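(* Let $\Omega=[0,1]^d$. For any $f\in X^{2,\infty}(\Omega)$ with $|f|_{2,\infty}\le 1$ and any $N,L\in\mathbb{N}_+$, there is a $\sigma$-NN $k$ with width $3^d\left(64d(N+3)(\log_2(8N))^{d+1}\right)$ and depth $(33L+2)(\log_2(4L))^{d+1}+2d$ such that $$\|k-f\|_{L_p(\Omega)}\le C N^{-4}L^{-4}(\log_2 N)^{d-1}(\log_2 L)^{d-1},$$ where $C$ is a constant independent of $N,L$, and polynomially dependent on the dimension $d$, and $1\le p\le\infty$.
   Context: Networks: $\sigma(x)=\max\{0,x\}$ (ReLU), applied componentwise to vectors. A $\sigma$-NN in $\mathbb{R}^d$ is a function $\phi:\mathbb{R}^d\to\mathbb{R}$ of the form $\tilde h_0=x$, $h_i=W_i\tilde h_{i-1}+b_i$ $(i=1,\dots,\ell+1)$, $\tilde h_i=\sigma(h_i)$ $(i=1,\dots,\ell)$, $\phi(x)=h_{\ell+1}$, with $W_i\in\mathbb{R}^{N_i\times N_{i-1}}$, $b_i\in\mathbb{R}^{N_i}$, $N_0=d$, $N_{\ell+1}=1$. "Width $W$ and depth $D$" means that all hidden layers have size $N_i\le W$ and the number of hidden layers satisfies $\ell\le D$. Korobov space: $X^{2,\infty}(\Omega)=\{f\in L_\infty(\Omega): f|_{\partial\Omega}=0,\ D^{\boldsymbol{k}}f\in L_\infty(\Omega)\text{ for all multi-indices }\boldsymbol{k}\in\mathbb{N}^d\text{ with }\max_j k_j\le 2\}$ (weak derivatives), with norm $|f|_{2,\infty}=\left\|\frac{\partial^{2d}f}{\partial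 x_1^2\cdots\partial x_d^2}\right\|_{L_\infty(\Omega)}$.
   Formalization: For d ≥ 2 the formal theorem requires N ≥ 2 and L ≥ 2 (all N, L ≥ 1 are kept for d = 1), because with N = 1 or L = 1 the printed bound is 0, which fails e.g. for f = ∏ x_i(1−x_i)/2. *)

theory Defs
  imports
    "HOL-Probability.Essential_Supremum"
    "HOL-Computational_Algebra.Polynomial"
    "Jordan_Normal_Form.Matrix"
begin

text \<open>The dimension \<open>d\<close> is quantified inside the theorem, because the constant is polynomially
  bounded in \<open>d\<close>.  Hence \<open>\<real>\<^sup>d\<close> is not an indexed type: its points are the functions
  \<open>nat \<Rightarrow> real\<close> that are \<open>undefined\<close> outside \<open>{..<d}\<close>, with the topology inherited from the product
  topology of \<open>nat \<Rightarrow> real\<close>.\<close>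

definition Rn :: "nat \<Rightarrow> (nat \<Rightarrow> real) set" where
  "Rn d = (\<Pi>\<^sub>E i\<in>{..<d}. UNIV)"

definition cube :: "nat \<Rightarrow> (nat \<Rightarrow> real) set" where
  "cube d = (\<Pi>\<^sub>E i\<in>{..<d}. {0..1})"

definition open_cube :: "nat \<Rightarrow> (nat \<Rightarrow> real) set" where
  "open_cube d = (\<Pi>\<^sub>E i\<in>{..<d}. {0<..<1})"

definition lebesgue_Rn :: "nat \<Rightarrow> (nat \<Rightarrow> real) measure" where
  "lebesgue_Rn d = completion (\<Pi>\<^sub>M i\<in>{..<d}. lborel)"

definition lebesgue_cube :: "nat \<Rightarrow> (nat \<Rightarrow> real) measure" where
  "lebesgue_cube d = restrict_space (lebesgue_Rn d) (cube d)"

text \<open>The \<open>L\<^sub>p\<close> norm for \<open>1 \<le> p \<le> \<infinity>\<close>, with value \<open>\<infinity>\<close> when it is not finite.\<close>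

definition Lp_norm :: "ennreal \<Rightarrow> 'a measure \<Rightarrow> ('a \<Rightarrow> real) \<Rightarrow> ennreal" where
  "Lp_norm p M g =
    (if p = \<infinity> then esssup M (\<lambda>x. ennreal \<bar>g x\<bar>)
     else let I = (\<integral>\<^sup>+ x. ennreal (\<bar>g x\<bar> powr enn2real p) \<partial>M)
          in if I = \<infinity> then \<infinity> else ennreal (enn2real I powr (1 / enn2real p)))"

definition L_infty :: "'a measure \<Rightarrow> ('a \<Rightarrow> real) set" where
  "L_infty M = {g \<in> borel_measurable M. Lp_norm \<infinity> M g < \<infinity>}"


subsection \<open>Weak derivatives on the open unit cube\<close>

definition partial_deriv :: "nat \<Rightarrow> ((nat \<Rightarrow> real) \<Rightarrow> real) \<Rightarrow> (nat \<Rightarrow> real) \<Rightarrow> real" where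
  "partial_deriv i \<phi> x = deriv (\<lambda>t. \<phi> (x(i := t))) (x i)"

text \<open>\<open>classical_D d k\<close> is \<open>\<partial>\<^sub>0\<^bsup>k 0\<^esup> \<dots> \<partial>\<^sub>d\<^sub>-\<^sub>1\<^bsup>k (d-1)\<^esup>\<close>; it is only applied to smooth functions, so the
  order of differentiation is irrelevant.  Only the values of \<open>k\<close> on \<open>{..<d}\<close> matter.\<close>

definition classical_D ::
    "nat \<Rightarrow> (nat \<Rightarrow> nat) \<Rightarrow> ((nat \<Rightarrow> real) \<Rightarrow> real) \<Rightarrow> (nat \<Rightarrow> real) \<Rightarrow> real" where
  "classical_D d k \<phi> = fold (\<lambda>i. partial_deriv i ^^ k i) [0..<d] \<phi>"

primrec C_times :: "nat \<Rightarrow> nat \<Rightarrow> ((nat \<Rightarrow> real) \<Rightarrow> real) \<Rightarrow> bool" where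
  "C_times d 0 \<phi> \<longleftrightarrow> continuous_on (Rn d) \<phi>"
| "C_times d (Suc m) \<phi> \<longleftrightarrow> continuous_on (Rn d) \<phi> \<and>
     (\<forall>i<d. (\<forall>x\<in>Rn d. (\<lambda>t. \<phi> (x(i := t))) differentiable (at (x i))) \<and>
            C_times d m (partial_deriv i \<phi>))"

definition test_function :: "nat \<Rightarrow> ((nat \<Rightarrow> real) \<Rightarrow> real) \<Rightarrow> bool" where
  "test_function d \<phi> \<longleftrightarrow> (\<forall>m. C_times d m \<phi>) \<and>
     (\<exists>K. compact K \<and> K \<subseteq> open_cube d \<and> (\<forall>x\<in>Rn d - K. \<phi> x = 0))"

definition locally_integrable :: "nat \<Rightarrow> ((nat \<Rightarrow> real) \<Rightarrow> real) \<Rightarrow> bool" where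
  "locally_integrable d g \<longleftrightarrow>
     (\<forall>K. compact K \<and> K \<subseteq> open_cube d \<longrightarrow> set_integrable (lebesgue_Rn d) K g)"

definition is_weak_deriv ::
    "nat \<Rightarrow> (nat \<Rightarrow> nat) \<Rightarrow> ((nat \<Rightarrow> real) \<Rightarrow> real) \<Rightarrow> ((nat \<Rightarrow> real) \<Rightarrow> real) \<Rightarrow> bool" where
  "is_weak_deriv d k f g \<longleftrightarrow> locally_integrable d f \<and> locally_integrable d g \<and>
     (\<forall>\<phi>. test_function d \<phi> \<longrightarrow>
        (LINT x:open_cube d|lebesgue_Rn d. f x * classical_D d k \<phi> x) =
        (-1) ^ (\<Sum>i<d. k i) * (LINT x:open_cube d|lebesgue_Rn d. g x * \<phi> x))"

text \<open>Weak derivatives are unique up to null sets, so the choice does not affect essential suprema.\<close>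

definition weak_deriv ::
    "nat \<Rightarrow> (nat \<Rightarrow> nat) \<Rightarrow> ((nat \<Rightarrow> real) \<Rightarrow> real) \<Rightarrow> (nat \<Rightarrow> real) \<Rightarrow> real" where
  "weak_deriv d k f = (SOME g. is_weak_deriv d k f g)"


subsection \<open>Korobov space\<close>

text \<open>An element of \<open>L\<^sub>\<infinity>\<close> is only determined up to null sets, and the boundary is a null set.  Boundary
  values are those of the continuous representative; it exists for every \<open>f\<close> satisfying the other two
  conditions, since all first-order weak derivatives of such \<open>f\<close> are bounded.\<close>

definition zero_on_boundary :: "nat \<Rightarrow> ((nat \<Rightarrow> real) \<Rightarrow> real) \<Rightarrow> bool" where
  "zero_on_boundary d f \<longleftrightarrow>
     (\<exists>g. continuous_on (cube d) g \<and> (AE x in lebesgue_cube d. f x = g x) \<and>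
          (\<forall>x \<in> cube d - open_cube d. g x = 0))"

definition korobov_space :: "nat \<Rightarrow> ((nat \<Rightarrow> real) \<Rightarrow> real) set" where
  "korobov_space d = {f \<in> L_infty (lebesgue_cube d). zero_on_boundary d f \<and>
     (\<forall>k. (\<forall>j<d. k j \<le> 2) \<longrightarrow>
        (\<exists>g. is_weak_deriv d k f g \<and> g \<in> L_infty (lebesgue_cube d)))}"

definition korobov_norm :: "nat \<Rightarrow> ((nat \<Rightarrow> real) \<Rightarrow> real) \<Rightarrow> ennreal" where
  "korobov_norm d f = Lp_norm \<infinity> (lebesgue_cube d) (weak_deriv d (\<lambda>_. 2) f)"


subsection \<open>ReLU networks\<close>

definition relu :: "real \<Rightarrow> real" where
  "relu x = max 0 x"

primrec hidden_layer ::
    "(nat \<Rightarrow> real mat) \<Rightarrow> (nat \<Rightarrow> real Matrix.vec) \<Rightarrow> real Matrix.vec \<Rightarrow> nat \<Rightarrow> real Matrix.vec" where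
  "hidden_layer W b x 0 = x"
| "hidden_layer W b x (Suc i) = map_vec relu (W (Suc i) *\<^sub>v hidden_layer W b x i + b (Suc i))"

definition relu_network :: "nat \<Rightarrow> real \<Rightarrow> real \<Rightarrow> ((nat \<Rightarrow> real) \<Rightarrow> real) \<Rightarrow> bool" where
  "relu_network d width depth \<phi> \<longleftrightarrow>
     (\<exists>(l::nat) (n :: nat \<Rightarrow> nat) W b.
        n 0 = d \<and> n (l + 1) = 1 \<and>
        (\<forall>i\<in>{1..l + 1}. W i \<in> carrier_mat (n i) (n (i - 1)) \<and> b i \<in> carrier_vec (n i)) \<and>
        (\<forall>i\<in>{1..l}. real (n i) \<le> width) \<and> real l \<le> depth \<and>
        (\<forall>x\<in>Rn d. \<phi> x =
           vec_index (W (l + 1) *\<^sub>v hidden_layer W b (Matrix.vec d x) l + b (l + 1)) 0))"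

end

theory Submission
  imports Defs
begin

text \<open>Testing the weak derivative of order \<open>(2,\<dots>,2)\<close> against tensor products of mollified hat functions shows
  that the hierarchical coefficients of the continuous representative on level \<open>m\<close> (with \<open>2^m j\<close> cells in
  coordinate \<open>j\<close>) are at most \<open>2^-d 4^-|m|\<close>. Hence only the levels with \<open>|m| \<le> n\<close> matter, where \<open>2^n\<close> is
  about \<open>N\<^sup>2L\<^sup>2\<close>, and each of them has at most \<open>2^n\<close> cells. On one level a network extracts the digits of the
  cell index of the input, looks the coefficient up in a table of \<open>N\<^sup>2L\<^sup>2\<close> entries (with width \<open>O(N)\<close> and
  depth \<open>O(L log L)\<close>, by digit extraction in a base of about \<open>N\<close>), and multiplies it by the hats. The index is
  wrong close to the cell boundaries, but there the hats are small, so this is harmless in the supremum norm.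
  The levels, at most \<open>(n + 1)^d\<close> many, are split into groups, parallel within a group and serial across groups.\<close>

subsection \<open>Affine spans and networks\<close>

inductive_set aff :: "('a \<Rightarrow> real) set \<Rightarrow> ('a \<Rightarrow> real) set" for G where
  aff_base: "g \<in> G \<Longrightarrow> g \<in> aff G"
| aff_const: "(\<lambda>x. c) \<in> aff G"
| aff_add: "f \<in> aff G \<Longrightarrow> g \<in> aff G \<Longrightarrow> (\<lambda>x. f x + g x) \<in> aff G"
| aff_scale: "f \<in> aff G \<Longrightarrow> (\<lambda>x. c * f x) \<in> aff G"

lemma aff_trans: "f \<in> aff F \<Longrightarrow> F \<subseteq> aff G \<Longrightarrow> f \<in> aff G"
  by (induction rule: aff.induct) (auto intro: aff.intros)

lemma aff_mono: "f \<in> aff F \<Longrightarrow> F \<subseteq> G \<Longrightarrow> f \<in> aff G"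
  by (rule aff_trans) (auto intro: aff_base)

lemma aff_subset_trans: "E \<subseteq> aff F \<Longrightarrow> F \<subseteq> aff G \<Longrightarrow> E \<subseteq> aff G"
  using aff_trans by blast

lemma aff_mono_subset: "F \<subseteq> G \<Longrightarrow> aff F \<subseteq> aff G"
  using aff_mono by blast

lemma aff_minus: "f \<in> aff G \<Longrightarrow> (\<lambda>x. - f x) \<in> aff G"
  using aff_scale[of f G "-1"] by simp

lemma aff_diff: "f \<in> aff G \<Longrightarrow> g \<in> aff G \<Longrightarrow> (\<lambda>x. f x - g x) \<in> aff G"
  using aff_add[OF _ aff_minus, of f G g] by simp

lemma aff_divide: "f \<in> aff G \<Longrightarrow> (\<lambda>x. f x / c) \<in> aff G"
  using aff_scale[of f G "1 / c"] by simp

lemma aff_scale_right: "f \<in> aff G \<Longrightarrow> (\<lambda>x. f x * c) \<in> aff G"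
  using aff_scale[of f G c] by (simp add: mult.commute)

lemma aff_sum: "(\<And>i. i \<in> I \<Longrightarrow> f i \<in> aff G) \<Longrightarrow> (\<lambda>x. \<Sum>i\<in>I. f i x) \<in> aff G"
  by (induction I rule: infinite_finite_induct) (auto intro: aff.intros)

lemmas aff_intros = aff_base aff_const aff_add aff_scale aff_minus aff_diff aff_divide
  aff_scale_right aff_sum

text \<open>Coefficients become explicit only here, for the weight matrices. Everywhere else
  membership in \<open>aff\<close> is proved by rules that follow the shape of the term, which is
  why the span is inductive.\<close>

lemma aff_finite_repr:
  assumes "f \<in> aff G" "finite G"
  shows "\<exists>c b. \<forall>x. f x = b + (\<Sum>g\<in>G. c g * g x)"
  using assms(1)
proof (induction rule: aff.induct)
  case (aff_base g)
  have "\<forall>x. g x = 0 + (\<Sum>h\<in>G. (if h = g then 1 else 0) * h x)"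
    using aff_base assms(2) by (simp add: if_distrib[of "\<lambda>u. u * _"] cong: if_cong)
  then show ?case by - (rule exI[where x = "\<lambda>h. if h = g then 1 else 0"], rule exI[where x = 0])
next
  case (aff_const c)
  have "\<forall>x. c = c + (\<Sum>h\<in>G. 0 * h x)" by simp
  then show ?case by - (rule exI[where x = "\<lambda>h. 0"], rule exI[where x = c])
next
  case (aff_add f g)
  from aff_add.IH(1) obtain c b where 1: "\<forall>x. f x = b + (\<Sum>h\<in>G. c h * h x)" by (elim exE)
  from aff_add.IH(2) obtain c' b' where "\<forall>x. g x = b' + (\<Sum>h\<in>G. c' h * h x)" by (elim exE)
  with 1 have "\<forall>x. f x + g x = (b + b') + (\<Sum>h\<in>G. (c h + c' h) * h x)"
    by (simp add: sum.distrib algebra_simps)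
  then show ?case by - (rule exI[where x = "\<lambda>h. c h + c' h"], rule exI[where x = "b + b'"])
next
  case (aff_scale f k)
  from aff_scale.IH obtain c b where "\<forall>x. f x = b + (\<Sum>h\<in>G. c h * h x)" by (elim exE)
  then have "\<forall>x. k * f x = k * b + (\<Sum>h\<in>G. (k * c h) * h x)"
    by (simp add: sum_distrib_left algebra_simps)
  then show ?case by - (rule exI[where x = "\<lambda>h. k * c h"], rule exI[where x = "k * b"])
qed

text \<open>\<open>net G W D F\<close>: all functions in \<open>F\<close> are affine outputs of one network with inputs \<open>G\<close> that
  has exactly \<open>D\<close> hidden layers, all of size at most \<open>W\<close>.\<close>

inductive net :: "('a \<Rightarrow> real) set \<Rightarrow> nat \<Rightarrow> nat \<Rightarrow> ('a \<Rightarrow> real) set \<Rightarrow> bool" for G W where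
  net_0: "F \<subseteq> aff G \<Longrightarrow> net G W 0 F"
| net_Suc: "net G W D E \<Longrightarrow> finite H \<Longrightarrow> card H \<le> W \<Longrightarrow>
    (\<And>h. h \<in> H \<Longrightarrow> \<exists>f\<in>aff E. h = (\<lambda>x. relu (f x))) \<Longrightarrow> F \<subseteq> aff H \<Longrightarrow> net G W (Suc D) F"

lemma net_aff: "net G W D F \<Longrightarrow> E \<subseteq> aff F \<Longrightarrow> net G W D E"
proof (induction rule: net.cases)
  case (net_0 F)
  then show ?case using net.net_0 aff_subset_trans by metis
next
  case (net_Suc D E' H F)
  have "E \<subseteq> aff H" using aff_subset_trans net_Suc by metis
  then show ?case using net_Suc net.net_Suc[of G W D E' H E] by auto
qed

lemma net_subset: "net G W D F \<Longrightarrow> E \<subseteq> F \<Longrightarrow> net G W D E"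
  by (erule net_aff) (auto intro: aff_base)

lemma net_mono: "net G W D F \<Longrightarrow> W \<le> W' \<Longrightarrow> net G W' D F"
proof (induction rule: net.induct)
  case (net_Suc D E H F)
  then show ?case using net.net_Suc[of G W' D E H F] by auto
qed (rule net_0)

text \<open>Composition costs no layer at the seam: the affine output of the first network is
  absorbed by the affine part of the next layer.\<close>

lemma net_trans: "net E W D' F \<Longrightarrow> net G W D E \<Longrightarrow> net G W (D + D') F"
proof (induction rule: net.induct)
  case (net_0 F)
  then show ?case by (auto intro: net_aff)
next
  case (net_Suc D'' E' H F)
  then show ?case using net.net_Suc[of G W "D + D''" E' H F] by auto
qed

lemma relu_of_nonneg: "0 \<le> x \<Longrightarrow> relu x = x"
  and relu_of_nonpos: "x \<le> 0 \<Longrightarrow> relu x = 0"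
  by (auto simp: relu_def)

lemma relu_diff_relu_minus: "x = relu x - relu (- x)"
  by (auto simp: relu_def)

lemma abs_eq_relu: "\<bar>x\<bar> = relu x + relu (- x)"
  by (auto simp: relu_def)

text \<open>The layer count in \<open>net\<close> is exact, so the two networks advance in step and
  their neuron sets can be united layer by layer.\<close>

lemma net_Un:
  "net G W1 D F1 \<Longrightarrow> net G W2 D F2 \<Longrightarrow> net G (W1 + W2) D (F1 \<union> F2)"
proof (induction arbitrary: F2 rule: net.induct)
  case (net_0 F)
  from net_0(2) have "F2 \<subseteq> aff G" by cases
  then show ?case using net_0 by (auto intro!: net.net_0)
next
  case (net_Suc D E1 H1 F1)
  from net_Suc.prems obtain E2 H2 where *: "net G W2 D E2" "finite H2" "card H2 \<le> W2"
     "\<And>h. h \<in> H2 \<Longrightarrow> \<exists>f\<in>aff E2. h = (\<lambda>x. relu (f x))" "F2 \<subseteq> aff H2"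
    by (cases rule: net.cases) auto
  show ?case
  proof (rule net.net_Suc[of G "W1 + W2" D "E1 \<union> E2" "H1 \<union> H2"])
    show "net G (W1 + W2) D (E1 \<union> E2)" using net_Suc.IH *(1) by blast
    show "finite (H1 \<union> H2)" using net_Suc *(2) by auto
    show "card (H1 \<union> H2) \<le> W1 + W2"
      using card_Un_le[of H1 H2] net_Suc *(3) by linarith
    show "\<exists>f\<in>aff (E1 \<union> E2). h = (\<lambda>x. relu (f x))" if "h \<in> H1 \<union> H2" for h
      using that net_Suc(4) *(4) aff_mono_subset[of E1 "E1 \<union> E2"] aff_mono_subset[of E2 "E1 \<union> E2"]
      by blast
    show "F1 \<union> F2 \<subseteq> aff (H1 \<union> H2)"
      using net_Suc(5) *(5) aff_mono_subset[of H1 "H1 \<union> H2"] aff_mono_subset[of H2 "H1 \<union> H2"]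
      by blast
  qed
qed

lemma net_empty: "net G W D {}"
  by (induction D) (auto intro: net.intros intro!: net_Suc[of _ _ _ "{}" "{}"])

lemma net_UN:
  assumes "finite I" "\<And>i. i \<in> I \<Longrightarrow> net G W D (F i)"
  shows "net G (card I * W) D (\<Union>i\<in>I. F i)"
  using assms
proof (induction I rule: finite_induct)
  case empty
  then show ?case by (simp add: net_empty)
next
  case (insert i I)
  have "net G (W + card I * W) D (F i \<union> (\<Union>i\<in>I. F i))"
    by (rule net_Un) (use insert in auto)
  then show ?case using insert by simp
qed

lemma net_layer:
  assumes "finite H" "card H \<le> W" "H \<subseteq> aff G" "F \<subseteq> aff ((\<lambda>f x. relu (f x)) ` H)"
  shows "net G W 1 F"
proof -
  have "net G W 0 G" by (rule net_0) (auto intro: aff_base)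
  then have "net G W (Suc 0) F"
    by (rule net_Suc[where H = "(\<lambda>f x. relu (f x)) ` H"])
       (use assms card_image_le[of H] in \<open>auto intro: order_trans\<close>)
  then show ?thesis by simp
qed

lemma net_layer_family:
  assumes "finite I" "card I \<le> W" "\<And>i. i \<in> I \<Longrightarrow> h i \<in> aff G"
    "F \<subseteq> aff ((\<lambda>i x. relu (h i x)) ` I)"
  shows "net G W 1 F"
proof (rule net_layer[where H = "h ` I"])
  show "card (h ` I) \<le> W" using card_image_le[OF assms(1), of h] assms(2) by simp
qed (use assms in \<open>auto simp: image_image\<close>)

text \<open>A value passes through a ReLU layer as \<open>relu f - relu (- f)\<close>, at two
  neurons each. This delays values and carries intermediate results past other computations.\<close>

lemma net_id: "finite C \<Longrightarrow> C \<subseteq> aff G \<Longrightarrow> net G (2 * card C) D C"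
proof (induction D arbitrary: G)
  case 0
  then show ?case by (auto intro: net_0)
next
  case (Suc D)
  let ?H = "C \<union> (\<lambda>f x. - f x) ` C"
  have 1: "net G (2 * card C) 1 C"
  proof (rule net_layer[of ?H])
    show "card ?H \<le> 2 * card C"
      using card_Un_le[of C "(\<lambda>f x. - f x) ` C"] card_image_le[of C "\<lambda>f x. - f x"] Suc by linarith
    show "?H \<subseteq> aff G" using Suc by (auto intro: aff_minus)
    show "C \<subseteq> aff ((\<lambda>f x. relu (f x)) ` ?H)"
    proof
      fix f assume f: "f \<in> C"
      have "(\<lambda>x. relu (f x) - relu (- f x)) \<in> aff ((\<lambda>f x. relu (f x)) ` ?H)"
        using f by (intro aff_diff aff_base) (auto simp: image_iff)
      then show "f \<in> aff ((\<lambda>f x. relu (f x)) ` ?H)"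
        using relu_diff_relu_minus by simp
    qed
  qed (use Suc in auto)
  have "net C (2 * card C) D C" by (rule Suc.IH) (use Suc in \<open>auto intro: aff_base\<close>)
  from net_trans[OF this 1] show ?case by simp
qed

lemma net_carry:
  assumes "net G W D F" "finite C" "C \<subseteq> aff G"
  shows "net G (W + 2 * card C) D (F \<union> C)"
  by (rule net_Un[OF assms(1) net_id[OF assms(2,3)]])

lemma net_iterate:
  assumes "\<And>i. i < k \<Longrightarrow> net (F i) W D (F (Suc i))"
  shows "net (F 0) W (k * D) (F k)"
  using assms
proof (induction k)
  case 0
  then show ?case by (auto intro: net_0 aff_base)
next
  case (Suc k)
  from net_trans[OF Suc.prems[of k] Suc.IH] Suc.prems show ?case by (simp add: add.commute)
qed

text \<open>The trade of width for depth: the \<open>k\<close> networks run one after another, while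
  a running sum and the inputs \<open>G\<close> are carried along at two neurons per value.\<close>

lemma net_serial_sum:
  assumes "finite G" "\<And>i. i < k \<Longrightarrow> net G W D {f i}"
  shows "net G (W + 2 * (card G + 1)) (k * D) ({\<lambda>x. \<Sum>i<k. f i x} \<union> G)"
proof -
  define F where "F i = {\<lambda>x. \<Sum>j<i. f j x} \<union> G" for i
  have "net (F i) (W + 2 * (card G + 1)) D (F (Suc i))" if i: "i < k" for i
  proof -
    have "net (F i) W 0 G" by (rule net_0) (auto intro: aff_base simp: F_def)
    from net_trans[OF assms(2)[OF i] this] have "net (F i) W D {f i}" by simp
    from net_carry[OF this, of "F i"]
    have "net (F i) (W + 2 * card (F i)) D ({f i} \<union> F i)"
      using assms(1) by (auto simp: F_def intro: aff_base)
    moreover have "card (F i) \<le> card G + 1"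
      unfolding F_def using card_Un_le[of "{\<lambda>x. \<Sum>j<i. f j x}" G] by simp
    ultimately have "net (F i) (W + 2 * (card G + 1)) D ({f i} \<union> F i)"
      by (auto elim: net_mono)
    then show ?thesis
    proof (rule net_aff)
      have "(\<lambda>x. (\<Sum>j<i. f j x) + f i x) \<in> aff ({f i} \<union> F i)"
        by (intro aff_add aff_base) (auto simp: F_def)
      then show "F (Suc i) \<subseteq> aff ({f i} \<union> F i)"
        by (auto simp: F_def intro: aff_base)
    qed
  qed
  from net_iterate[of k F, OF this] 
  have "net (F 0) (W + 2 * (card G + 1)) (k * D) (F k)" .
  moreover have "net G (W + 2 * (card G + 1)) 0 (F 0)"
    by (rule net_0) (auto simp: F_def intro: aff_base aff_const)
  ultimately show ?thesis using net_trans unfolding F_def by fastforce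
qed

section \<open>From inductive networks to weight matrices\<close>

lemma hidden_layer_cong:
  "(\<And>j. 1 \<le> j \<Longrightarrow> j \<le> i \<Longrightarrow> W j = W' j \<and> b j = b' j) \<Longrightarrow>
    hidden_layer W b x i = hidden_layer W' b' x i"
  by (induction i) auto

lemma aff_list_repr:
  assumes "f \<in> aff (set hs)" "distinct hs"
  obtains a b where "\<And>x. f x = (\<Sum>j<length hs. a j * (hs ! j) x) + b"
proof -
  from aff_finite_repr[OF assms(1) finite_set] obtain c b where 1: "\<forall>x. f x = b + (\<Sum>g\<in>set hs. c g * g x)"
    by (elim exE) auto
  have "f x = (\<Sum>j<length hs. c (hs ! j) * (hs ! j) x) + b" for x
  proof -
    have "(\<Sum>g\<in>set hs. c g * g x) = (\<Sum>j<length hs. c (hs ! j) * (hs ! j) x)"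
      using sum.reindex_bij_betw[OF bij_betw_nth[OF assms(2) refl refl], of "\<lambda>g. c g * g x"] by simp
    then show ?thesis using 1 by simp
  qed
  then show ?thesis by (rule that)
qed

text \<open>Neurons are functions, so width counts distinct functions. Listing them without
  repetition lets a position in \<open>hs\<close> act as a row index of the matrices.\<close>

lemma relu_network_layers:
  assumes "net ((\<lambda>i x. x i) ` {..<d}) W D F"
  shows "\<exists>n Wt b hs. n 0 = d \<and>
    (\<forall>i\<in>{1..D}. n i \<le> W \<and> Wt i \<in> carrier_mat (n i) (n (i - 1)) \<and> b i \<in> carrier_vec (n i)) \<and>
    length hs = n D \<and> distinct hs \<and> F \<subseteq> aff (set hs) \<and>
    (\<forall>x. hidden_layer Wt b (Matrix.vec d x) D = Matrix.vec (n D) (\<lambda>j. (hs ! j) x))"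
  using assms
proof (induction rule: net.induct)
  case (net_0 F)
  let ?hs = "map (\<lambda>i x. x i) [0..<d] :: ((nat \<Rightarrow> real) \<Rightarrow> real) list"
  \<comment> \<open>Different coordinates must be different functions, or the list of inputs would
    not be distinct.\<close>
  have inj: "inj (\<lambda>i (x :: nat \<Rightarrow> real). x i)"
  proof (rule injI)
    fix i j :: nat assume "(\<lambda>x :: nat \<Rightarrow> real. x i) = (\<lambda>x. x j)"
    from fun_cong[OF this, of "\<lambda>k. if k = i then 1 else 0"] show "i = j"
      by (simp split: if_splits)
  qed
  have "set ?hs = (\<lambda>i x. x i) ` {..<d}" by auto
  moreover have "distinct ?hs" using inj_on_subset[OF inj] by (auto simp: distinct_map)
  ultimately show ?case using net_0
    by (intro exI[of _ "\<lambda>_. d"], simp) (intro exI[of _ ?hs], auto)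
next
  case (net_Suc D E H F)
  from net_Suc.IH obtain n Wt b hs where *: "n 0 = d"
    "\<And>i. i \<in> {1..D} \<Longrightarrow> n i \<le> W \<and> Wt i \<in> carrier_mat (n i) (n (i - 1)) \<and> b i \<in> carrier_vec (n i)"
    "length hs = n D" "distinct hs" "E \<subseteq> aff (set hs)"
    "\<And>x. hidden_layer Wt b (Matrix.vec d x) D = Matrix.vec (n D) (\<lambda>j. (hs ! j) x)"
    by (elim exE conjE) metis
  obtain gs where gs: "set gs = H" "distinct gs" "length gs = card H"
    using finite_distinct_list[OF net_Suc(2)] distinct_card by metis
  have "\<forall>i<length gs. \<exists>a c. \<forall>x. (gs ! i) x = relu ((\<Sum>j<length hs. a j * (hs ! j) x) + c)"
  proof (intro allI impI)
    fix i assume "i < length gs"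
    then have "gs ! i \<in> H" using gs(1) by auto
    then obtain f where f: "f \<in> aff E" "gs ! i = (\<lambda>x. relu (f x))" using net_Suc(4) by blast
    obtain a c where "\<And>x. f x = (\<Sum>j<length hs. a j * (hs ! j) x) + c"
      using aff_list_repr[OF aff_trans[OF f(1) *(5)] *(4)] by metis
    then show "\<exists>a c. \<forall>x. (gs ! i) x = relu ((\<Sum>j<length hs. a j * (hs ! j) x) + c)"
      using f(2) by auto
  qed
  then obtain a c where ac: "\<And>i x. i < length gs \<Longrightarrow>
      (gs ! i) x = relu ((\<Sum>j<length hs. a i j * (hs ! j) x) + c i)"
    by metis
  define A where "A = Matrix.mat (card H) (n D) (\<lambda>(i, j). a i j)"
  define v where "v = Matrix.vec (card H) c"
  define n' where "n' = n(Suc D := card H)"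
  define Wt' where "Wt' = Wt(Suc D := A)"
  define b' where "b' = b(Suc D := v)"
  have "hidden_layer Wt' b' (Matrix.vec d x) (Suc D) = Matrix.vec (n' (Suc D)) (\<lambda>j. (gs ! j) x)" for x
  proof -
    have "hidden_layer Wt' b' (Matrix.vec d x) D = hidden_layer Wt b (Matrix.vec d x) D"
      by (rule hidden_layer_cong) (auto simp: Wt'_def b'_def)
    then show ?thesis
      using *(3) gs(3) ac *(6)
      by (intro eq_vecI) (auto simp: Wt'_def b'_def A_def v_def n'_def scalar_prod_def atLeast0LessThan)
  qed
  moreover have "n' i \<le> W \<and> Wt' i \<in> carrier_mat (n' i) (n' (i - 1)) \<and> b' i \<in> carrier_vec (n' i)"
    if "i \<in> {1..Suc D}" for i
  proof (cases "i = Suc D")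
    case True
    then show ?thesis using net_Suc(3) by (auto simp: n'_def Wt'_def b'_def A_def v_def)
  next
    case False
    then have "i \<in> {1..D}" using that by auto
    then have "n' i = n i" "n' (i - 1) = n (i - 1)" "Wt' i = Wt i" "b' i = b i"
      using False by (auto simp: n'_def Wt'_def b'_def)
    then show ?thesis using *(2)[OF \<open>i \<in> {1..D}\<close>] by simp
  qed
  ultimately show ?case using gs net_Suc(5) *(1)
    by (intro exI[of _ n'] exI[of _ Wt'] exI[of _ b'] exI[of _ gs]) (auto simp: n'_def)
qed

lemma relu_network_of_net:
  assumes "net ((\<lambda>i x. x i) ` {..<d}) W D F" "f \<in> aff F" "real W \<le> w" "real D \<le> t"
  shows "relu_network d w t f"
proof -
  from relu_network_layers[OF assms(1)] obtain n Wt b hs where *: "n 0 = d"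
    "\<And>i. i \<in> {1..D} \<Longrightarrow> n i \<le> W \<and> Wt i \<in> carrier_mat (n i) (n (i - 1)) \<and> b i \<in> carrier_vec (n i)"
    "length hs = n D" "distinct hs" "F \<subseteq> aff (set hs)"
    "\<And>x. hidden_layer Wt b (Matrix.vec d x) D = Matrix.vec (n D) (\<lambda>j. (hs ! j) x)"
    by (elim exE conjE) metis
  obtain a c where ac: "\<And>x. f x = (\<Sum>j<length hs. a j * (hs ! j) x) + c"
    using aff_list_repr[OF aff_trans[OF assms(2) *(5)] *(4)] by metis
  define n' where "n' = n(D + 1 := 1)"
  define Wt' where "Wt' = Wt(D + 1 := Matrix.mat 1 (n D) (\<lambda>(i, j). a j))"
  define b' where "b' = b(D + 1 := Matrix.vec 1 (\<lambda>_. c))"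
  have in_D: "i \<in> {1..D}" if "i \<in> {1..D + 1}" "i \<noteq> D + 1" for i using that by auto
  show ?thesis unfolding relu_network_def
  proof (intro exI[of _ D] exI[of _ n'] exI[of _ Wt'] exI[of _ b'] conjI ballI)
    fix i assume i: "i \<in> {1..D + 1}"
    show "Wt' i \<in> carrier_mat (n' i) (n' (i - 1))"
      using *(2)[OF in_D[OF i]] i by (cases "i = D + 1") (auto simp: n'_def Wt'_def)
    show "b' i \<in> carrier_vec (n' i)"
      using *(2)[OF in_D[OF i]] i by (cases "i = D + 1") (auto simp: n'_def b'_def)
  next
    fix i assume "i \<in> {1..D}"
    then show "real (n' i) \<le> w" using *(2)[of i] assms(3) by (auto simp: n'_def)
  next
    fix x
    have "hidden_layer Wt' b' (Matrix.vec d x) D = hidden_layer Wt b (Matrix.vec d x) D"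
      by (rule hidden_layer_cong) (auto simp: Wt'_def b'_def)
    then show "f x = vec_index (Wt' (D + 1) *\<^sub>v hidden_layer Wt' b' (Matrix.vec d x) D + b' (D + 1)) 0"
      using *(3) by (auto simp: *(6) ac Wt'_def b'_def scalar_prod_def atLeast0LessThan)
  qed (use * assms in \<open>auto simp: n'_def\<close>)
qed

section \<open>Measurability of networks\<close>

lemma aff_measurable: "f \<in> aff G \<Longrightarrow> (\<And>g. g \<in> G \<Longrightarrow> g \<in> borel_measurable M) \<Longrightarrow> f \<in> borel_measurable M"
  by (induction rule: aff.induct) auto

lemma net_measurable:
  assumes "net G W D F" "\<And>g. g \<in> G \<Longrightarrow> g \<in> borel_measurable M" "f \<in> F"
  shows "f \<in> borel_measurable M"
  using assms
proof (induction arbitrary: f rule: net.induct)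
  case (net_0 F)
  then show ?case using aff_measurable by blast
next
  case (net_Suc D E H F)
  have [measurable]: "relu \<in> borel_measurable borel" unfolding relu_def by measurable
  have "h \<in> borel_measurable M" if h: "h \<in> H" for h
  proof -
    obtain f where f: "f \<in> aff E" "h = (\<lambda>x. relu (f x))" using net_Suc(4)[OF h] by blast
    have [measurable]: "f \<in> borel_measurable M"
      by (rule aff_measurable[OF f(1) net_Suc.IH[OF net_Suc.prems(1)]])
    show ?thesis unfolding f(2) by measurable
  qed
  with net_Suc.prems net_Suc(5) show ?case using aff_measurable by blast
qed

subsection \<open>Piecewise linear functions and products\<close>

definition clamp01 :: "real \<Rightarrow> real" where "clamp01 t = min 1 (max 0 t)"

lemma clamp01_relu: "clamp01 t = relu t - relu (t - 1)"
  by (auto simp: clamp01_def relu_def)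

lemma clamp01_bounds: "0 \<le> clamp01 t" "clamp01 t \<le> 1"
  by (auto simp: clamp01_def)

lemma clamp01_id: "0 \<le> t \<Longrightarrow> t \<le> 1 \<Longrightarrow> clamp01 t = t"
  by (auto simp: clamp01_def)

lemma net_clamp01:
  assumes "f \<in> aff G" shows "net G 2 1 {\<lambda>x. clamp01 (f x)}"
proof (rule net_layer[where H = "{f, \<lambda>x. f x - 1}"])
  have "(\<lambda>x. relu (f x) - relu (f x - 1)) \<in> aff ((\<lambda>f x. relu (f x)) ` {f, \<lambda>x. f x - 1})"
    by (intro aff_diff aff_base) auto
  then show "{\<lambda>x. clamp01 (f x)} \<subseteq> aff ((\<lambda>f x. relu (f x)) ` {f, \<lambda>x. f x - 1})"
    by (simp add: clamp01_relu)
qed (use assms in \<open>auto intro: aff_intros simp: card_insert_if\<close>)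

text \<open>The distance to the nearest even integer.\<close>

definition zigzag :: "real \<Rightarrow> real" where
  "zigzag y = (if even \<lfloor>y\<rfloor> then frac y else 1 - frac y)"

lemma zigzag_bounds: "0 \<le> zigzag y" "zigzag y \<le> 1"
  using frac_lt_1[of y] frac_ge_0[of y] by (auto simp: zigzag_def)

lemma zigzag_minus: "zigzag (- y) = zigzag y"
proof (cases "y \<in> \<int>")
  case True
  then show ?thesis by (auto simp: zigzag_def frac_neg elim!: Ints_cases)
next
  case False
  then have "\<lfloor>- y\<rfloor> = - \<lfloor>y\<rfloor> - 1" "frac (- y) = 1 - frac y"
    by (auto simp: frac_neg floor_minus ceiling_altdef Ints_def)
  then show ?thesis by (auto simp: zigzag_def)
qed

lemma zigzag_add_even: "even k \<Longrightarrow> zigzag (of_int k + y) = zigzag y"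
  by (auto simp: zigzag_def frac_def)

text \<open>Folding first does not change the result since \<open>zigzag\<close> is even and has
  period 2: on an odd cell, reflect and shift by the even integer \<open>R * (floor y + 1)\<close>.
  High frequencies thus arise by composing low ones.\<close>

lemma zigzag_mult: "zigzag (real R * zigzag y) = zigzag (real R * y)"
proof (cases "even \<lfloor>y\<rfloor>")
  case True
  have "zigzag (real R * y) = zigzag (of_int (int R * \<lfloor>y\<rfloor>) + real R * frac y)"
    by (simp add: frac_def algebra_simps)
  also have "\<dots> = zigzag (real R * frac y)" using True by (intro zigzag_add_even) auto
  finally show ?thesis using True by (simp add: zigzag_def[of y])
next
  case False
  have "zigzag (real R * y) = zigzag (- (real R * y))" by (simp add: zigzag_minus)
  also have "\<dots> = zigzag (of_int (int R * (\<lfloor>y\<rfloor> + 1)) + - (real R * y))"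
    using False by (intro zigzag_add_even[symmetric]) auto
  also have "of_int (int R * (\<lfloor>y\<rfloor> + 1)) + - (real R * y) = real R * (1 - frac y)"
    by (simp add: frac_def algebra_simps)
  finally show ?thesis using False by (simp add: zigzag_def[of y])
qed

lemma zigzag_piece:
  assumes "real k \<le> y" "y \<le> real k + 1"
  shows "zigzag y = (if even k then y - real k else 1 - (y - real k))"
proof (cases "y = real k + 1")
  case True
  then have "\<lfloor>y\<rfloor> = int k + 1" by linarith
  then show ?thesis using True by (simp add: zigzag_def frac_def)
next
  case False
  then have "\<lfloor>y\<rfloor> = int k" using assms by linarith
  then show ?thesis by (simp add: zigzag_def frac_def)
qed

lemma zigzag_id: "0 \<le> y \<Longrightarrow> y \<le> 1 \<Longrightarrow> zigzag y = y"
  using zigzag_piece[of 0 y] by simp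

text \<open>The tent over each unit cell in terms of the position in the cell. It serves both to
  match interpolation increments and to see that the tent is small where the fractional part is
  close to 1.\<close>

lemma zigzag_double: "zigzag (2 * y) = 1 - \<bar>2 * frac y - 1\<bar>"
proof (cases "frac y < 1 / 2")
  case True
  then have "\<lfloor>2 * y\<rfloor> = 2 * \<lfloor>y\<rfloor>"
    using frac_ge_0[of y] unfolding frac_def by (intro floor_unique) auto
  then show ?thesis using True by (auto simp: zigzag_def frac_def)
next
  case False
  then have "\<lfloor>2 * y\<rfloor> = 2 * \<lfloor>y\<rfloor> + 1"
    using frac_lt_1[of y] unfolding frac_def by (intro floor_unique) auto
  then show ?thesis using False by (auto simp: zigzag_def frac_def)
qed

text \<open>Neighbouring cells are closed and share their endpoint, which builds continuity into the
  definition; \<open>s k\<close> is the slope on cell \<open>k\<close>.\<close>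

definition cpwl :: "nat \<Rightarrow> (real \<Rightarrow> real) \<Rightarrow> bool" where
  "cpwl M F \<longleftrightarrow> (\<exists>s. \<forall>k<M. \<forall>t. real k / real M \<le> t \<longrightarrow> t \<le> (real k + 1) / real M \<longrightarrow>
      F t = F (real k / real M) + s k * (t - real k / real M))"

lemma unit_interval_cell:
  assumes "0 \<le> t" "t \<le> (1::real)" "0 < M"
  obtains k where "k < M" "real k / real M \<le> t" "t \<le> (real k + 1) / real M"
proof (cases "t = 1")
  case True
  show ?thesis by (rule that[of "M - 1"]) (use assms True in \<open>auto simp: field_simps of_nat_diff\<close>)
next
  case False
  define k where "k = nat \<lfloor>real M * t\<rfloor>"
  have "real k \<le> real M * t" "real M * t < real k + 1"
    using assms by (auto simp: k_def)
  moreover have "real M * t < real M * 1" using assms False by (intro mult_strict_left_mono) auto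
  ultimately have "real k < real M" by linarith
  with \<open>real k \<le> real M * t\<close> \<open>real M * t < real k + 1\<close> show ?thesis
    using assms by (intro that[of k]) (auto simp: field_simps)
qed

text \<open>The weight of the ReLU at \<open>k / M\<close> is the jump of the slope there. The kinks
  do not depend on \<open>F\<close>, so one layer of \<open>M\<close> neurons serves a whole family
  of such functions.\<close>

lemma cpwl_relu:
  assumes "cpwl M F" "0 < M"
  shows "\<exists>c. \<forall>t\<in>{0..1}. F t = F 0 + (\<Sum>k<M. c k * relu (t - real k / real M))"
proof -
  from assms(1) obtain s where s: "\<And>k t. k < M \<Longrightarrow> real k / real M \<le> t \<Longrightarrow> t \<le> (real k + 1) / real M \<Longrightarrow>
      F t = F (real k / real M) + s k * (t - real k / real M)" unfolding cpwl_def by metis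
  define c where "c k = s k - (if k = 0 then 0 else s (k - 1))" for k
  \<comment> \<open>The first \<open>k + 1\<close> terms, without the ReLUs, already give the affine
    piece of cell \<open>k\<close>.\<close>
  have claim: "F 0 + (\<Sum>j<Suc k. c j * (t - real j / real M)) = F (real k / real M) + s k * (t - real k / real M)"
    if "k < M" for k t
    using that
  proof (induction k)
    case 0
    then show ?case by (simp add: c_def)
  next
    case (Suc k)
    define u v where "u = real k / real M" and "v = real (Suc k) / real M"
    have "F v = F u + s k * (v - u)"
      unfolding u_def v_def using Suc.prems assms(2) by (intro s) (auto simp: field_simps)
    moreover have "F 0 + (\<Sum>j<Suc (Suc k). c j * (t - real j / real M)) = F u + s k * (t - u) + c (Suc k) * (t - v)"
      using Suc unfolding u_def v_def by simp
    moreover have "c (Suc k) = s (Suc k) - s k" by (simp add: c_def)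
    ultimately have "F 0 + (\<Sum>j<Suc (Suc k). c j * (t - real j / real M)) = F v + s (Suc k) * (t - v)"
      by (simp only: algebra_simps)
    then show ?case unfolding v_def .
  qed
  show ?thesis
  proof (rule exI[of _ c], rule ballI)
    fix t :: real assume "t \<in> {0..1}"
    then have t: "0 \<le> t" "t \<le> 1" by auto
    obtain k where k: "k < M" "real k / real M \<le> t" "t \<le> (real k + 1) / real M"
      using unit_interval_cell[OF t assms(2)] by blast
    have "(\<Sum>j<M. c j * relu (t - real j / real M)) = (\<Sum>j<Suc k. c j * relu (t - real j / real M))"
    proof (intro sum.mono_neutral_right ballI)
      fix j assume "j \<in> {..<M} - {..<Suc k}"
      then have "real k + 1 \<le> real j" by auto
      then have "(real k + 1) / real M \<le> real j / real M" using assms(2) by (intro divide_right_mono) auto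
      then show "c j * relu (t - real j / real M) = 0" using k by (simp add: relu_of_nonpos)
    qed (use k in auto)
    also have "\<dots> = (\<Sum>j<Suc k. c j * (t - real j / real M))"
    proof (intro sum.cong refl)
      fix j assume "j \<in> {..<Suc k}"
      then have "real j / real M \<le> real k / real M" using assms(2) by (intro divide_right_mono) auto
      then show "c j * relu (t - real j / real M) = c j * (t - real j / real M)"
        using k by (simp add: relu_of_nonneg)
    qed
    finally show "F t = F 0 + (\<Sum>k<M. c k * relu (t - real k / real M))"
      using claim[OF k(1)] s[OF k] by simp
  qed
qed

lemma net_cpwl:
  assumes "f \<in> aff G" "\<And>x. 0 \<le> f x" "\<And>x. f x \<le> 1" "0 < M" "\<And>F. F \<in> \<F> \<Longrightarrow> cpwl M F"
  shows "net G M 1 ((\<lambda>F x. F (f x)) ` \<F>)"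
proof (rule net_layer_family[where I = "{..<M}" and h = "\<lambda>k x. f x - real k / real M"])
  show "(\<lambda>F x. F (f x)) ` \<F> \<subseteq> aff ((\<lambda>k x. relu (f x - real k / real M)) ` {..<M})"
  proof clarify
    fix F assume "F \<in> \<F>"
    from cpwl_relu[OF assms(5)[OF \<open>F \<in> \<F>\<close>] assms(4)]
    obtain c where c: "\<forall>t\<in>{0..1}. F t = F 0 + (\<Sum>k<M. c k * relu (t - real k / real M))"
      by (elim exE)
    have "(\<lambda>x. F (f x)) = (\<lambda>x. F 0 + (\<Sum>k<M. c k * relu (f x - real k / real M)))"
      by (rule ext, rule bspec[OF c]) (simp add: assms(2,3))
    also have "\<dots> \<in> aff ((\<lambda>k x. relu (f x - real k / real M)) ` {..<M})"
      by (intro aff_add aff_const aff_sum aff_scale aff_base) auto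
    finally show "(\<lambda>x. F (f x)) \<in> aff ((\<lambda>k x. relu (f x - real k / real M)) ` {..<M})" .
  qed
  show "(\<lambda>x. f x - real k / real M) \<in> aff G" for k
    by (intro aff_diff aff_const assms(1))
qed simp_all

lemma cpwl_zigzag:
  assumes "0 < M" shows "cpwl M (\<lambda>t. zigzag (real M * t))"
proof -
  have "zigzag (real M * t) = zigzag (real M * (real k / real M)) +
      (if even k then real M else - real M) * (t - real k / real M)"
    if "real k / real M \<le> t" "t \<le> (real k + 1) / real M" for k t
  proof -
    have "real k \<le> real M * t" "real M * t \<le> real k + 1" using that assms by (auto simp: field_simps)
    from zigzag_piece[OF this] zigzag_piece[of k "real k"] show ?thesis
      using assms by (auto simp: field_simps)
  qed
  then show ?thesis unfolding cpwl_def by (intro exI[of _ "\<lambda>k. if even k then real M else - real M"]) blast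
qed

text \<open>\<open>x (1 - x)\<close> minus a copy of itself, folded by the zigzag and shrunk by \<open>M\<^sup>2\<close>, is piecewise linear.\<close>

definition parabola :: "real \<Rightarrow> real" where "parabola x = x * (1 - x)"

definition parabola_res :: "nat \<Rightarrow> real \<Rightarrow> real" where
  "parabola_res M x = parabola x - parabola (zigzag (real M * x)) / (real M)\<^sup>2"

definition parabola_approx :: "nat \<Rightarrow> nat \<Rightarrow> real \<Rightarrow> real" where
  "parabola_approx M Q x = (\<Sum>q<Q. parabola_res M (zigzag (real (M ^ q) * x)) / real (M ^ (2 * q)))"

text \<open>With \<open>t = k / M + s\<close> the folded copy is \<open>M s (1 - M s)\<close>;
  divided by \<open>M^2\<close> it becomes \<open>s / M - s^2\<close>, which cancels the quadratic
  term of \<open>t (1 - t)\<close> exactly.\<close>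

lemma cpwl_parabola_res:
  assumes "0 < M" shows "cpwl M (parabola_res M)"
proof -
  have eq: "parabola_res M t = real k / real M * (1 - real k / real M)
      + (1 - (2 * real k + 1) / real M) * (t - real k / real M)"
    if "real k / real M \<le> t" "t \<le> (real k + 1) / real M" for k t
  proof -
    define a b s where "a = real k / real M" "b = 1 / real M" "s = t - a"
    have "real k \<le> real M * t" "real M * t \<le> real k + 1" using that assms by (auto simp: field_simps)
    from zigzag_piece[OF this] have "parabola (zigzag (real M * t)) = (real M * t - real k) * (1 - (real M * t - real k))"
      by (auto simp: parabola_def algebra_simps)
    also have "real M * t - real k = real M * s" using assms by (simp add: a_b_s_def field_simps)
    finally have "parabola (zigzag (real M * t)) / (real M)\<^sup>2 = s * b - s * s"
      using assms by (simp add: a_b_s_def(2) field_simps power2_eq_square)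
    moreover have "t = a + s" "(2 * real k + 1) / real M = 2 * a + b"
      by (simp_all add: a_b_s_def add_divide_distrib)
    ultimately show ?thesis unfolding a_b_s_def(1)[symmetric] parabola_res_def by (simp add: parabola_def algebra_simps)
  qed
  have "parabola_res M t = parabola_res M (real k / real M) + (1 - (2 * real k + 1) / real M) * (t - real k / real M)"
    if "real k / real M \<le> t" "t \<le> (real k + 1) / real M" for k t
    unfolding eq[OF that] using eq[of k "real k / real M"] assms by (simp add: divide_right_mono)
  then show ?thesis unfolding cpwl_def by (intro exI[of _ "\<lambda>k. 1 - (2 * real k + 1) / real M"]) blast
qed

lemma parabola_bounds: "0 \<le> x \<Longrightarrow> x \<le> 1 \<Longrightarrow> 0 \<le> parabola x" "parabola x \<le> 1 / 4"
proof -
  show "0 \<le> x \<Longrightarrow> x \<le> 1 \<Longrightarrow> 0 \<le> parabola x" by (simp add: parabola_def)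
  have "0 \<le> (x - 1 / 2)\<^sup>2" by simp
  then show "parabola x \<le> 1 / 4" by (simp add: parabola_def power2_eq_square algebra_simps)
qed

text \<open>The sum telescopes by \<open>zigzag_mult\<close>. The remainder is of order
  \<open>M^(-2 Q)\<close>: width of order \<open>M\<close> buys a factor \<open>M^2\<close> of
  accuracy per layer.\<close>

lemma parabola_approx_eq:
  assumes "0 < M" "0 \<le> x" "x \<le> 1"
  shows "parabola_approx M Q x = parabola x - parabola (zigzag (real (M ^ Q) * x)) / real (M ^ (2 * Q))"
proof (induction Q)
  case 0
  then show ?case using assms by (simp add: parabola_approx_def zigzag_id)
next
  case (Suc Q)
  have "zigzag (real M * zigzag (real (M ^ Q) * x)) = zigzag (real (M ^ Suc Q) * x)"
    by (simp add: zigzag_mult mult.assoc)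
  then have "parabola_res M (zigzag (real (M ^ Q) * x)) / real (M ^ (2 * Q)) =
     parabola (zigzag (real (M ^ Q) * x)) / real (M ^ (2 * Q)) - parabola (zigzag (real (M ^ Suc Q) * x)) / real (M ^ (2 * Suc Q))"
    using assms by (simp add: parabola_res_def field_simps power2_eq_square)
  then show ?case using Suc by (simp add: parabola_approx_def)
qed

lemma parabola_approx_error:
  assumes "0 < M" "0 \<le> x" "x \<le> 1"
  shows "parabola_approx M Q x \<le> parabola x" "parabola x \<le> parabola_approx M Q x + 1 / (4 * real (M ^ (2 * Q)))"
proof -
  note b = parabola_bounds(1)[OF zigzag_bounds, of "real (M ^ Q) * x"] parabola_bounds(2)[of "zigzag (real (M ^ Q) * x)"]
  have p: "0 < real (M ^ (2 * Q))" using assms by simp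
  show "parabola_approx M Q x \<le> parabola x" unfolding parabola_approx_eq[OF assms]
    using b(1) p by simp
  have "parabola (zigzag (real (M ^ Q) * x)) / real (M ^ (2 * Q)) \<le> (1 / 4) / real (M ^ (2 * Q))"
    using b(2) p by (intro divide_right_mono) auto
  then show "parabola x \<le> parabola_approx M Q x + 1 / (4 * real (M ^ (2 * Q)))"
    unfolding parabola_approx_eq[OF assms] by simp
qed

lemma net_parabola_approx:
  assumes "f \<in> aff G" "\<And>x. 0 \<le> f x" "\<And>x. f x \<le> 1" "0 < M"
  shows "net G (M + 2) Q {\<lambda>x. parabola_approx M Q (f x)}"
proof -
  define F where "F q = {\<lambda>x. zigzag (real (M ^ q) * f x), \<lambda>x. parabola_approx M q (f x)}" for q
  \<comment> \<open>Both updates are piecewise linear in the same folded argument with the same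
    kinks, hence \<open>M\<close> neurons; two more carry the partial sum.\<close>
  have step: "net (F q) (M + 2) 1 (F (Suc q))" for q
  proof -
    let ?g = "\<lambda>x. zigzag (real (M ^ q) * f x)" and ?a = "\<lambda>x. parabola_approx M q (f x)"
    let ?E = "(\<lambda>F x. F (?g x)) ` {\<lambda>t. zigzag (real M * t), parabola_res M}"
    have "net (F q) M 1 ?E"
      by (rule net_cpwl) (use assms cpwl_zigzag cpwl_parabola_res in \<open>auto simp: F_def zigzag_bounds intro: aff_base\<close>)
    from net_carry[OF this, of "{?a}"]
    have 1: "net (F q) (M + 2) 1 (?E \<union> {?a})" by (simp add: F_def aff_base)
    have "(\<lambda>x. zigzag (real (M ^ Suc q) * f x)) = (\<lambda>x. zigzag (real M * ?g x))"
      by (simp add: zigzag_mult mult.assoc)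
    moreover have "(\<lambda>x. parabola_approx M (Suc q) (f x)) = (\<lambda>x. ?a x + parabola_res M (?g x) / real (M ^ (2 * q)))"
      by (simp add: parabola_approx_def)
    ultimately have "F (Suc q) = {\<lambda>x. zigzag (real M * ?g x), \<lambda>x. ?a x + parabola_res M (?g x) / real (M ^ (2 * q))}"
      unfolding F_def by simp
    moreover have "(\<lambda>x. zigzag (real M * ?g x)) \<in> aff (?E \<union> {?a})" by (rule aff_base) auto
    moreover have "(\<lambda>x. ?a x + parabola_res M (?g x) / real (M ^ (2 * q))) \<in> aff (?E \<union> {?a})"
      by (intro aff_add aff_divide) (auto intro: aff_base)
    ultimately show ?thesis by (intro net_aff[OF 1]) auto
  qed
  have "net (F 0) (M + 2) (Q * 1) (F Q)" by (rule net_iterate) (rule step)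
  moreover have "(\<lambda>x. zigzag (real (M ^ 0) * f x)) = f" using assms by (auto simp: zigzag_id)
  then have "net G (M + 2) 0 (F 0)"
    using assms(1) by (intro net_0) (auto simp: F_def parabola_approx_def intro: aff_const)
  ultimately have "net G (M + 2) Q (F Q)" using net_trans by fastforce
  then show ?thesis by (rule net_subset) (simp add: F_def)
qed

text \<open>Polarisation: with exact parabolas the argument of \<open>clamp01\<close> equals
  \<open>x * y\<close>. Clamping makes the result a legal input of the next multiplication and
  cannot increase the error for factors in \<open>[0,1]\<close>, whose product lies there
  too.\<close>

definition mul_approx :: "nat \<Rightarrow> nat \<Rightarrow> real \<Rightarrow> real \<Rightarrow> real" where
  "mul_approx M Q x y = clamp01 ((x + y) / 2 - 2 * parabola_approx M Q ((x + y) / 2)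
     + parabola_approx M Q x / 2 + parabola_approx M Q y / 2)"

lemma mul_approx_bounds: "0 \<le> mul_approx M Q x y" "mul_approx M Q x y \<le> 1"
  by (auto simp: mul_approx_def clamp01_bounds)

lemma mul_approx_error:
  assumes "0 < M" "0 \<le> x" "x \<le> 1" "0 \<le> y" "y \<le> 1"
  shows "\<bar>mul_approx M Q x y - x * y\<bar> \<le> 1 / real (M ^ (2 * Q))"
proof -
  define e where "e = 1 / (4 * real (M ^ (2 * Q)))"
  define r where "r = (x + y) / 2 - 2 * parabola_approx M Q ((x + y) / 2) + parabola_approx M Q x / 2 + parabola_approx M Q y / 2"
  have e: "1 / real (M ^ (2 * Q)) = 4 * e" by (simp add: e_def)
  have "x * y = (x + y) / 2 - 2 * parabola ((x + y) / 2) + parabola x / 2 + parabola y / 2"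
    by (simp add: parabola_def field_simps)
  moreover note parabola_approx_error[of M x Q] parabola_approx_error[of M y Q] parabola_approx_error[of M "(x + y) / 2" Q]
  ultimately have *: "\<bar>r - x * y\<bar> \<le> 4 * e" using assms unfolding r_def e_def[symmetric]
    by simp
  have "0 \<le> x * y" "x * y \<le> 1" using assms by (auto intro: mult_le_one)
  then have "\<bar>clamp01 r - x * y\<bar> \<le> \<bar>r - x * y\<bar>" by (auto simp: clamp01_def)
  then show ?thesis using * unfolding e mul_approx_def r_def by simp
qed

lemma net_mul_approx:
  assumes "f \<in> aff G" "\<And>x. 0 \<le> f x" "\<And>x. f x \<le> 1"
    "g \<in> aff G" "\<And>x. 0 \<le> g x" "\<And>x. g x \<le> 1" "0 < M"
  shows "net G (3 * M + 12) (Q + 1) {\<lambda>x. mul_approx M Q (f x) (g x)}"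
proof -
  let ?h = "\<lambda>x. (f x + g x) / 2"
  have h: "?h \<in> aff G" using assms by (intro aff_divide aff_add) auto
  have 1: "net G (M + 2) Q {\<lambda>x. parabola_approx M Q (f x)}" using assms by (intro net_parabola_approx) auto
  have 2: "net G (M + 2) Q {\<lambda>x. parabola_approx M Q (g x)}" using assms by (intro net_parabola_approx) auto
  have 3: "net G (M + 2) Q {\<lambda>x. parabola_approx M Q (?h x)}"
    using assms(7) h
  proof (intro net_parabola_approx)
    show "0 \<le> ?h x" "?h x \<le> 1" for x using assms(2,3,5,6)[of x] by auto
  qed auto
  have 4: "net G 2 Q {?h}" using net_id[of "{?h}"] h by simp
  let ?E = "{\<lambda>x. parabola_approx M Q (f x)} \<union> {\<lambda>x. parabola_approx M Q (g x)} \<union> {\<lambda>x. parabola_approx M Q (?h x)} \<union> {?h}"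
  have 5: "net G (3 * M + 12) Q ?E"
    by (rule net_mono[OF net_Un[OF net_Un[OF net_Un[OF 1 2] 3] 4]]) simp
  have "(\<lambda>x. ?h x - 2 * parabola_approx M Q (?h x) + parabola_approx M Q (f x) / 2 + parabola_approx M Q (g x) / 2) \<in> aff ?E"
    by (intro aff_add[OF aff_add[OF aff_diff[OF aff_base aff_scale[OF aff_base]]
        aff_divide[OF aff_base]] aff_divide[OF aff_base]]) auto
  from net_trans[OF net_mono[OF net_clamp01[OF this], of "3 * M + 12"] 5]
  show ?thesis by (simp add: mul_approx_def)
qed

primrec prod_approx :: "nat \<Rightarrow> nat \<Rightarrow> (nat \<Rightarrow> real) \<Rightarrow> nat \<Rightarrow> real" where
  "prod_approx M Q g 0 = 1"
| "prod_approx M Q g (Suc k) = mul_approx M Q (prod_approx M Q g k) (g k)"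

lemma prod_approx_bounds: "0 \<le> prod_approx M Q g k \<and> prod_approx M Q g k \<le> 1"
  by (cases k) (auto simp: mul_approx_bounds)

text \<open>A factor at most 1 does not amplify the error made so far, so the errors of the single
  multiplications only add up.\<close>

lemma prod_approx_error:
  assumes "0 < M" "\<And>j. j < k \<Longrightarrow> 0 \<le> g j \<and> g j \<le> 1"
  shows "\<bar>prod_approx M Q g k - (\<Prod>j<k. g j)\<bar> \<le> real k / real (M ^ (2 * Q))"
  using assms(2)
proof (induction k)
  case 0
  then show ?case by simp
next
  case (Suc k)
  have g: "0 \<le> g k" "g k \<le> 1" using Suc.prems by auto
  have IH: "\<bar>prod_approx M Q g k - (\<Prod>j<k. g j)\<bar> \<le> real k / real (M ^ (2 * Q))"
    using Suc by simp
  have "\<bar>prod_approx M Q g k * g k - (\<Prod>j<k. g j) * g k\<bar> = \<bar>prod_approx M Q g k - (\<Prod>j<k. g j)\<bar> * g k"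
    using g by (simp add: abs_mult left_diff_distrib[symmetric])
  also have "\<dots> \<le> \<bar>prod_approx M Q g k - (\<Prod>j<k. g j)\<bar>" using g by (intro mult_left_le) auto
  finally have "\<bar>prod_approx M Q g (Suc k) - (\<Prod>j<Suc k. g j)\<bar>
      \<le> 1 / real (M ^ (2 * Q)) + real k / real (M ^ (2 * Q))"
    using mul_approx_error[OF assms(1), of "prod_approx M Q g k" "g k" Q] prod_approx_bounds[of M Q g k] g IH
    by (simp del: of_nat_power)
  then show ?case by (simp add: add_divide_distrib)
qed

lemma net_prod_approx:
  assumes "finite G" "\<And>j. j < k \<Longrightarrow> g j \<in> aff G" "\<And>j x. j < k \<Longrightarrow> 0 \<le> g j x \<and> g j x \<le> 1" "0 < M"
  shows "net G (3 * M + 14 + 2 * card G) (k * (Q + 1)) ({\<lambda>x. prod_approx M Q (\<lambda>j. g j x) k} \<union> G)"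
proof -
  define F where "F i = {\<lambda>x. prod_approx M Q (\<lambda>j. g j x) i} \<union> G" for i
  have "net (F i) (3 * M + 14 + 2 * card G) (Q + 1) (F (Suc i))" if i: "i < k" for i
  proof -
    have 1: "net (F i) (3 * M + 12) (Q + 1) {\<lambda>x. mul_approx M Q (prod_approx M Q (\<lambda>j. g j x) i) (g i x)}"
      using assms i prod_approx_bounds aff_mono[OF assms(2)[OF i], of "F i"]
      by (intro net_mul_approx) (auto simp: F_def intro: aff_base)
    have 2: "G \<subseteq> aff (F i)" by (auto simp: F_def intro: aff_base)
    from net_carry[OF 1 assms(1) 2] have "net (F i) (3 * M + 12 + 2 * card G) (Q + 1) (F (Suc i))"
      by (simp add: F_def)
    then show ?thesis by (rule net_mono) simp
  qed
  from net_iterate[of k F, OF this] have "net (F 0) (3 * M + 14 + 2 * card G) (k * (Q + 1)) (F k)" .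
  moreover have "net G (3 * M + 14 + 2 * card G) 0 (F 0)"
    by (rule net_0) (auto simp: F_def intro: aff_base aff_const)
  ultimately show ?thesis using net_trans unfolding F_def by fastforce
qed

subsection \<open>Digit extraction\<close>

text \<open>The ramps of width \<open>\<delta>\<close> replace the jumps of \<open>t \<mapsto> \<lfloor>R t\<rfloor>\<close>; the result is exact away from them.\<close>

definition soft_floor :: "real \<Rightarrow> nat \<Rightarrow> real \<Rightarrow> real" where
  "soft_floor \<delta> R t = (\<Sum>e\<in>{1..<R}. clamp01 ((t - real e / real R) / \<delta> + 1))"

text \<open>Each ramp ends at its jump \<open>e / R\<close> and rises only to the left of it. The
  value is therefore right at the jump itself, and the bad set is the top end of each cell, where
  the tent is small.\<close>

lemma soft_floor_eq:
  assumes "0 < \<delta>" "0 < R" "0 \<le> t" "t < 1"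
    "\<And>e. e \<in> {1..<R} \<Longrightarrow> real e / real R \<le> t \<or> t \<le> real e / real R - \<delta>"
  shows "soft_floor \<delta> R t = of_int \<lfloor>real R * t\<rfloor>"
proof -
  have lt: "real R * t < real R" using assms by simp
  have "soft_floor \<delta> R t = (\<Sum>e\<in>{1..<R}. if int e \<le> \<lfloor>real R * t\<rfloor> then 1 else 0)"
    unfolding soft_floor_def
  proof (intro sum.cong refl)
    fix e assume e: "e \<in> {1..<R}"
    show "clamp01 ((t - real e / real R) / \<delta> + 1) = (if int e \<le> \<lfloor>real R * t\<rfloor> then 1 else 0)"
    proof (cases "real e / real R \<le> t")
      case True
      then have "real e \<le> real R * t" using assms by (simp add: field_simps)
      then have "int e \<le> \<lfloor>real R * t\<rfloor>" by (simp add: le_floor_iff)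
      moreover have "1 \<le> (t - real e / real R) / \<delta> + 1" using True assms by simp
      ultimately show ?thesis by (simp add: clamp01_def)
    next
      case False
      then have "\<not> real e \<le> real R * t" using assms by (simp add: field_simps)
      then have "\<not> int e \<le> \<lfloor>real R * t\<rfloor>" by (simp add: le_floor_iff)
      moreover have "t - real e / real R \<le> - \<delta>" using False assms(5)[OF e] by auto
      then have "(t - real e / real R) / \<delta> + 1 \<le> 0" using assms by (simp add: field_simps)
      ultimately show ?thesis by (simp add: clamp01_def)
    qed
  qed
  also have "\<dots> = real (card {e\<in>{1..<R}. int e \<le> \<lfloor>real R * t\<rfloor>})"
    by (simp add: sum.If_cases Int_def)
  also have "{e\<in>{1..<R}. int e \<le> \<lfloor>real R * t\<rfloor>} = {1..nat \<lfloor>real R * t\<rfloor>}"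
  proof -
    have "\<lfloor>real R * t\<rfloor> < int R" using lt by (simp add: floor_less_iff)
    then show ?thesis using assms by (auto simp: le_nat_iff)
  qed
  also have "real (card {1..nat \<lfloor>real R * t\<rfloor>}) = of_int \<lfloor>real R * t\<rfloor>"
    using assms by simp
  finally show ?thesis .
qed

text \<open>\<open>a\<close> is the integer read so far, \<open>t\<close> the fraction still to be
  read. The ramp width stays fixed while \<open>t\<close> is magnified, so in terms of the original
  input later ramps are narrower.\<close>

definition digit_step :: "real \<Rightarrow> nat \<Rightarrow> real \<times> real \<Rightarrow> real \<times> real" where
  "digit_step \<delta> R = (\<lambda>(a, t). (real R * a + soft_floor \<delta> R t, real R * t - soft_floor \<delta> R t))"

definition digits :: "real \<Rightarrow> nat list \<Rightarrow> real \<times> real \<Rightarrow> real \<times> real" where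
  "digits \<delta> Rs = fold (digit_step \<delta>) Rs"

lemma frac_mult_frac: "frac (real P * frac y) = frac (real P * y)"
proof -
  define k where "k = int P * \<lfloor>y\<rfloor>"
  have "real P * frac y = real P * y - of_int k" by (simp add: frac_def algebra_simps k_def)
  then show ?thesis by (simp add: frac_def)
qed

text \<open>One condition at the finest scale controls all digits: the ramp below
  \<open>e / R\<close>, magnified by the full product \<open>P\<close> of the radices, is an
  interval of length \<open>P * \<delta>\<close> below an integer, and there the fractional part
  exceeds \<open>1 - P * \<delta>\<close>.\<close>

lemma digits_eq:
  assumes "0 < \<delta>" "0 \<le> t" "t < 1" "0 \<notin> set Rs"
    "frac (real (prod_list Rs) * t) \<le> 1 - real (prod_list Rs) * \<delta>"
  shows "digits \<delta> Rs (a, t) =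
    (real (prod_list Rs) * a + of_int \<lfloor>real (prod_list Rs) * t\<rfloor>, frac (real (prod_list Rs) * t))"
  using assms(2-)
proof (induction Rs arbitrary: a t)
  case Nil
  then have "\<lfloor>t\<rfloor> = 0" by (simp add: floor_unique)
  then show ?case by (simp add: digits_def frac_def)
next
  case (Cons R Rs)
  define P where "P = prod_list Rs"
  have pos: "0 < R" "0 < P" 
    using Cons.prems prod_list_zero_iff[of Rs] by (auto simp: P_def intro: Nat.gr0I)
  have fr: "frac (real R * real P * t) \<le> 1 - real R * real P * \<delta>" using Cons.prems by (simp add: P_def)
  have fl: "soft_floor \<delta> R t = of_int \<lfloor>real R * t\<rfloor>"
  proof (rule soft_floor_eq[OF assms(1) pos(1) Cons.prems(1,2)])
    fix e assume "e \<in> {1..<R}"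
    show "real e / real R \<le> t \<or> t \<le> real e / real R - \<delta>"
    proof (rule ccontr)
      assume "\<not> ?thesis"
      then have 1: "t < real e / real R" "real e / real R - \<delta> < t" by auto
      have lt: "real R * real P * t < real (e * P)" using 1(1) pos by (simp add: field_simps)
      have "real R * real P * (real e / real R - \<delta>) < real R * real P * t"
        using 1(2) pos by (intro mult_strict_left_mono) auto
      moreover have "real R * real P * (real e / real R - \<delta>) = real (e * P) - real R * real P * \<delta>"
        using pos by (simp add: right_diff_distrib)
      ultimately have 2: "real (e * P) - real R * real P * \<delta> < real R * real P * t" by simp
      have "real R * real P * \<delta> \<le> 1" using fr frac_ge_0[of "real R * real P * t"] by linarith
      with 2 have "\<lfloor>real R * real P * t\<rfloor> = int (e * P) - 1"
        using lt by (intro floor_unique) auto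
      then have "frac (real R * real P * t) = real R * real P * t - real (e * P) + 1"
        unfolding frac_def by simp
      then show False using 2 fr by linarith
    qed
  qed
  have "digits \<delta> (R # Rs) (a, t) = digits \<delta> Rs (real R * a + of_int \<lfloor>real R * t\<rfloor>, frac (real R * t))"
    by (simp add: digits_def digit_step_def fl frac_def)
  also have "\<dots> = (real P * (real R * a + of_int \<lfloor>real R * t\<rfloor>) + of_int \<lfloor>real P * frac (real R * t)\<rfloor>,
       frac (real P * frac (real R * t)))"
    unfolding P_def
  proof (rule Cons.IH)
    show "frac (real (prod_list Rs) * frac (real R * t)) \<le> 1 - real (prod_list Rs) * \<delta>"
    proof -
      have "real P * \<delta> \<le> real R * real P * \<delta>" using pos assms(1) by simp
      then show ?thesis using fr by (simp add: frac_mult_frac P_def[symmetric] mult.commute mult.left_commute)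
    qed
  qed (use Cons.prems frac_lt_1 in auto)
  also have "\<lfloor>real P * frac (real R * t)\<rfloor> = \<lfloor>real P * (real R * t)\<rfloor> - int P * \<lfloor>real R * t\<rfloor>"
  proof -
    have "real P * frac (real R * t) = real P * (real R * t) - of_int (int P * \<lfloor>real R * t\<rfloor>)"
      by (simp add: frac_def algebra_simps)
    then show ?thesis by (metis floor_diff_of_int)
  qed
  finally show ?case by (simp add: frac_mult_frac P_def[symmetric] algebra_simps)
qed

lemma net_soft_floor:
  assumes "t \<in> aff G" "R \<le> M"
  shows "net G (2 * M) 1 {\<lambda>x. soft_floor \<delta> R (t x)}"
proof (rule net_layer_family[where I = "{1..<R} \<times> {0, 1::nat}" and
      h = "\<lambda>(e, i) x. (t x - real e / real R) / \<delta> + 1 - real i"])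
  show "(case p of (e, i) \<Rightarrow> \<lambda>x. (t x - real e / real R) / \<delta> + 1 - real i) \<in> aff G" for p
    by (auto split: prod.split intro!: aff_add aff_diff aff_divide aff_const assms)
  show "card ({1..<R} \<times> {0, 1::nat}) \<le> 2 * M" using assms by (simp add: card_cartesian_product)
  let ?H = "(\<lambda>p x. relu ((case p of (e, i) \<Rightarrow> \<lambda>x. (t x - real e / real R) / \<delta> + 1 - real i) x)) `
            ({1..<R} \<times> {0, 1::nat})"
  have "(\<lambda>x. relu ((t x - real e / real R) / \<delta> + 1 - real i)) \<in> ?H" if "e \<in> {1..<R}" "i \<in> {0, 1}" for e i
    using that by (intro image_eqI[of _ _ "(e, i)"]) auto
  from this[of _ 0] this[of _ 1]
  have "(\<lambda>x. \<Sum>e\<in>{1..<R}. relu ((t x - real e / real R) / \<delta> + 1) - relu ((t x - real e / real R) / \<delta> + 1 - 1)) \<in> aff ?H"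
    by (intro aff_sum aff_diff aff_base) simp_all
  then show "{\<lambda>x. soft_floor \<delta> R (t x)} \<subseteq> aff ?H" by (simp add: soft_floor_def clamp01_relu)
qed auto

lemma net_digits:
  assumes "a \<in> aff G" "t \<in> aff G" "\<And>R. R \<in> set Rs \<Longrightarrow> R \<le> M"
  shows "net G (2 * M + 4) (length Rs)
    {\<lambda>x. fst (digits \<delta> Rs (a x, t x)), \<lambda>x. snd (digits \<delta> Rs (a x, t x))}"
  using assms
proof (induction Rs arbitrary: G a t)
  case Nil
  then show ?case by (auto simp: digits_def intro: net_0)
next
  case (Cons R Rs)
  let ?a = "\<lambda>x. real R * a x + soft_floor \<delta> R (t x)" and ?t = "\<lambda>x. real R * t x - soft_floor \<delta> R (t x)"
  have "net G (2 * M + 2 * card {a, t}) 1 ({\<lambda>x. soft_floor \<delta> R (t x)} \<union> {a, t})"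
    using Cons.prems by (intro net_carry net_soft_floor) auto
  then have "net G (2 * M + 4) 1 ({\<lambda>x. soft_floor \<delta> R (t x)} \<union> {a, t})"
    by (rule net_mono) (auto simp: card_insert_if)
  then have "net G (2 * M + 4) 1 {?a, ?t}"
  proof (rule net_aff)
    let ?F = "{\<lambda>x. soft_floor \<delta> R (t x)} \<union> {a, t}"
    have "?a \<in> aff ?F" "?t \<in> aff ?F" by (intro aff_add aff_diff aff_scale aff_base; simp)+
    then show "{?a, ?t} \<subseteq> aff ?F" by simp
  qed
  moreover have "net {?a, ?t} (2 * M + 4) (length Rs)
    {\<lambda>x. fst (digits \<delta> Rs (?a x, ?t x)), \<lambda>x. snd (digits \<delta> Rs (?a x, ?t x))}"
    by (rule Cons.IH) (use Cons.prems in \<open>auto intro: aff_base\<close>)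
  ultimately show ?case using net_trans by (fastforce simp: digits_def digit_step_def)
qed

lemma exponent_list:
  assumes "m \<le> q * a"
  shows "\<exists>es. length es = q \<and> (\<forall>e\<in>set es. e \<le> a) \<and> sum_list es = (m::nat)"
  using assms
proof (induction q arbitrary: m)
  case 0
  then show ?case by simp
next
  case (Suc q)
  then have "m - min m a \<le> q * a" by auto
  from Suc.IH[OF this] obtain es where "length es = q" "\<forall>e\<in>set es. e \<le> a" "sum_list es = m - min m a"
    by blast
  then show ?case by (intro exI[of _ "min m a # es"]) auto
qed

text \<open>The number of radices is prescribed, with radix 1 as padding, so that all coordinates
  finish in the same layer whatever their exponents.\<close>

lemma radix_list:
  assumes "m \<le> q * a"
  shows "\<exists>Rs. length Rs = q \<and> (\<forall>R\<in>set Rs. R \<le> 2 ^ a) \<and> 0 \<notin> set Rs \<and> prod_list Rs = (2::nat) ^ m"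
proof -
  obtain es where es: "length es = q" "\<forall>e\<in>set es. e \<le> a" "sum_list es = m"
    using exponent_list[OF assms] by blast
  have "prod_list (map ((^) (2::nat)) es) = 2 ^ sum_list es" by (induction es) (auto simp: power_add)
  then show ?thesis using es by (intro exI[of _ "map ((^) 2) es"]) auto
qed

lemma net_zigzag:
  assumes "f \<in> aff G" "\<And>x. 0 \<le> f x" "\<And>x. f x \<le> 1" "\<And>R. R \<in> set Rs \<Longrightarrow> R \<le> M" "0 \<notin> set Rs"
  shows "net G M (length Rs) {\<lambda>x. zigzag (real (prod_list Rs) * f x)}"
  using assms
proof (induction Rs arbitrary: G f)
  case Nil
  then have "(\<lambda>x. zigzag (f x)) = f" by (simp add: zigzag_id)
  with Nil show ?case by (auto intro: net_0)
next
  case (Cons R Rs)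
  let ?g = "\<lambda>x. zigzag (real R * f x)"
  have "0 < R" using Cons.prems by auto
  have "net G R 1 ((\<lambda>F x. F (f x)) ` {\<lambda>t. zigzag (real R * t)})"
    by (rule net_cpwl) (use Cons.prems cpwl_zigzag[OF \<open>0 < R\<close>] \<open>0 < R\<close> in auto)
  then have 1: "net G M 1 {?g}" using Cons.prems by (auto elim: net_mono)
  have 2: "net {?g} M (length Rs) {\<lambda>x. zigzag (real (prod_list Rs) * ?g x)}"
    by (rule Cons.IH) (use Cons.prems zigzag_bounds in \<open>auto intro: aff_base\<close>)
  have "(\<lambda>x. zigzag (real (prod_list Rs) * ?g x)) = (\<lambda>x. zigzag (real (prod_list (R # Rs)) * f x))"
    by (simp add: zigzag_mult mult.assoc mult.left_commute)
  with net_trans[OF 2 1] show ?case by simp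
qed

subsection \<open>Table lookup\<close>

text \<open>The final \<open>1 / 2\<close> keeps all remainders away from the jumps of the floor function.\<close>

primrec pack :: "nat \<Rightarrow> (nat \<Rightarrow> nat) \<Rightarrow> nat \<Rightarrow> real" where
  "pack B w 0 = 1 / 2"
| "pack B w (Suc n) = (real (w 0) + pack B (\<lambda>i. w (Suc i)) n) / real B"

text \<open>The distance to 1 is the safety margin that \<open>digits_eq\<close> asks for; each
  stored entry costs a factor \<open>B\<close> of it.\<close>

lemma pack_bounds:
  assumes "0 < B" "\<And>i. w i < B"
  shows "0 < pack B w n \<and> pack B w n \<le> 1 - 1 / (2 * real B ^ n)"
  using assms(2)
proof (induction n arbitrary: w)
  case 0
  then show ?case by simp
next
  case (Suc n)
  have IH: "0 < pack B (\<lambda>i. w (Suc i)) n" "pack B (\<lambda>i. w (Suc i)) n \<le> 1 - 1 / (2 * real B ^ n)"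
    using Suc.IH[of "\<lambda>i. w (Suc i)"] Suc.prems by auto
  have "real (w 0) + 1 \<le> real B" using Suc.prems[of 0] by linarith
  then have "real (w 0) + pack B (\<lambda>i. w (Suc i)) n \<le> real B - 1 / (2 * real B ^ n)" using IH(2) by linarith
  then have "pack B w (Suc n) \<le> (real B - 1 / (2 * real B ^ n)) / real B"
    by (simp add: divide_right_mono)
  also have "\<dots> = 1 - 1 / (2 * real B ^ Suc n)" using assms(1) by (simp add: diff_divide_distrib)
  finally show ?case using IH(1) assms(1) by (simp add: add_nonneg_pos)
qed

lemma pack_lt_1:
  assumes "0 < B" "\<And>i. w i < B" shows "pack B w n < 1"
proof -
  have "0 < 1 / (2 * real B ^ n)" using assms(1) by simp
  then show ?thesis using pack_bounds[of B w n, OF assms] by linarith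
qed

text \<open>One entry is one digit in base \<open>M ^ K\<close>, read as \<open>K\<close> digits in
  base \<open>M\<close>. The remainder is again a packed number, so the reading can be
  repeated.\<close>

lemma digits_pack:
  assumes "0 < M" "\<And>i. w i < M ^ K" "0 < \<delta>" "\<delta> \<le> 1 / (2 * real (M ^ K) ^ Suc n)"
  shows "digits \<delta> (replicate K M) (0, pack (M ^ K) w (Suc n)) = (real (w 0), pack (M ^ K) (\<lambda>i. w (Suc i)) n)"
proof -
  let ?B = "M ^ K" and ?y = "pack (M ^ K) (\<lambda>i. w (Suc i)) n"
  have B: "0 < ?B" "prod_list (replicate K M) = ?B" using assms(1) by (auto simp: prod_list_replicate)
  note b = pack_bounds[of ?B, OF B(1)] pack_lt_1[of ?B, OF B(1)]
  have y: "0 < ?y" "?y < 1" "?y \<le> 1 - 1 / (2 * real ?B ^ n)" using b assms(2) by auto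
  have mul: "real ?B * pack ?B w (Suc n) = real (w 0) + ?y" using B(1) by simp
  have fl: "\<lfloor>real (w 0) + ?y\<rfloor> = int (w 0)" using y by (intro floor_unique) auto
  then have fr: "frac (real (w 0) + ?y) = ?y" by (simp add: frac_def)
  have "real ?B * \<delta> \<le> real ?B * (1 / (2 * real ?B ^ Suc n))" using assms(4) by (intro mult_left_mono) auto
  also have "c * (1 / (2 * c ^ Suc n)) = 1 / (2 * c ^ n)" if "0 < c" for c :: real using that by simp
  then have "real ?B * (1 / (2 * real ?B ^ Suc n)) = 1 / (2 * real ?B ^ n)" using B(1) of_nat_0_less_iff by blast
  finally have "?y \<le> 1 - real ?B * \<delta>" using y(3) by linarith
  then have *: "frac (real (prod_list (replicate K M)) * pack ?B w (Suc n))
      \<le> 1 - real (prod_list (replicate K M)) * \<delta>"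
    unfolding B(2) mul fr .
  have "0 \<le> pack ?B w (Suc n)" "pack ?B w (Suc n) < 1" 
    using b(1)[of w "Suc n"] b(2)[of w "Suc n"] assms(2) by (blast intro: less_imp_le)+
  from digits_eq[OF assms(3) this _ *, of 0] show ?thesis
    using assms(1) unfolding B(2) mul fr fl by simp
qed

text \<open>All entries are read in turn and only the wanted one is kept: \<open>a / M ^ K\<close>
  is below 1, so subtracting \<open>|q - i|\<close> and taking the ReLU leaves it for
  \<open>i = q\<close> and gives 0 for the other integers. The selection costs depth, not
  width.\<close>

primrec unpack :: "real \<Rightarrow> nat \<Rightarrow> nat \<Rightarrow> real \<Rightarrow> nat \<Rightarrow> real \<Rightarrow> real \<times> real" where
  "unpack \<delta> M K q 0 y = (y, 0)"
| "unpack \<delta> M K q (Suc i) y =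
    (let (y', s) = unpack \<delta> M K q i y; (a, y'') = digits \<delta> (replicate K M) (0, y')
     in (y'', s + relu (a / real (M ^ K) - \<bar>q - real i\<bar>)))"

lemma unpack_pack:
  assumes "0 < M" "\<And>i. w i < M ^ K" "0 < \<delta>" "\<delta> \<le> 1 / (2 * real (M ^ K) ^ n)" "i \<le> n"
  shows "unpack \<delta> M K (real q) i (pack (M ^ K) w n) =
    (pack (M ^ K) (\<lambda>j. w (i + j)) (n - i), if q < i then real (w q) / real (M ^ K) else 0)"
  using assms(5)
proof (induction i)
  case 0
  then show ?case by simp
next
  case (Suc i)
  have B: "0 < M ^ K" using assms(1) by simp
  obtain m where m: "n - i = Suc m" "n - Suc i = m" using Suc.prems by (metis Suc_diff_Suc less_eq_Suc_le)
  have "real (M ^ K) ^ Suc m \<le> real (M ^ K) ^ n" using B m(1) by (intro power_increasing) auto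
  then have "1 / (2 * real (M ^ K) ^ n) \<le> 1 / (2 * real (M ^ K) ^ Suc m)"
    using B by (intro divide_left_mono mult_left_mono) auto
  then have "\<delta> \<le> 1 / (2 * real (M ^ K) ^ Suc m)" using assms(4) by linarith
  from digits_pack[OF assms(1) _ assms(3) this, of "\<lambda>j. w (i + j)"]
  have d: "digits \<delta> (replicate K M) (0, pack (M ^ K) (\<lambda>j. w (i + j)) (n - i)) =
    (real (w i), pack (M ^ K) (\<lambda>j. w (Suc i + j)) (n - Suc i))"
    using assms(2) m by simp
  have "relu (real (w i) / real (M ^ K) - \<bar>real q - real i\<bar>) = (if q = i then real (w i) / real (M ^ K) else 0)"
  proof (cases "q = i")
    case False
    then have "1 \<le> \<bar>real q - real i\<bar>" by linarith
    moreover have "real (w i) / real (M ^ K) \<le> 1" using assms(2)[of i] B by simp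
    ultimately show ?thesis using False by (simp add: relu_of_nonpos)
  qed (simp add: relu_of_nonneg)
  then show ?case using Suc d by auto
qed

text \<open>Per entry: \<open>K\<close> layers for the digits, one for \<open>|q - i|\<close>, one
  for the outer ReLU.\<close>

lemma net_unpack:
  assumes "y \<in> aff G" "q \<in> aff G" "0 < M"
  shows "net G (2 * M + 12) (n * (K + 2)) {\<lambda>x. snd (unpack \<delta> M K (q x) n (y x))}"
proof -
  define F where "F i = {\<lambda>x. fst (unpack \<delta> M K (q x) i (y x)), \<lambda>x. snd (unpack \<delta> M K (q x) i (y x)), q}" for i
  have "net (F i) (2 * M + 12) (K + 2) (F (Suc i))" for i
  proof -
    let ?y = "\<lambda>x. fst (unpack \<delta> M K (q x) i (y x))" and ?s = "\<lambda>x. snd (unpack \<delta> M K (q x) i (y x))"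
    let ?d = "\<lambda>x. digits \<delta> (replicate K M) (0, ?y x)"
    let ?A = "{\<lambda>x. fst (?d x), \<lambda>x. snd (?d x)}"
    let ?p = "\<lambda>x. relu (q x - real i)" and ?m = "\<lambda>x. relu (real i - q x)"
    let ?r = "\<lambda>x. relu (fst (?d x) / real (M ^ K) - \<bar>q x - real i\<bar>)"
    have "net (F i) (2 * M + 4) K ?A"
      using net_digits[of "\<lambda>_. 0" "F i" ?y "replicate K M" M \<delta>] by (auto simp: F_def intro: aff_base aff_const)
    from net_carry[OF this, of "{?s, q}"]
    have "net (F i) (2 * M + 4 + 2 * card {?s, q}) K (?A \<union> {?s, q})" by (auto simp: F_def intro: aff_base)
    then have 1: "net (F i) (2 * M + 12) K (?A \<union> {?s, q})"
      by (rule net_mono) (auto simp: card_insert_if)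
    have "net (?A \<union> {?s, q}) 2 1 {?p, ?m}"
    proof (rule net_layer[where H = "{\<lambda>x. q x - real i, \<lambda>x. real i - q x}"])
      show "{\<lambda>x. q x - real i, \<lambda>x. real i - q x} \<subseteq> aff (?A \<union> {?s, q})"
        by (auto intro: aff_diff aff_const aff_base)
    qed (auto simp: card_insert_if intro: aff_base)
    from net_carry[OF this, of "?A \<union> {?s, q}"]
    have "net (?A \<union> {?s, q}) (2 + 2 * card (?A \<union> {?s, q})) 1 ({?p, ?m} \<union> (?A \<union> {?s, q}))"
      by (auto intro: aff_base)
    then have 2: "net (?A \<union> {?s, q}) (2 * M + 12) 1 ({?p, ?m} \<union> (?A \<union> {?s, q}))"
      by (rule net_mono) (use assms(3) in \<open>auto simp: card_insert_if\<close>)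
    let ?B = "{?p, ?m} \<union> (?A \<union> {?s, q})"
    have "(\<lambda>x. fst (?d x) / real (M ^ K) - (?p x + ?m x)) \<in> aff ?B"
      by (intro aff_diff[OF aff_divide[OF aff_base] aff_add[OF aff_base aff_base]]) auto
    then have "(\<lambda>x. fst (?d x) / real (M ^ K) - \<bar>q x - real i\<bar>) \<in> aff ?B"
      by (simp add: abs_eq_relu)
    then have "net ?B 1 1 {?r}"
      by (intro net_layer[where H = "{\<lambda>x. fst (?d x) / real (M ^ K) - \<bar>q x - real i\<bar>}"]) (auto intro: aff_base)
    from net_carry[OF this, of "?A \<union> {?s, q}"]
    have "net ?B (1 + 2 * card (?A \<union> {?s, q})) 1 ({?r} \<union> (?A \<union> {?s, q}))"
      by (auto intro: aff_base)
    then have 3: "net ?B (2 * M + 12) 1 ({?r} \<union> (?A \<union> {?s, q}))"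
      by (rule net_mono) (use assms(3) in \<open>auto simp: card_insert_if\<close>)
    from net_trans[OF 3 net_trans[OF 2 1]]
    have "net (F i) (2 * M + 12) (K + 2) ({?r} \<union> (?A \<union> {?s, q}))" by simp
    then show ?thesis
    proof (rule net_aff)
      have "(\<lambda>x. fst (unpack \<delta> M K (q x) (Suc i) (y x))) = (\<lambda>x. snd (?d x))"
        "(\<lambda>x. snd (unpack \<delta> M K (q x) (Suc i) (y x))) = (\<lambda>x. ?s x + ?r x)"
        by (auto simp: Let_def split: prod.splits)
      moreover have "(\<lambda>x. ?s x + ?r x) \<in> aff ({?r} \<union> (?A \<union> {?s, q}))" by (intro aff_add aff_base) auto
      ultimately show "F (Suc i) \<subseteq> aff ({?r} \<union> (?A \<union> {?s, q}))"
        by (auto simp: F_def intro: aff_base)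
    qed
  qed
  from net_iterate[of n F, OF this] have 1: "net (F 0) (2 * M + 12) (n * (K + 2)) (F n)" .
  have "net G (2 * M + 12) 0 (F 0)"
    by (rule net_0) (use assms in \<open>auto simp: F_def intro: aff_const\<close>)
  from net_trans[OF 1 this] have "net G (2 * M + 12) (n * (K + 2)) (F n)" by simp
  then show ?thesis by (rule net_subset) (auto simp: F_def)
qed

text \<open>Selection of a table entry by three digits: a step function in the first one, the other two
  by switching off all wrong values.\<close>

definition select :: "nat \<Rightarrow> nat \<Rightarrow> (nat \<Rightarrow> nat \<Rightarrow> nat \<Rightarrow> real) \<Rightarrow> real \<Rightarrow> real \<Rightarrow> real \<Rightarrow> real" where
  "select M L Y r s a = (\<Sum>c<L. \<Sum>j<M. relu (Y 0 j c
      + (\<Sum>e\<in>{1..<M}. (Y e j c - Y (e - 1) j c) * (relu (r - real e + 1) - relu (r - real e)))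
      - \<bar>s - real j\<bar> - \<bar>a - real c\<bar>))"

lemma select_eq:
  assumes "i < M" "k < M" "l < L" "\<And>i j c. 0 \<le> Y i j c \<and> Y i j c \<le> 1"
  shows "select M L Y (real i) (real k) (real l) = Y i k l"
proof -
  \<comment> \<open>At \<open>r = i\<close> the difference of ReLUs is 1 for
    \<open>e \<le> i\<close> and 0 otherwise, so the increments telescope.\<close>
  have step: "Y 0 j c + (\<Sum>e\<in>{1..<M}. (Y e j c - Y (e - 1) j c) *
      (relu (real i - real e + 1) - relu (real i - real e))) = Y i j c" for j c
  proof -
    have "(\<Sum>e\<in>{1..<M}. (Y e j c - Y (e - 1) j c) * (relu (real i - real e + 1) - relu (real i - real e)))
        = (\<Sum>e\<in>{1..<M}. if e \<le> i then Y e j c - Y (e - 1) j c else 0)"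
    proof (intro sum.cong refl)
      fix e
      show "(Y e j c - Y (e - 1) j c) * (relu (real i - real e + 1) - relu (real i - real e)) =
        (if e \<le> i then Y e j c - Y (e - 1) j c else 0)"
        by (cases "e \<le> i") (auto simp: relu_of_nonneg relu_of_nonpos)
    qed
    also have "\<dots> = (\<Sum>e\<in>{1..i}. Y e j c - Y (e - 1) j c)"
      using assms(1) by (intro sum.mono_neutral_cong_right) auto
    also have "\<dots> = Y i j c - Y 0 j c"
      by (induction i) auto
    finally show ?thesis by simp
  qed
  have "relu (Y i j c - \<bar>real k - real j\<bar> - \<bar>real l - real c\<bar>) = (if j = k then if c = l then Y i k l else 0 else 0)"
    for j c
  proof (cases "j = k \<and> c = l")
    case True
    then show ?thesis using assms(4) by (simp add: relu_of_nonneg)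
  next
    case False
    then have "1 \<le> \<bar>real k - real j\<bar> + \<bar>real l - real c\<bar>" by linarith
    then show ?thesis using False assms(4)[of i j c] by (auto intro!: relu_of_nonpos)
  qed
  then have "select M L Y (real i) (real k) (real l) =
     (\<Sum>c<L. \<Sum>j<M. if j = k then if c = l then Y i k l else 0 else 0)"
    unfolding select_def step by simp
  also have "\<dots> = Y i k l" using assms(2,3) by simp
  finally show ?thesis .
qed

text \<open>For one \<open>c\<close>, the \<open>M * M\<close> values sit in the weights between two
  layers of width of order \<open>M\<close>, because the \<open>2 * M\<close> kinks in
  \<open>r\<close> are shared by all \<open>j\<close>. The sum over \<open>c\<close> is serial, two
  layers per term.\<close>

lemma net_select:
  assumes "finite G" "r \<in> aff G" "s \<in> aff G" "a \<in> aff G" "0 < M"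
  shows "net G (5 * M + 4 + 2 * card G) (L * 2) ({\<lambda>x. select M L Y (r x) (s x) (a x)} \<union> G)"
proof -
  let ?g = "\<lambda>c j x. Y 0 j c
      + (\<Sum>e\<in>{1..<M}. (Y e j c - Y (e - 1) j c) * (relu (r x - real e + 1) - relu (r x - real e)))
      - \<bar>s x - real j\<bar> - \<bar>a x - real c\<bar>"
  have "net G (5 * M + 2) 2 {\<lambda>x. \<Sum>j<M. relu (?g c j x)}" for c
  proof -
    let ?S = "{\<lambda>x. a x - real c, \<lambda>x. - (a x - real c)}"
    let ?H = "(\<lambda>e x. r x - real e + 1) ` {..<M} \<union> (\<lambda>e x. r x - real e) ` {..<M} \<union>
      (\<lambda>j x. s x - real j) ` {..<M} \<union> (\<lambda>j x. - (s x - real j)) ` {..<M} \<union> ?S"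
    let ?R = "(\<lambda>f x. relu (f x)) ` ?H"
    have c4: "card (A \<union> B \<union> C \<union> E \<union> ?S) \<le> 5 * M + 2"
      if "card A \<le> M" "card B \<le> M" "card C \<le> M" "card E \<le> M" for A B C E
      using that card_Un_le[of "A \<union> B \<union> C \<union> E" ?S] card_Un_le[of "A \<union> B \<union> C" E] card_Un_le[of "A \<union> B" C]
        card_Un_le[of A B] card_insert_le_m1[of 2 "{\<lambda>x. - (a x - real c)}" "\<lambda>x. a x - real c"] by simp
    have 1: "net G (5 * M + 2) 1 ?R"
    proof (rule net_layer[where H = ?H])
      show "?H \<subseteq> aff G" using assms by (auto intro!: aff_add aff_minus aff_diff aff_const)
      show "card ?H \<le> 5 * M + 2"
        by (intro c4; rule order_trans[OF card_image_le]; simp)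
    qed (auto intro: aff_base)
    have "?g c j \<in> aff ?R" if j: "j < M" for j
    proof -
      have inR: "(\<lambda>x. relu (f x)) \<in> aff ?R" if "f \<in> ?H" for f
        using that by (intro aff_base) (rule imageI)
      have "(\<lambda>x. Y 0 j c
        + (\<Sum>e\<in>{1..<M}. (Y e j c - Y (e - 1) j c) * (relu (r x - real e + 1) - relu (r x - real e)))
        - (relu (s x - real j) + relu (- (s x - real j))) - (relu (a x - real c) + relu (- (a x - real c)))) \<in> aff ?R"
        by (intro aff_diff aff_add aff_const aff_sum aff_scale inR) (use j in auto)
      then show ?thesis by (simp only: abs_eq_relu)
    qed
    then have "net ?R (5 * M + 2) 1 {\<lambda>x. \<Sum>j<M. relu (?g c j x)}"
      by (intro net_layer_family[where I = "{..<M}" and h = "?g c"]) (auto intro!: aff_sum intro: aff_base)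
    from net_trans[OF this 1] show ?thesis by (simp add: numeral_2_eq_2)
  qed
  from net_serial_sum[OF assms(1), of L, OF this]
  have "net G (5 * M + 2 + 2 * (card G + 1)) (L * 2) ({\<lambda>x. \<Sum>c<L. \<Sum>j<M. relu (?g c j x)} \<union> G)" .
  moreover have "5 * M + 2 + 2 * (card G + 1) = 5 * M + 4 + 2 * card G" by simp
  ultimately show ?thesis unfolding select_def by (simp only:)
qed

text \<open>The offset 1/2 keeps the scaled integer away from every jump, so the reading is exact.
  The remainder has the same form, hence the next group of digits can be split off in the same
  way.\<close>

lemma digits_half:
  assumes "0 < T" "0 \<notin> set Rs" "i < prod_list Rs * T" "\<delta> = 1 / (2 * real (prod_list Rs * T))"
  shows "digits \<delta> Rs (0, (real i + 1 / 2) / real (prod_list Rs * T)) =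
    (real (i div T), (real (i mod T) + 1 / 2) / real T)"
proof -
  let ?P = "prod_list Rs" and ?u = "(real i + 1 / 2) / real (prod_list Rs * T)"
  have P: "0 < ?P" using assms(3) by (auto intro: Nat.gr0I)
  have "real i + 1 / 2 < real (?P * T)" using assms(3) by linarith
  then have "?u < 1" by simp
  have "real i = real (i div T) * real T + real (i mod T)"
    by (metis div_mult_mod_eq of_nat_add of_nat_mult)
  then have eq: "real ?P * ?u = real (i div T) + (real (i mod T) + 1 / 2) / real T"
    using P assms(1) by (simp add: field_simps)
  have "i mod T < T" using assms(1) by simp
  then have "real (i mod T) + 1 / 2 \<le> real T - 1 / 2" by linarith
  then have "(real (i mod T) + 1 / 2) / real T \<le> (real T - 1 / 2) / real T" by (rule divide_right_mono) simp
  then have m': "(real (i mod T) + 1 / 2) / real T \<le> 1 - 1 / (2 * real T)"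
    using assms(1) by (simp add: diff_divide_distrib)
  have lt: "(real (i mod T) + 1 / 2) / real T < 1" 
  proof -
    have "0 < 1 / (2 * real T)" using assms(1) by simp
    then show ?thesis using m' by linarith
  qed
  have "0 \<le> (real (i mod T) + 1 / 2) / real T" by (intro divide_nonneg_nonneg add_nonneg_nonneg) simp_all
  with lt have fl: "\<lfloor>real ?P * ?u\<rfloor> = int (i div T)"
    unfolding eq by (intro floor_unique; unfold of_int_of_nat_eq; linarith)
  have fr: "frac (real ?P * ?u) = (real (i mod T) + 1 / 2) / real T" unfolding frac_def fl unfolding eq by simp
  have "real ?P * \<delta> = 1 / (2 * real T)" using P assms(1,4) by simp
  then have "frac (real ?P * ?u) \<le> 1 - real ?P * \<delta>" using m' fr by simp
  moreover have "0 < \<delta>" using P assms(1,4) by simp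
  moreover have "0 \<le> ?u" by (intro divide_nonneg_nonneg add_nonneg_nonneg) simp_all
  ultimately show ?thesis
    using digits_eq[of \<delta> ?u Rs 0, OF _ _ \<open>?u < 1\<close> assms(2)] unfolding fl fr by simp
qed


text \<open>Rows of \<open>L\<close> entries are packed into \<open>M\<^sup>2L\<close> numbers, so that width \<open>O(M)\<close> suffices.\<close>

lemma net_lookup:
  fixes wt :: "nat \<Rightarrow> nat"
  assumes "I \<in> aff G" "M = 2 ^ \<alpha>" "1 \<le> \<alpha>" "L = 2 ^ \<beta>" "\<And>i. wt i < M ^ K"
  shows "\<exists>lam. net G (5 * M + 12) (2 + 2 * \<beta> + L * 2 + L * (K + 2)) {lam} \<and>
    (\<forall>x i. I x = real i \<longrightarrow> i < M * M * L * L \<longrightarrow> lam x = real (wt i) / real (M ^ K))"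
proof -
  have M: "2 \<le> M" "0 < M" using assms(2,3) by (auto simp: self_le_power)
  have L: "0 < L" using assms(4) by simp
  define T where "T = M * M * L * L"
  have T: "0 < T" using M L by (simp add: T_def)
  define \<delta> where "\<delta> = (\<lambda>P :: nat. 1 / (2 * real P))"
  define s0 where "s0 = (\<lambda>x. (I x + 1 / 2) / real T)"
  define d1 where "d1 = (\<lambda>x. digits (\<delta> T) [M] (0, s0 x))"
  define d2 where "d2 = (\<lambda>x. digits (\<delta> (M * L * L)) [M] (0, snd (d1 x)))"
  \<comment> \<open>\<open>L\<close> may exceed \<open>M\<close>, so its two digits are read bit by
    bit, in \<open>\<beta>\<close> layers each.\<close>
  define d3 where "d3 = (\<lambda>x. digits (\<delta> (L * L)) (replicate \<beta> 2) (0, snd (d2 x)))"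
  define d4 where "d4 = (\<lambda>x. digits (\<delta> L) (replicate \<beta> 2) (0, snd (d3 x)))"
  define r1 r2 r3 r4 where "r1 = (\<lambda>x. fst (d1 x))" and "r2 = (\<lambda>x. fst (d2 x))"
    and "r3 = (\<lambda>x. fst (d3 x))" and "r4 = (\<lambda>x. fst (d4 x))"
  have s0: "s0 \<in> aff G" unfolding s0_def by (intro aff_divide aff_add aff_const assms(1))
  have stage: "net E (5 * M + 12) (length Rs) ({\<lambda>x. fst (digits e Rs (0, t x)), \<lambda>x. snd (digits e Rs (0, t x))} \<union> C)"
    if "t \<in> aff E" "\<And>R. R \<in> set Rs \<Longrightarrow> R \<le> M" "finite C" "card C \<le> 3" "C \<subseteq> aff E" for E e Rs t C
    by (rule net_mono[OF net_carry[OF net_digits[OF aff_const that(1,2)] that(3,5)]]) (use that(4) in auto)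
  have n1: "net G (5 * M + 12) 1 {r1, \<lambda>x. snd (d1 x)}"
    using stage[of s0 G "[M]" "{}" "\<delta> T"] s0 by (simp add: r1_def d1_def)
  have n2: "net {r1, \<lambda>x. snd (d1 x)} (5 * M + 12) 1 {r1, r2, \<lambda>x. snd (d2 x)}"
    using stage[of "\<lambda>x. snd (d1 x)" "{r1, \<lambda>x. snd (d1 x)}" "[M]" "{r1}" "\<delta> (M * L * L)"]
    by (auto simp: r2_def d2_def insert_commute intro: aff_base)
  have n3: "net {r1, r2, \<lambda>x. snd (d2 x)} (5 * M + 12) \<beta> {r1, r2, r3, \<lambda>x. snd (d3 x)}"
  proof (rule net_subset)
    show "net {r1, r2, \<lambda>x. snd (d2 x)} (5 * M + 12) \<beta> ({r3, \<lambda>x. snd (d3 x)} \<union> {r1, r2})"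
      unfolding r3_def d3_def
      by (rule stage[of _ _ "replicate \<beta> 2", unfolded length_replicate])
        (use M in \<open>auto simp: card_insert_if intro: aff_base\<close>)
  qed auto
  have n4: "net {r1, r2, r3, \<lambda>x. snd (d3 x)} (5 * M + 12) \<beta> {r1, r2, r3, r4}"
  proof (rule net_subset)
    show "net {r1, r2, r3, \<lambda>x. snd (d3 x)} (5 * M + 12) \<beta> ({r4, \<lambda>x. snd (d4 x)} \<union> {r1, r2, r3})"
      unfolding r4_def d4_def
      by (rule stage[of _ _ "replicate \<beta> 2", unfolded length_replicate])
        (use M in \<open>auto simp: card_insert_if intro: aff_base\<close>)
  qed auto
  \<comment> \<open>The index has the digits \<open>i\<close>, \<open>k\<close> in base
    \<open>M\<close> and \<open>l\<close>, \<open>q\<close> in base \<open>L\<close>; the last one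
    is the position within a packed row.\<close>
  define w where "w i k l q = wt (((i * M + k) * L + l) * L + q)" for i k l q
  define Y where "Y i k l = pack (M ^ K) (w i k l) L" for i k l
  have Y: "0 \<le> Y i k l \<and> Y i k l \<le> 1" for i k l
    unfolding Y_def using pack_bounds[of "M ^ K" "w i k l" L] pack_lt_1[of "M ^ K" "w i k l" L] assms(5) M
    by (simp add: w_def less_imp_le)
  define y where "y = (\<lambda>x. select M L Y (r1 x) (r2 x) (r3 x))"
  have n5: "net {r1, r2, r3, r4} (5 * M + 12) (L * 2) {y, r4}"
  proof (rule net_subset)
    have "card {r1, r2, r3, r4} \<le> 4" by (auto simp: card_insert_if)
    then show "net {r1, r2, r3, r4} (5 * M + 12) (L * 2) ({y} \<union> {r1, r2, r3, r4})"
      unfolding y_def using M by (intro net_mono[OF net_select]) (auto intro: aff_base)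
  qed auto
  \<comment> \<open>The margin that a packed row of \<open>L\<close> entries leaves below 1.\<close>
  define e where "e = 1 / (2 * real (M ^ K) ^ L)"
  define lam where "lam = (\<lambda>x. snd (unpack e M K (r4 x) L (y x)))"
  have n6: "net {y, r4} (5 * M + 12) (L * (K + 2)) {lam}"
    unfolding lam_def by (rule net_mono[OF net_unpack]) (use M in \<open>auto intro: aff_base\<close>)
  have "net G (5 * M + 12) (1 + 1 + \<beta> + \<beta> + L * 2 + L * (K + 2)) {lam}"
    using net_trans[OF n6 net_trans[OF n5 net_trans[OF n4 net_trans[OF n3 net_trans[OF n2 n1]]]]]
    by (simp add: add.assoc)
  moreover have eq: "1 + 1 + \<beta> + \<beta> + L * 2 + L * (K + 2) = 2 + 2 * \<beta> + L * 2 + L * (K + 2)" by simp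
  ultimately have net: "net G (5 * M + 12) (2 + 2 * \<beta> + L * 2 + L * (K + 2)) {lam}" by (simp only: eq)
  have "lam x = real (wt i) / real (M ^ K)" if x: "I x = real i" and i: "i < T" for x i
  proof -
    define i1 i2 i3 where "i1 = i mod (M * L * L)" and "i2 = i1 mod (L * L)" and "i3 = i2 mod L"
    have d1: "d1 x = (real (i div (M * L * L)), (real i1 + 1 / 2) / real (M * L * L))"
      using digits_half[of "M * L * L" "[M]" i "\<delta> T"] M L i unfolding d1_def s0_def x i1_def \<delta>_def T_def
      by (simp add: mult.assoc)
    have i1: "i1 < M * (L * L)" using M L by (simp add: i1_def mult.assoc)
    have d2: "d2 x = (real (i1 div (L * L)), (real i2 + 1 / 2) / real (L * L))"
      using digits_half[of "L * L" "[M]" i1 "\<delta> (M * L * L)"] M L i1 unfolding d2_def d1 i2_def \<delta>_def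
      by (simp add: mult.assoc)
    have i2: "i2 < L * L" using L by (simp add: i2_def)
    have d3: "d3 x = (real (i2 div L), (real i3 + 1 / 2) / real L)"
      using digits_half[of L "replicate \<beta> 2" i2 "\<delta> (L * L)"] L i2 assms(4) unfolding d3_def d2 i3_def \<delta>_def
      by (simp add: prod_list_replicate)
    have i3: "i3 < L" using L by (simp add: i3_def)
    have d4: "d4 x = (real i3, 1 / 2)"
      using digits_half[of 1 "replicate \<beta> 2" i3 "\<delta> L"] i3 assms(4) unfolding d4_def d3 \<delta>_def
      by (simp add: prod_list_replicate)
    have b1: "i div (M * L * L) < M" using i by (intro less_mult_imp_div_less) (simp add: T_def mult.assoc)
    have b2: "i1 div (L * L) < M" using i1 by (simp add: less_mult_imp_div_less)
    have b3: "i2 div L < L" using i2 by (simp add: less_mult_imp_div_less)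
    have dec: "((i div (M * L * L) * M + i1 div (L * L)) * L + i2 div L) * L + i3 = i"
    proof -
      have "i2 = i2 div L * L + i3" "i1 = i1 div (L * L) * (L * L) + i2" "i = i div (M * L * L) * (M * L * L) + i1"
        unfolding i1_def i2_def i3_def by (rule div_mult_mod_eq[symmetric])+
      then show ?thesis by (metis add.assoc distrib_right mult.assoc)
    qed
    have "y x = pack (M ^ K) (w (i div (M * L * L)) (i1 div (L * L)) (i2 div L)) L"
      unfolding y_def r1_def r2_def r3_def d1 d2 d3 fst_conv by (simp add: select_eq[OF b1 b2 b3 Y] Y_def)
    note yx = this
    have "lam x = real (w (i div (M * L * L)) (i1 div (L * L)) (i2 div L) i3) / real (M ^ K)"
      unfolding lam_def r4_def d4 fst_conv yx
      by (subst unpack_pack) (use M assms(5) i3 in \<open>auto simp: w_def e_def\<close>)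
    then show ?thesis by (simp add: w_def dec)
  qed
  then show ?thesis using net unfolding T_def by blast
qed

subsection \<open>One level of the sparse grid\<close>

text \<open>Mixed radix with the first coordinate least significant. It is linear in
  \<open>i\<close>, so a network obtains the table index from the coordinate indices by an affine
  map.\<close>

primrec enc :: "(nat \<Rightarrow> nat) \<Rightarrow> nat \<Rightarrow> (nat \<Rightarrow> nat) \<Rightarrow> nat" where
  "enc m 0 i = 0"
| "enc m (Suc d) i = enc m d i + 2 ^ (\<Sum>j<d. m j) * i d"

lemma enc_less: "(\<And>j. j < d \<Longrightarrow> i j < 2 ^ m j) \<Longrightarrow> enc m d i < 2 ^ (\<Sum>j<d. m j)"
proof (induction d)
  case 0
  then show ?case by simp
next
  case (Suc d)
  let ?P = "2 ^ (\<Sum>j<d. m j) :: nat"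
  have "enc m d i < ?P" "i d + 1 \<le> 2 ^ m d" using Suc by (auto simp: Suc_le_eq)
  then have "enc m d i + ?P * i d < ?P * (i d + 1)" by simp
  also have "\<dots> \<le> ?P * 2 ^ m d" using \<open>i d + 1 \<le> 2 ^ m d\<close> by (intro mult_left_mono) auto
  finally show ?case by (simp add: power_add)
qed

lemma enc_inj:
  assumes "\<And>j. j < d \<Longrightarrow> i j < 2 ^ m j" "\<And>j. j < d \<Longrightarrow> i' j < 2 ^ m j" "enc m d i = enc m d i'" "j < d"
  shows "i j = i' j"
  using assms
proof (induction d)
  case 0
  then show ?case by simp
next
  case (Suc d)
  let ?P = "2 ^ (\<Sum>j<d. m j) :: nat"
  have lt: "enc m d i < ?P" "enc m d i' < ?P" using Suc.prems by (auto intro!: enc_less)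
  have eq: "enc m d i + ?P * i d = enc m d i' + ?P * i' d" using Suc.prems(3) by simp
  from arg_cong[OF eq, of "\<lambda>n. n mod ?P"] lt have 1: "enc m d i = enc m d i'" by simp
  with eq have "i d = i' d" by simp
  then show ?case using Suc.IH[OF _ _ 1] Suc.prems by (cases "j = d") auto
qed

definition cells :: "nat \<Rightarrow> (nat \<Rightarrow> nat) \<Rightarrow> (nat \<Rightarrow> nat) set" where
  "cells d m = (\<Pi>\<^sub>E j\<in>{..<d}. {..<2 ^ m j})"

lemma inj_on_enc: "inj_on (enc m d) (cells d m)"
proof (rule inj_onI)
  fix i i' assume *: "i \<in> cells d m" "i' \<in> cells d m" "enc m d i = enc m d i'"
  show "i = i'"
  proof (rule PiE_ext[OF *(1,2)[unfolded cells_def]])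
    show "i j = i' j" if "j \<in> {..<d}" for j
      using * that by (intro enc_inj[of d i m i']) (auto simp: cells_def PiE_iff)
  qed
qed

text \<open>Rounding down to \<open>B\<close> levels; on \<open>[0,1]\<close> the minimum acts only
  at \<open>t = 1\<close>.\<close>

definition code :: "nat \<Rightarrow> real \<Rightarrow> nat" where
  "code B t = min (B - 1) (nat \<lfloor>real B * t\<rfloor>)"

lemma code_less: "0 < B \<Longrightarrow> code B t < B"
  by (auto simp: code_def min_def)

lemma code_error:
  assumes "0 < B" "0 \<le> t" "t \<le> 1"
  shows "\<bar>real (code B t) / real B - t\<bar> \<le> 1 / real B"
proof -
  have "0 \<le> real B * t" "real B * t \<le> real B" using assms by (auto simp: mult_left_le)
  define n where "n = nat \<lfloor>real B * t\<rfloor>"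
  have "real n \<le> real B * t" "real B * t < real n + 1"
    unfolding n_def using \<open>0 \<le> real B * t\<close> by linarith+
  then have "\<bar>real (code B t) - real B * t\<bar> \<le> 1"
    using \<open>real B * t \<le> real B\<close> assms(1) unfolding code_def n_def[symmetric] by (auto simp: min_def of_nat_diff)
  then have "\<bar>real (code B t) - real B * t\<bar> / real B \<le> 1 / real B" by (rule divide_right_mono) simp
  also have "\<bar>real (code B t) - real B * t\<bar> / real B = \<bar>(real (code B t) - real B * t) / real B\<bar>" by simp
  also have "(real (code B t) - real B * t) / real B = real (code B t) / real B - t"
    using assms(1) by (simp add: diff_divide_distrib)
  finally show ?thesis .
qed

text \<open>At \<open>x j = 1\<close> the index is \<open>2 ^ m j\<close>, just outside
  \<open>cells d m\<close>; \<open>bump\<close> vanishes there.\<close>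

definition cell_of :: "nat \<Rightarrow> (nat \<Rightarrow> nat) \<Rightarrow> (nat \<Rightarrow> real) \<Rightarrow> nat \<Rightarrow> nat" where
  "cell_of d m x = (\<lambda>j\<in>{..<d}. nat \<lfloor>2 ^ m j * x j\<rfloor>)"

text \<open>All hats of level \<open>m\<close> at once: in coordinate \<open>j\<close> every
  interval of length \<open>1 / 2 ^ m j\<close> carries one tent, with its peak at the
  midpoint.\<close>

definition bump :: "nat \<Rightarrow> (nat \<Rightarrow> nat) \<Rightarrow> (nat \<Rightarrow> real) \<Rightarrow> real" where
  "bump d m x = (\<Prod>j<d. zigzag (2 ^ (m j + 1) * x j))"

lemma bump_bounds: "0 \<le> bump d m x" "bump d m x \<le> 1"
  unfolding bump_def by (auto intro!: prod_nonneg prod_le_1 simp: zigzag_bounds)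

lemma bump_le_factor:
  assumes "j < d" shows "bump d m x \<le> zigzag (2 ^ (m j + 1) * x j)"
proof -
  have "bump d m x = zigzag (2 ^ (m j + 1) * x j) * (\<Prod>j\<in>{..<d} - {j}. zigzag (2 ^ (m j + 1) * x j))"
    unfolding bump_def using assms by (subst prod.remove[of _ j]) auto
  also have "\<dots> \<le> zigzag (2 ^ (m j + 1) * x j)"
    by (intro mult_left_le prod_le_1) (auto simp: zigzag_bounds)
  finally show ?thesis .
qed

text \<open>The summands are the stages of \<open>net_unit\<close>: cell indices and zigzags, lookup
  with \<open>L = 2 ^ \<beta>\<close> and \<open>K = 4 + 4 * \<beta>\<close>, clamping, product of
  the hats, and multiplication by the coefficient, the last two with
  \<open>Q = 2 + 2 * \<beta>\<close>.\<close>

definition unit_depth :: "nat \<Rightarrow> nat \<Rightarrow> nat" where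
  "unit_depth d \<beta> = (3 + 2 * \<beta>) + (2 + 2 * \<beta> + 2 ^ \<beta> * 2 + 2 ^ \<beta> * (4 + 4 * \<beta> + 2)) + 1
     + d * (2 + 2 * \<beta> + 1) + (2 + 2 * \<beta> + 1)"

text \<open>In units of \<open>A * \<epsilon>\<close>, the error \<open>d + 4\<close> consists of
  \<open>d\<close> from the product of the hats, 2 from rounding the coefficient or from a wrong
  cell index, and 2 from the last multiplication.\<close>

lemma net_unit:
  fixes \<xi> :: "nat \<Rightarrow> 'a \<Rightarrow> real" and v :: "(nat \<Rightarrow> nat) \<Rightarrow> real"
  assumes G: "G = \<xi> ` {..<d}" and \<xi>: "\<And>j x. j < d \<Longrightarrow> 0 \<le> \<xi> j x \<and> \<xi> j x \<le> 1"
    and M: "M = 2 ^ \<alpha>" "1 \<le> \<alpha>" and d: "1 \<le> d" and m: "(\<Sum>j<d. m j) \<le> 2 * \<alpha> + 2 * \<beta>"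
    and v: "\<And>i. \<bar>v i\<bar> \<le> A" "0 < A"
  shows "\<exists>k. net G (d * (5 * M + 16)) (unit_depth d \<beta>) {k} \<and>
    (\<forall>x. \<bar>k x - v (cell_of d m (\<lambda>j. \<xi> j x)) * bump d m (\<lambda>j. \<xi> j x)\<bar> \<le> A * ((real d + 4) / 4 ^ (2 * \<alpha> + 2 * \<beta>)))"
proof -
  define n where "n = 2 * \<alpha> + 2 * \<beta>"
  define K where "K = 4 + 4 * \<beta>"
  define Q where "Q = 2 + 2 * \<beta>"
  define L :: nat where "L = 2 ^ \<beta>"
  define W where "W = d * (5 * M + 16)"
  define \<epsilon> :: real where "\<epsilon> = 1 / 4 ^ n"
  define \<eta> where "\<eta> = \<epsilon> / 2"
  have \<eta>: "0 < \<eta>" "\<eta> \<le> 1 / 2" "2 * \<eta> = \<epsilon>" "0 < \<epsilon>" by (auto simp: \<eta>_def \<epsilon>_def)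
  have M2: "2 \<le> M" "0 < M" using M by (auto simp: self_le_power)
  \<comment> \<open>\<open>K\<close> and \<open>2 * Q\<close> digits in base
    \<open>2 ^ \<alpha>\<close> resolve \<open>4 ^ - n\<close>, because
    \<open>\<alpha> * \<beta>\<close> is at least \<open>\<beta>\<close>. Thus \<open>K\<close> and
    \<open>Q\<close> can be chosen independently of \<open>\<alpha>\<close>, and the depth is free
    of \<open>N\<close>.\<close>
  have mono: "\<alpha> * (4 + 4 * \<beta>) \<ge> 2 * n"
  proof -
    have "\<beta> \<le> \<alpha> * \<beta>" using M(2) by simp
    then show ?thesis by (simp add: n_def algebra_simps)
  qed
  have MK: "M ^ K = 2 ^ (\<alpha> * (4 + 4 * \<beta>))" "M ^ (2 * Q) = 2 ^ (\<alpha> * (4 + 4 * \<beta>))"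
    unfolding M(1) K_def Q_def power_mult[symmetric] by (simp_all add: distrib_left)
  have "(4 :: real) ^ n = 2 ^ (2 * n)" by (simp add: power_mult)
  also have "\<dots> \<le> 2 ^ (\<alpha> * (4 + 4 * \<beta>))" using mono by (intro power_increasing) auto
  finally have "4 ^ n \<le> (2 :: real) ^ (\<alpha> * (4 + 4 * \<beta>))" .
  then have small: "1 / real (M ^ K) \<le> \<epsilon>" "1 / real (M ^ (2 * Q)) \<le> \<epsilon>"
    unfolding MK \<epsilon>_def by (auto intro!: divide_left_mono)
  have len: "m j + 1 \<le> (3 + 2 * \<beta>) * \<alpha>" if "j < d" for j
  proof -
    have "m j \<le> (\<Sum>j<d. m j)" using that by (intro member_le_sum) auto
    moreover have "\<beta> \<le> \<beta> * \<alpha>" using M(2) by simp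
    moreover have "(3 + 2 * \<beta>) * \<alpha> = 3 * \<alpha> + 2 * (\<beta> * \<alpha>)" by (simp add: algebra_simps)
    ultimately show ?thesis using m M(2) by linarith
  qed
  have "\<forall>j. j < d \<longrightarrow> (\<exists>Rs. length Rs = 3 + 2 * \<beta> \<and> (\<forall>R\<in>set Rs. R \<le> M) \<and> 0 \<notin> set Rs \<and> prod_list Rs = 2 ^ m j)"
    unfolding M(1) using len by (intro allI impI radix_list) (metis Suc_eq_plus1 Suc_leD)
  then obtain R1 where R1: "\<And>j. j < d \<Longrightarrow> length (R1 j) = 3 + 2 * \<beta>"
    "\<And>j R. j < d \<Longrightarrow> R \<in> set (R1 j) \<Longrightarrow> R \<le> M" "\<And>j. j < d \<Longrightarrow> 0 \<notin> set (R1 j)"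
    "\<And>j. j < d \<Longrightarrow> prod_list (R1 j) = 2 ^ m j" by metis
  have "\<forall>j. j < d \<longrightarrow> (\<exists>Rs. length Rs = 3 + 2 * \<beta> \<and> (\<forall>R\<in>set Rs. R \<le> M) \<and> 0 \<notin> set Rs \<and> prod_list Rs = 2 ^ (m j + 1))"
    unfolding M(1) using len by (intro allI impI radix_list)
  then obtain R2 where R2: "\<And>j. j < d \<Longrightarrow> length (R2 j) = 3 + 2 * \<beta>"
    "\<And>j R. j < d \<Longrightarrow> R \<in> set (R2 j) \<Longrightarrow> R \<le> M" "\<And>j. j < d \<Longrightarrow> 0 \<notin> set (R2 j)"
    "\<And>j. j < d \<Longrightarrow> prod_list (R2 j) = 2 ^ (m j + 1)" by metis
  \<comment> \<open>The ramp width is \<open>\<eta>\<close> when measured in cells of level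
    \<open>m j\<close>.\<close>
  define di where "di j = (\<lambda>x. fst (digits (\<eta> / 2 ^ m j) (R1 j) (0, \<xi> j x)))" for j
  define \<phi> where "\<phi> j = (\<lambda>x. zigzag (2 ^ (m j + 1) * \<xi> j x))" for j
  have \<phi>: "0 \<le> \<phi> j x \<and> \<phi> j x \<le> 1" for j x by (simp add: \<phi>_def zigzag_bounds)
  define \<Phi> where "\<Phi> = \<phi> ` {..<d}"
  have fin: "finite \<Phi>" "card \<Phi> \<le> d" using card_image_le[of "{..<d}" \<phi>] by (auto simp: \<Phi>_def)
  define E where "E = (\<Union>j\<in>{..<d}. {di j, \<phi> j})"
  have n1: "net G W (3 + 2 * \<beta>) E"
  proof -
    have "net G (3 * M + 4) (3 + 2 * \<beta>) {di j, \<phi> j}" if j: "j < d" for j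
    proof -
      have \<xi>G: "\<xi> j \<in> aff G" using j by (intro aff_base) (auto simp: G)
      have "net G (2 * M + 4) (length (R1 j)) {di j, \<lambda>x. snd (digits (\<eta> / 2 ^ m j) (R1 j) (0, \<xi> j x))}"
        unfolding di_def by (rule net_digits[OF aff_const \<xi>G R1(2)[OF j]])
      then have 1: "net G (2 * M + 4) (3 + 2 * \<beta>) {di j}" unfolding R1(1)[OF j] by (rule net_subset) simp
      from net_zigzag[OF \<xi>G _ _ R2(2)[OF j] R2(3)[OF j]] \<xi> j R2(1)[OF j] R2(4)[OF j]
      have 2: "net G M (3 + 2 * \<beta>) {\<phi> j}" by (simp add: \<phi>_def)
      from net_Un[OF 1 2] show ?thesis by (simp add: insert_commute)
    qed
    from net_UN[of "{..<d}", OF _ this] have "net G (d * (3 * M + 4)) (3 + 2 * \<beta>) E" by (simp add: E_def)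
    then show ?thesis by (rule net_mono) (simp add: W_def)
  qed
  define I where "I = (\<lambda>x. \<Sum>j<d. 2 ^ (\<Sum>i<j. m i) * di j x)"
  have I_aff: "I \<in> aff E" unfolding I_def by (intro aff_sum aff_scale aff_base) (auto simp: E_def)
  \<comment> \<open>Coefficients in \<open>[-A, A]\<close> are moved to \<open>[0,1]\<close> before
    rounding; the final combination \<open>2 * pw - p\<close> undoes the shift.\<close>
  define wt where "wt e = code (M ^ K) ((v (inv_into (cells d m) (enc m d) e) / A + 1) / 2)" for e
  have "\<exists>lam. net E (5 * M + 12) (2 + 2 * \<beta> + L * 2 + L * (K + 2)) {lam} \<and>
    (\<forall>x i. I x = real i \<longrightarrow> i < M * M * L * L \<longrightarrow> lam x = real (wt i) / real (M ^ K))"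
    by (rule net_lookup[OF I_aff M L_def]) (use M2 in \<open>auto simp: wt_def intro: code_less\<close>)
  then obtain lam where lam: "net E (5 * M + 12) (2 + 2 * \<beta> + L * 2 + L * (K + 2)) {lam}"
    "\<And>x i. I x = real i \<Longrightarrow> i < M * M * L * L \<Longrightarrow> lam x = real (wt i) / real (M ^ K)" by blast
  have \<Phi>E: "\<Phi> \<subseteq> aff E" by (auto simp: \<Phi>_def E_def intro: aff_base)
  have n2: "net E W (2 + 2 * \<beta> + L * 2 + L * (K + 2)) ({lam} \<union> \<Phi>)"
    by (rule net_mono[OF net_carry[OF lam(1) fin(1) \<Phi>E]]) (use fin(2) d in \<open>cases d; auto simp: W_def algebra_simps\<close>)
  \<comment> \<open>For a wrong index nothing is known about \<open>lam\<close>; clamping turns it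
    into a legal factor.\<close>
  define w where "w = (\<lambda>x. clamp01 (lam x))"
  have w: "0 \<le> w x \<and> w x \<le> 1" for x by (simp add: w_def clamp01_bounds)
  have n3: "net ({lam} \<union> \<Phi>) W 1 ({w} \<union> \<Phi>)"
  proof (rule net_mono)
    show "net ({lam} \<union> \<Phi>) (2 + 2 * card \<Phi>) 1 ({w} \<union> \<Phi>)" unfolding w_def
      by (intro net_carry net_clamp01 fin(1)) (auto intro: aff_base)
    show "2 + 2 * card \<Phi> \<le> W" using fin(2) d by (cases d) (auto simp: W_def algebra_simps)
  qed
  define p where "p = (\<lambda>x. prod_approx M Q (\<lambda>j. \<phi> j x) d)"
  have n4: "net ({w} \<union> \<Phi>) W (d * (Q + 1)) {p, w}"
  proof (rule net_subset)
    show "net ({w} \<union> \<Phi>) W (d * (Q + 1)) ({p} \<union> ({w} \<union> \<Phi>))" unfolding p_def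
    proof (rule net_mono[OF net_prod_approx])
      have "card ({w} \<union> \<Phi>) \<le> d + 1" using card_Un_le[of "{w}" \<Phi>] fin(2) by simp
      then show "3 * M + 14 + 2 * card ({w} \<union> \<Phi>) \<le> W" using d M2 by (cases d) (auto simp: W_def algebra_simps)
    qed (use fin \<phi> M2 in \<open>auto simp: \<Phi>_def intro: aff_base\<close>)
  qed auto
  define pw where "pw = (\<lambda>x. mul_approx M Q (p x) (w x))"
  have p: "0 \<le> p x \<and> p x \<le> 1" for x by (simp add: p_def prod_approx_bounds)
  have n5: "net {p, w} W (Q + 1) ({pw} \<union> {p})"
  proof (rule net_mono)
    show "net {p, w} (3 * M + 12 + 2 * card {p}) (Q + 1) ({pw} \<union> {p})" unfolding pw_def
      by (intro net_carry net_mul_approx) (use p w M2 in \<open>auto intro: aff_base\<close>)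
    show "3 * M + 12 + 2 * card {p} \<le> W" using d M2 by (cases d) (auto simp: W_def)
  qed
  define k where "k = (\<lambda>x. A * (2 * pw x - p x))"
  have "net G W (3 + 2 * \<beta> + (2 + 2 * \<beta> + L * 2 + L * (K + 2)) + 1 + d * (Q + 1) + (Q + 1)) ({pw} \<union> {p})"
    using net_trans[OF n5 net_trans[OF n4 net_trans[OF n3 net_trans[OF n2 n1]]]] .
  moreover have "k \<in> aff ({pw} \<union> {p})" unfolding k_def by (intro aff_scale aff_diff aff_base) auto
  ultimately have net: "net G (d * (5 * M + 16)) (unit_depth d \<beta>) {k}"
    unfolding unit_depth_def W_def[symmetric] Q_def K_def L_def by (auto elim: net_aff)
  have "\<bar>k x - v (cell_of d m (\<lambda>j. \<xi> j x)) * bump d m (\<lambda>j. \<xi> j x)\<bar> \<le> A * ((real d + 4) * \<epsilon>)" for x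
  proof -
    define b where "b = bump d m (\<lambda>j. \<xi> j x)"
    define u where "u = v (cell_of d m (\<lambda>j. \<xi> j x)) / A"
    have b: "0 \<le> b" "b \<le> 1" by (auto simp: b_def bump_bounds)
    have u: "\<bar>u\<bar> \<le> 1" using v(1)[of "cell_of d m (\<lambda>j. \<xi> j x)"] v(2) by (simp add: u_def)
    have "\<bar>p x - b\<bar> \<le> real d / real (M ^ (2 * Q))"
      using prod_approx_error[OF M2(2), of d "\<lambda>j. \<phi> j x" Q] \<phi> by (simp add: p_def b_def bump_def \<phi>_def)
    also have "\<dots> \<le> real d * \<epsilon>" using small(2) mult_left_mono[OF small(2), of "real d"] by simp
    finally have pb: "\<bar>p x - b\<bar> \<le> real d * \<epsilon>" .
    have pwe: "\<bar>pw x - p x * w x\<bar> \<le> \<epsilon>"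
      using mul_approx_error[OF M2(2), of "p x" "w x" Q] p[of x] w[of x] small(2) unfolding pw_def by linarith
    have main: "\<bar>(2 * w x - 1) * p x - u * b\<bar> \<le> (real d + 2) * \<epsilon>"
    \<comment> \<open>Below the top \<open>\<eta>\<close>-part of its cell every coordinate index is
      exact, and \<open>\<xi> j x < 1\<close> keeps it in range.\<close>
    proof (cases "\<forall>j<d. \<xi> j x < 1 \<and> frac (2 ^ m j * \<xi> j x) \<le> 1 - \<eta>")
      case True
      have di: "di j x = real (cell_of d m (\<lambda>j. \<xi> j x) j)" if j: "j < d" for j
      proof -
        have "digits (\<eta> / 2 ^ m j) (R1 j) (0, \<xi> j x) =
          (real (prod_list (R1 j)) * 0 + of_int \<lfloor>real (prod_list (R1 j)) * \<xi> j x\<rfloor>, frac (real (prod_list (R1 j)) * \<xi> j x))"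
          by (rule digits_eq) (use j True \<xi> \<eta> R1 in \<open>auto\<close>)
        then show ?thesis using j \<xi>[OF j, of x] by (simp add: di_def cell_of_def R1(4))
      qed
      define c where "c = cell_of d m (\<lambda>j. \<xi> j x)"
      have c: "c \<in> cells d m"
      proof -
        have "nat \<lfloor>2 ^ m j * \<xi> j x\<rfloor> < 2 ^ m j" if j: "j < d" for j
        proof -
          have "2 ^ m j * \<xi> j x < 2 ^ m j * 1" using True j by (intro mult_strict_left_mono) auto
          then have "\<lfloor>2 ^ m j * \<xi> j x\<rfloor> < 2 ^ m j" by (simp add: floor_less_iff)
          then show ?thesis by (simp add: nat_less_iff)
        qed
        then show ?thesis by (auto simp: c_def cells_def cell_of_def)
      qed
      have "I x = real (enc m d c)"
      proof -
        have "(\<Sum>j<e. 2 ^ (\<Sum>i<j. m i) * di j x) = real (enc m e c)" if "e \<le> d" for e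
          using that by (induction e) (auto simp: di c_def)
        then show ?thesis by (simp add: I_def)
      qed
      moreover have "enc m d c < M * M * L * L"
      proof -
        have "enc m d c < 2 ^ (\<Sum>j<d. m j)" using c by (intro enc_less) (auto simp: cells_def PiE_iff)
        also have "\<dots> \<le> 2 ^ (2 * \<alpha> + 2 * \<beta>)" using m by (intro power_increasing) auto
        also have "\<dots> = M * M * L * L" by (simp add: M(1) L_def power_add mult_2)
        finally show ?thesis .
      qed
      ultimately have "lam x = real (wt (enc m d c)) / real (M ^ K)" by (rule lam(2))
      also have "wt (enc m d c) = code (M ^ K) ((u + 1) / 2)"
        using inv_into_f_f[OF inj_on_enc c] by (simp add: wt_def u_def c_def)
      finally have l: "lam x = real (code (M ^ K) ((u + 1) / 2)) / real (M ^ K)" .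
      then have "0 \<le> lam x" "lam x \<le> 1" using code_less[of "M ^ K" "(u + 1) / 2"] M2 by auto
      then have "w x = lam x" by (simp add: w_def clamp01_id)
      then have "\<bar>w x - (u + 1) / 2\<bar> \<le> \<epsilon>"
        using code_error[of "M ^ K" "(u + 1) / 2"] u small(1) l M2 by (simp add: abs_le_iff)
      then have "\<bar>(2 * w x - 1) - u\<bar> \<le> 2 * \<epsilon>" by (simp add: abs_le_iff field_simps)
      then have "\<bar>(2 * w x - 1) - u\<bar> * b \<le> 2 * \<epsilon> * 1" using b by (intro mult_mono) auto
      moreover have "\<bar>2 * w x - 1\<bar> * \<bar>p x - b\<bar> \<le> 1 * (real d * \<epsilon>)"
        using w[of x] pb by (intro mult_mono) (auto simp: abs_le_iff)
      moreover have "(2 * w x - 1) * p x - u * b = (2 * w x - 1) * (p x - b) + ((2 * w x - 1) - u) * b"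
        by (simp add: algebra_simps)
      moreover have "\<bar>(2 * w x - 1) * (p x - b) + ((2 * w x - 1) - u) * b\<bar>
          \<le> \<bar>2 * w x - 1\<bar> * \<bar>p x - b\<bar> + \<bar>(2 * w x - 1) - u\<bar> * b"
        using b by (intro order_trans[OF abs_triangle_ineq]) (simp add: abs_mult)
      ultimately show ?thesis by (simp add: algebra_simps)
    next
      case False
      then obtain j where j: "j < d" "\<xi> j x = 1 \<or> 1 - \<eta> < frac (2 ^ m j * \<xi> j x)"
        using \<xi> by (metis not_less order_less_le)
      \<comment> \<open>The tent has slope 2 in cell units and vanishes at the right end of the
        cell, in particular at \<open>\<xi> j x = 1\<close>.\<close>
      have "\<phi> j x \<le> 2 * \<eta>"
      proof -
        have "\<phi> j x = 1 - \<bar>2 * frac (2 ^ m j * \<xi> j x) - 1\<bar>"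
          using zigzag_double[of "2 ^ m j * \<xi> j x"] by (simp add: \<phi>_def mult.assoc)
        moreover have "frac ((2 :: real) ^ m j) = 0" by simp
        ultimately show ?thesis using j(2) \<eta>(1,2) by (auto simp del: frac_eq_0_iff)
      qed
      then have "b \<le> \<epsilon>" using bump_le_factor[OF j(1), of m "\<lambda>j. \<xi> j x"] \<eta>(3) by (simp add: b_def \<phi>_def)
      moreover have "\<bar>2 * w x - 1\<bar> * p x \<le> 1 * p x" using w[of x] p[of x] by (intro mult_mono) (auto simp: abs_le_iff)
      moreover have "p x \<le> b + real d * \<epsilon>" using pb by linarith
      moreover have "\<bar>u\<bar> * b \<le> 1 * b" using u b by (intro mult_mono) auto
      moreover have "\<bar>(2 * w x - 1) * p x - u * b\<bar> \<le> \<bar>2 * w x - 1\<bar> * p x + \<bar>u\<bar> * b"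
        using b p[of x] by (intro order_trans[OF abs_triangle_ineq4]) (simp add: abs_mult)
      ultimately show ?thesis by (simp add: algebra_simps)
    qed
    have "2 * pw x - p x - u * b = 2 * (pw x - p x * w x) + ((2 * w x - 1) * p x - u * b)"
      by (simp add: algebra_simps)
    then have "\<bar>2 * pw x - p x - u * b\<bar> \<le> (real d + 4) * \<epsilon>"
      using main pwe by (simp add: algebra_simps)
    then have "A * \<bar>2 * pw x - p x - u * b\<bar> \<le> A * ((real d + 4) * \<epsilon>)" using v(2) by (intro mult_left_mono) auto
    also have "A * \<bar>2 * pw x - p x - u * b\<bar> = \<bar>A * (2 * pw x - p x - u * b)\<bar>" using v(2) by (simp add: abs_mult)
    also have "A * (2 * pw x - p x - u * b) = k x - v (cell_of d m (\<lambda>j. \<xi> j x)) * b"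
      using v(2) by (simp add: k_def u_def algebra_simps)
    finally show ?thesis by (simp add: b_def)
  qed
  with net show ?thesis unfolding \<epsilon>_def n_def by (intro exI[of _ k]) simp
qed

subsection \<open>Hierarchical interpolation\<close>

lemma sum_PiE_Suc:
  fixes F :: "(nat \<Rightarrow> 'b) \<Rightarrow> real"
  shows "(\<Sum>f\<in>PiE {..<Suc d} (\<lambda>_. S). F f) = (\<Sum>y\<in>S. \<Sum>f\<in>PiE {..<d} (\<lambda>_. S). F (f(d := y)))"
proof -
  have "(\<Sum>f\<in>PiE {..<Suc d} (\<lambda>_. S). F f) = (\<Sum>p\<in>S \<times> PiE {..<d} (\<lambda>_. S). F ((snd p)(d := fst p)))"
    unfolding lessThan_Suc PiE_insert_eq
    by (subst sum.reindex[OF inj_combinator]) (auto simp: case_prod_beta)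
  then show ?thesis by (simp add: sum.cartesian_product case_prod_beta)
qed

section \<open>Tail sums over the levels\<close>

definition tail_sum :: "nat \<Rightarrow> nat \<Rightarrow> nat \<Rightarrow> real" where
  "tail_sum d n \<nu> = (\<Sum>m\<in>PiE {..<d} (\<lambda>_. {..<n}). if \<nu> \<le> (\<Sum>j<d. m j) then (1 / 4) ^ (\<Sum>j<d. m j) else 0)"

lemma tail_sum_0: "tail_sum 0 n \<nu> = (if \<nu> = 0 then 1 else 0)"
  by (simp add: tail_sum_def)

lemma tail_sum_Suc: "tail_sum (Suc d) n \<nu> = (\<Sum>k<n. (1 / 4) ^ k * tail_sum d n (\<nu> - k))"
proof -
  have "tail_sum (Suc d) n \<nu> = (\<Sum>k<n. \<Sum>m\<in>PiE {..<d} (\<lambda>_. {..<n}).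
     if \<nu> \<le> (\<Sum>j<d. m j) + k then (1 / 4) ^ ((\<Sum>j<d. m j) + k) else 0)"
    unfolding tail_sum_def sum_PiE_Suc by (intro sum.cong refl) simp
  also have "\<dots> = (\<Sum>k<n. (1 / 4) ^ k * tail_sum d n (\<nu> - k))"
    unfolding tail_sum_def sum_distrib_left by (intro sum.cong refl) (simp add: power_add le_diff_conv)
  finally show ?thesis .
qed

lemma geometric_sum_le:
  fixes r :: real assumes "0 \<le> r" "r < 1" shows "(\<Sum>k<n. r ^ k) \<le> 1 / (1 - r)"
proof -
  have "(\<Sum>k<n. r ^ k) = (1 - r ^ n) / (1 - r)" using assms by (subst sum_gp_strict) auto
  also have "\<dots> \<le> 1 / (1 - r)" using assms by (intro divide_right_mono) auto
  finally show ?thesis .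
qed

text \<open>Splitting \<open>1 / 4 = q * r\<close> lets each coordinate spend \<open>r ^ k\<close>
  on its own geometric series while \<open>q ^ \<nu>\<close> survives the induction. The free
  \<open>r\<close> will balance the cost \<open>1 / (1 - r)\<close> per dimension against the growth
  of \<open>q ^ \<nu>\<close>.\<close>

lemma tail_sum_bound:
  assumes "1 / 4 \<le> r" "r < 1" "q * r = 1 / 4"
  shows "tail_sum (Suc d) n \<nu> \<le> 4 / 3 * q ^ \<nu> * (1 / (1 - r)) ^ d"
proof -
  have r: "0 < r" using assms by simp
  have q_eq: "q = 1 / (4 * r)" using assms(3) r by (simp add: field_simps)
  have q: "0 < q" "q \<le> 1" "1 / 4 \<le> q" using assms r by (auto simp: q_eq field_simps)
  show ?thesis
  proof (induction d arbitrary: \<nu>)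
    case 0
    have "tail_sum (Suc 0) n \<nu> = (\<Sum>k<n. if \<nu> \<le> k then (1 / 4) ^ k else 0)"
      unfolding tail_sum_Suc tail_sum_0 by (intro sum.cong refl) auto
    also have "\<dots> \<le> (\<Sum>k<n. (1 / 4) ^ \<nu> * (if \<nu> \<le> k then (1 / 4) ^ (k - \<nu>) else 0))"
      by (intro sum_mono) (auto simp: power_add[symmetric])
    also have "\<dots> = (1 / 4) ^ \<nu> * (\<Sum>k\<in>{\<nu>..<n}. (1 / 4) ^ (k - \<nu>))"
      by (auto simp: sum_distrib_left[symmetric] intro!: sum.mono_neutral_cong_right)
    also have "(\<Sum>k\<in>{\<nu>..<n}. (1 / 4 :: real) ^ (k - \<nu>)) = (\<Sum>k<n - \<nu>. (1 / 4) ^ k)"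
      by (rule sum.reindex_bij_witness[of _ "\<lambda>k. k + \<nu>" "\<lambda>k. k - \<nu>"]) auto
    also have "(1 / 4) ^ \<nu> * (\<Sum>k<n - \<nu>. (1 / 4) ^ k) \<le> q ^ \<nu> * (1 / (1 - 1 / 4))"
      using q by (intro mult_mono power_mono geometric_sum_le) (auto intro: sum_nonneg)
    finally show ?case by simp
  next
    case (Suc d)
    let ?D = "(1 / (1 - r)) ^ d"
    have D: "0 \<le> ?D" using assms by simp
    have "tail_sum (Suc (Suc d)) n \<nu> \<le> (\<Sum>k<n. 4 / 3 * q ^ \<nu> * ?D * r ^ k)"
      unfolding tail_sum_Suc[of "Suc d"]
    proof (rule sum_mono)
      fix k
      have "(1 / 4) ^ k * q ^ (\<nu> - k) = r ^ k * (q ^ k * q ^ (\<nu> - k))"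
        by (simp add: assms(3)[symmetric] power_mult_distrib)
      \<comment> \<open>The subtraction truncates at 0: for \<open>k > \<nu>\<close> the exponent on
        the left exceeds \<open>\<nu>\<close>, which is harmless as
        \<open>q \<le> 1\<close>.\<close>
      also have "q ^ k * q ^ (\<nu> - k) \<le> q ^ \<nu>"
        unfolding power_add[symmetric] using q by (intro power_decreasing) auto
      finally have *: "(1 / 4) ^ k * q ^ (\<nu> - k) \<le> r ^ k * q ^ \<nu>" using r by simp
      have "(1 / 4) ^ k * tail_sum (Suc d) n (\<nu> - k) \<le> (1 / 4) ^ k * (4 / 3 * q ^ (\<nu> - k) * ?D)"
        by (intro mult_left_mono Suc.IH) auto
      also have "\<dots> = 4 / 3 * ?D * ((1 / 4) ^ k * q ^ (\<nu> - k))" by simp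
      also have "\<dots> \<le> 4 / 3 * ?D * (r ^ k * q ^ \<nu>)" using * D by (intro mult_left_mono) auto
      finally show "(1 / 4) ^ k * tail_sum (Suc d) n (\<nu> - k) \<le> 4 / 3 * q ^ \<nu> * ?D * r ^ k"
        by (simp add: mult_ac)
    qed
    also have "\<dots> = 4 / 3 * q ^ \<nu> * ?D * (\<Sum>k<n. r ^ k)" by (simp add: sum_distrib_left)
    also have "\<dots> \<le> 4 / 3 * q ^ \<nu> * ?D * (1 / (1 - r))"
      using D q r assms by (intro mult_left_mono geometric_sum_le) auto
    finally show ?case by (simp add: mult_ac)
  qed
qed

text \<open>Piecewise linear interpolation at the points \<open>k / 2\<^sup>n\<close> and its increments from one level to the next,
  written as weights on the points of the line.\<close>

definition node :: "nat \<Rightarrow> real \<Rightarrow> nat \<Rightarrow> real" where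
  "node n t e = (real (nat \<lfloor>2 ^ n * t\<rfloor>) + real e) / 2 ^ n"

definition interp :: "nat \<Rightarrow> real \<Rightarrow> real \<Rightarrow> real" where
  "interp n t s = (1 - frac (2 ^ n * t)) * of_bool (s = node n t 0) + frac (2 ^ n * t) * of_bool (s = node n t 1)"

text \<open>The stencil -1/2, 1, -1/2: midpoint value minus the mean of the end values, the
  hierarchical surplus.\<close>

definition diff_coeff :: "nat \<Rightarrow> real" where
  "diff_coeff \<sigma> = (if \<sigma> = 1 then 1 else - 1 / 2)"

definition diff_node :: "nat \<Rightarrow> nat \<Rightarrow> nat \<Rightarrow> real" where
  "diff_node m i \<sigma> = real (2 * i + \<sigma>) / 2 ^ (m + 1)"

definition incr :: "nat \<Rightarrow> real \<Rightarrow> real \<Rightarrow> real" where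
  "incr m t s = (\<Sum>\<sigma><3. diff_coeff \<sigma> * of_bool (s = diff_node m (nat \<lfloor>2 ^ m * t\<rfloor>) \<sigma>))"

text \<open>On a cell both interpolants agree at the ends and differ by the surplus at the midpoint,
  so their difference is the surplus times the tent. Stated for weights in \<open>s\<close>, the
  identity can be multiplied over the coordinates.\<close>

lemma interp_Suc:
  assumes "0 \<le> t"
  shows "interp (Suc n) t s = interp n t s + zigzag (2 ^ (n + 1) * t) * incr n t s"
proof -
  define y where "y = 2 ^ n * t"
  define i where "i = nat \<lfloor>y\<rfloor>"
  define f where "f = frac y"
  have y: "0 \<le> y" using assms by (simp add: y_def)
  have yi: "y = real i + f" using y by (simp add: i_def f_def frac_def)
  have f: "0 \<le> f" "f < 1" by (auto simp: f_def frac_lt_1)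
  define P where "P \<sigma> = (of_bool (s = diff_node n i \<sigma>) :: real)" for \<sigma>
  have eqs: "(real i + 0) / 2 ^ n = diff_node n i 0" "(real i + 1) / 2 ^ n = diff_node n i 2"
    by (auto simp: diff_node_def field_simps)
  have W: "interp n t s = (1 - f) * P 0 + f * P 2"
    using eqs by (simp add: interp_def node_def y_def[symmetric] i_def[symmetric] f_def[symmetric] P_def)
  have I: "incr n t s = - P 0 / 2 + P 1 - P 2 / 2"
    by (simp add: incr_def y_def[symmetric] i_def[symmetric] P_def diff_coeff_def numeral_3_eq_3 numeral_2_eq_2)
  have Z: "zigzag (2 ^ (n + 1) * t) = 1 - \<bar>2 * f - 1\<bar>"
    using zigzag_double[of y] by (simp add: y_def f_def mult.assoc)
  have y2: "2 ^ Suc n * t = 2 * y" by (simp add: y_def)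
  show ?thesis
  proof (cases "f < 1 / 2")
    case True
    have fl: "\<lfloor>2 * y\<rfloor> = int (2 * i)" using True f yi by (intro floor_unique) auto
    then have fr: "frac (2 * y) = 2 * f" by (simp add: frac_def yi)
    have "interp (Suc n) t s = (1 - 2 * f) * P 0 + 2 * f * P 1"
    proof -
      have "node (Suc n) t 0 = diff_node n i 0" "node (Suc n) t 1 = diff_node n i 1"
        unfolding node_def y2 fl diff_node_def nat_int by (simp_all add: field_simps)
      then show ?thesis unfolding interp_def y2 fr P_def by simp
    qed
    then show ?thesis unfolding W I Z using True by (simp add: algebra_simps)
  next
    case False
    have fl: "\<lfloor>2 * y\<rfloor> = int (2 * i + 1)" using False f yi by (intro floor_unique) auto
    then have fr: "frac (2 * y) = 2 * f - 1" by (simp add: frac_def yi)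
    have "interp (Suc n) t s = (1 - (2 * f - 1)) * P 1 + (2 * f - 1) * P 2"
    proof -
      have "node (Suc n) t 0 = diff_node n i 1" "node (Suc n) t 1 = diff_node n i 2"
        unfolding node_def y2 fl diff_node_def nat_int by (simp_all add: field_simps)
      then show ?thesis unfolding interp_def y2 fr P_def by simp
    qed
    then show ?thesis unfolding W I Z using False by (simp add: algebra_simps)
  qed
qed

text \<open>The index is shifted: 0 is interpolation from the end points, \<open>Suc m\<close> the
  increment on the cells of level \<open>m\<close>.\<close>

definition layer :: "real \<Rightarrow> nat \<Rightarrow> real \<Rightarrow> real" where
  "layer t \<kappa> s = (case \<kappa> of 0 \<Rightarrow> interp 0 t s | Suc m \<Rightarrow> zigzag (2 ^ (m + 1) * t) * incr m t s)"

lemma interp_eq_sum_layers: "0 \<le> t \<Longrightarrow> interp n t s = (\<Sum>\<kappa>\<le>n. layer t \<kappa> s)"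
  by (induction n) (auto simp: interp_Suc layer_def)

text \<open>The grid reaches up to 2 because at \<open>t = 1\<close> the formal right neighbour lies
  beyond 1, although it contributes nothing.\<close>

definition gridpts :: "nat \<Rightarrow> real set" where
  "gridpts n = (\<lambda>k. real k / 2 ^ n) ` {..2 * 2 ^ n}"

lemma finite_gridpts: "finite (gridpts n)"
  by (simp add: gridpts_def)

lemma gridpts_mono:
  assumes "m \<le> n" "k \<le> 2 * 2 ^ m" shows "real k / 2 ^ m \<in> gridpts n"
proof -
  have "(2 :: real) ^ n = 2 ^ m * 2 ^ (n - m)" "(2 :: nat) ^ n = 2 ^ m * 2 ^ (n - m)"
    using assms(1) by (simp_all add: power_add[symmetric])
  then show ?thesis using assms(2) unfolding gridpts_def
    by (intro image_eqI[of _ _ "k * 2 ^ (n - m)"]) auto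
qed

lemma nat_floor_le:
  assumes "0 \<le> t" "t \<le> 1" shows "nat \<lfloor>2 ^ m * t\<rfloor> \<le> 2 ^ m"
proof -
  have "2 ^ m * t \<le> 2 ^ m" using assms by (simp add: mult_left_le)
  then have "\<lfloor>2 ^ m * t\<rfloor> \<le> 2 ^ m" by (metis floor_mono floor_numeral_power)
  then show ?thesis by (simp add: nat_le_iff)
qed

lemma node_gridpts:
  assumes "0 \<le> t" "t \<le> 1" "e \<le> 1" shows "node n t e \<in> gridpts n"
proof -
  have "nat \<lfloor>2 ^ n * t\<rfloor> + e \<le> 2 * 2 ^ n" using nat_floor_le[OF assms(1,2), of n] assms(3) one_le_power[of "2::nat" n]
    by linarith
  from gridpts_mono[OF order_refl this] show ?thesis by (simp add: node_def)
qed

lemma diff_node_gridpts: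
  assumes "i \<le> 2 ^ m" "\<sigma> < 3" "m < n" shows "diff_node m i \<sigma> \<in> gridpts n"
  unfolding diff_node_def
proof (rule gridpts_mono)
  have "1 \<le> (2::nat) ^ m" by simp
  then show "2 * i + \<sigma> \<le> 2 * 2 ^ (m + 1)" using assms by (simp, linarith)
qed (use assms in auto)

definition hcoeff :: "nat \<Rightarrow> ((nat \<Rightarrow> real) \<Rightarrow> real) \<Rightarrow> (nat \<Rightarrow> nat) \<Rightarrow> (nat \<Rightarrow> nat) \<Rightarrow> real" where
  "hcoeff d g m i = (\<Sum>\<sigma>\<in>PiE {..<d} (\<lambda>_. {..<3}).
     (\<Prod>j<d. diff_coeff (\<sigma> j)) * g (\<lambda>j\<in>{..<d}. diff_node (m j) (i j) (\<sigma> j)))"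

lemma sum_PiE_delta:
  fixes d :: nat and q :: "nat \<Rightarrow> 'b" and g :: "(nat \<Rightarrow> 'b) \<Rightarrow> real"
  assumes "finite S" "q \<in> PiE {..<d} (\<lambda>_. S)"
  shows "(\<Sum>s\<in>PiE {..<d} (\<lambda>_. S). (\<Prod>j<d. of_bool (s j = q j)) * g s) = g q"
proof -
  have "(\<Prod>j<d. of_bool (s j = q j)) * g s = (if s = q then g q else 0)" if "s \<in> PiE {..<d} (\<lambda>_. S)" for s
  proof (cases "s = q")
    case False
    have "\<exists>j<d. s j \<noteq> q j"
    proof (rule ccontr)
      assume "\<not> ?thesis"
      then have "s = q" using that assms(2) by (intro PiE_ext[of s "{..<d}" "\<lambda>_. S" q]) auto
      then show False using False by simp
    qed
    then obtain j where "j < d" "s j \<noteq> q j" by blast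
    then have "(\<Prod>j<d. of_bool (s j = q j) :: real) = 0" by (intro prod_zero) auto
    then show ?thesis using False by simp
  qed simp
  then have "(\<Sum>s\<in>PiE {..<d} (\<lambda>_. S). (\<Prod>j<d. of_bool (s j = q j)) * g s) =
      (\<Sum>s\<in>PiE {..<d} (\<lambda>_. S). if s = q then g q else 0)" by (intro sum.cong) auto
  also have "\<dots> = g q" using assms by (subst sum.delta) (auto intro: finite_PiE)
  finally show ?thesis .
qed

text \<open>Expanding the product of three-term sums gives the tensor product of the stencils;
  summing over \<open>s\<close> then only evaluates \<open>g\<close> at the stencil points.\<close>

lemma sum_incr_eq_hcoeff:
  assumes "finite S" "\<And>j \<sigma>. j < d \<Longrightarrow> \<sigma> < 3 \<Longrightarrow> diff_node (m j) (cell_of d m x j) \<sigma> \<in> S"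
  shows "(\<Sum>s\<in>PiE {..<d} (\<lambda>_. S). (\<Prod>j<d. incr (m j) (x j) (s j)) * g s) = hcoeff d g m (cell_of d m x)"
proof -
  let ?c = "cell_of d m x"
  have "(\<Prod>j<d. incr (m j) (x j) (s j)) = (\<Sum>\<sigma>\<in>PiE {..<d} (\<lambda>_. {..<3}).
       (\<Prod>j<d. diff_coeff (\<sigma> j)) * (\<Prod>j<d. of_bool (s j = (\<lambda>j\<in>{..<d}. diff_node (m j) (?c j) (\<sigma> j)) j)))" for s
  proof -
    have "(\<Prod>j<d. incr (m j) (x j) (s j)) = (\<Prod>j<d. \<Sum>\<sigma><3. diff_coeff \<sigma> * of_bool (s j = diff_node (m j) (?c j) \<sigma>))"
      by (intro prod.cong) (auto simp: incr_def cell_of_def)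
    also have "\<dots> = (\<Sum>\<sigma>\<in>PiE {..<d} (\<lambda>_. {..<3}). \<Prod>j<d. diff_coeff (\<sigma> j) * of_bool (s j = diff_node (m j) (?c j) (\<sigma> j)))"
      by (rule prod_sum_PiE) auto
    also have "\<dots> = (\<Sum>\<sigma>\<in>PiE {..<d} (\<lambda>_. {..<3}).
       (\<Prod>j<d. diff_coeff (\<sigma> j)) * (\<Prod>j<d. of_bool (s j = (\<lambda>j\<in>{..<d}. diff_node (m j) (?c j) (\<sigma> j)) j)))"
      unfolding prod.distrib by (intro sum.cong refl arg_cong2[of _ _ _ _ "(*)"] prod.cong) auto
    finally show ?thesis .
  qed
  then have "(\<Sum>s\<in>PiE {..<d} (\<lambda>_. S). (\<Prod>j<d. incr (m j) (x j) (s j)) * g s) =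
    (\<Sum>s\<in>PiE {..<d} (\<lambda>_. S). \<Sum>\<sigma>\<in>PiE {..<d} (\<lambda>_. {..<3}). (\<Prod>j<d. diff_coeff (\<sigma> j)) *
       ((\<Prod>j<d. of_bool (s j = (\<lambda>j\<in>{..<d}. diff_node (m j) (?c j) (\<sigma> j)) j)) * g s))"
    by (simp only: sum_distrib_right mult.assoc)
  also have "\<dots> = (\<Sum>\<sigma>\<in>PiE {..<d} (\<lambda>_. {..<3}). (\<Prod>j<d. diff_coeff (\<sigma> j)) *
       (\<Sum>s\<in>PiE {..<d} (\<lambda>_. S). (\<Prod>j<d. of_bool (s j = (\<lambda>j\<in>{..<d}. diff_node (m j) (?c j) (\<sigma> j)) j)) * g s))"
    unfolding sum_distrib_left by (rule sum.swap)
  also have "\<dots> = hcoeff d g m ?c"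
    unfolding hcoeff_def
  proof (intro sum.cong refl arg_cong2[of _ _ _ _ "(*)"] sum_PiE_delta assms(1))
    fix \<sigma> :: "nat \<Rightarrow> nat" assume "\<sigma> \<in> PiE {..<d} (\<lambda>_. {..<3})"
    then show "(\<lambda>j\<in>{..<d}. diff_node (m j) (?c j) (\<sigma> j)) \<in> PiE {..<d} (\<lambda>_. S)"
      using assms(2) by (auto simp: PiE_iff)
  qed
  finally show ?thesis .
qed


lemma interp_nonneg: "0 \<le> interp n t s"
  using frac_lt_1[of "2 ^ n * t"] by (auto simp: interp_def)

lemma cell_position:
  assumes "0 \<le> t"
  shows "2 ^ n * t = real (nat \<lfloor>2 ^ n * t\<rfloor>) + frac (2 ^ n * t)"
proof -
  have "0 \<le> 2 ^ n * t" using assms by simp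
  then show ?thesis by (simp add: frac_def)
qed

lemma interp_support:
  assumes "0 \<le> t" "t \<le> 1" "interp n t s \<noteq> 0"
  shows "0 \<le> s" "s \<le> 1" "\<bar>s - t\<bar> \<le> 1 / 2 ^ n"
proof -
  define i where "i = nat \<lfloor>2 ^ n * t\<rfloor>"
  define f where "f = frac (2 ^ n * t)"
  have f: "0 \<le> f" "f < 1" by (auto simp: f_def frac_lt_1)
  have t: "t = (real i + f) / 2 ^ n" using cell_position[OF assms(1), of n] by (simp add: i_def f_def field_simps)
  have i: "i \<le> 2 ^ n" using nat_floor_le[OF assms(1,2)] by (simp add: i_def)
  from assms(3) consider "s = real i / 2 ^ n" | "s = (real i + 1) / 2 ^ n" "0 < f"
    using f by (fastforce simp: interp_def node_def i_def f_def)
  then have "0 \<le> s \<and> s \<le> 1 \<and> \<bar>s - t\<bar> \<le> 1 / 2 ^ n"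
  proof cases
    case 1
    then have "s - t = - (f / 2 ^ n)" by (simp add: t add_divide_distrib)
    then have "\<bar>s - t\<bar> \<le> 1 / 2 ^ n" using f by (simp add: divide_right_mono)
    moreover have "real i \<le> 2 ^ n" using of_nat_mono[OF i, where 'a = real] by simp
    ultimately show ?thesis using 1 by auto
  next
    case 2
    then have "s - t = (1 - f) / 2 ^ n" by (simp add: t diff_divide_distrib add_divide_distrib)
    then have "\<bar>s - t\<bar> \<le> 1 / 2 ^ n" using f by (simp add: divide_right_mono)
    have "real i + f \<le> 2 ^ n" using assms(2) by (simp add: t field_simps)
    then have "real i < 2 ^ n" using 2 by linarith
    then have "i + 1 \<le> 2 ^ n" using of_nat_less_iff[of i "2 ^ n", where 'a = real] by simp
    from of_nat_mono[OF this, where 'a = real] have "real i + 1 \<le> 2 ^ n" by simp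
    with \<open>\<bar>s - t\<bar> \<le> 1 / 2 ^ n\<close> show ?thesis using 2 by auto
  qed
  then show "0 \<le> s" "s \<le> 1" "\<bar>s - t\<bar> \<le> 1 / 2 ^ n" by auto
qed

lemma interp_0_support:
  assumes "0 \<le> t" "t \<le> 1" "interp 0 t s \<noteq> 0" shows "s = 0 \<or> s = 1"
proof (cases "t = 1")
  case True
  then show ?thesis using assms(3) by (auto simp: interp_def node_def split: if_splits)
next
  case False
  then have "\<lfloor>t\<rfloor> = 0" using assms by (intro floor_unique) auto
  then show ?thesis using assms(3) by (auto simp: interp_def node_def split: if_splits)
qed

lemma cell_lt:
  assumes "0 \<le> t" "t < 1" shows "nat \<lfloor>2 ^ m * t\<rfloor> < 2 ^ m"
proof -
  have "2 ^ m * t < 2 ^ m" using assms by simp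
  then have "\<lfloor>2 ^ m * t\<rfloor> < 2 ^ m" by (simp add: floor_less_iff)
  then show ?thesis by (simp add: nat_less_iff)
qed

lemma zigzag_of_power: "zigzag (2 ^ (m + 1)) = 0"
proof -
  have "frac ((2 :: real) ^ m) = 0" by simp
  then show ?thesis using zigzag_double[of "2 ^ m"] by (simp del: frac_eq_0_iff)
qed

text \<open>A node beyond 1 could arise only at \<open>t = 1\<close>, and there the factor
  \<open>frac\<close> or \<open>zigzag\<close> in front of it is 0.\<close>

lemma layer_support:
  assumes "0 \<le> t" "t \<le> 1" "layer t \<kappa> s \<noteq> 0" shows "0 \<le> s \<and> s \<le> 1"
proof (cases \<kappa>)
  case 0
  then show ?thesis using assms interp_support[of t 0 s] by (simp add: layer_def)
next
  case (Suc m)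
  have "t \<noteq> 1" using assms(3) zigzag_of_power[of m] by (auto simp: layer_def Suc)
  then have i: "nat \<lfloor>2 ^ m * t\<rfloor> < 2 ^ m" using assms by (intro cell_lt) auto
  have nz: "incr m t s \<noteq> 0" using assms(3) by (auto simp: layer_def Suc)
  have "\<exists>\<sigma><3. s = diff_node m (nat \<lfloor>2 ^ m * t\<rfloor>) \<sigma>"
  proof (rule ccontr)
    assume "\<not> ?thesis"
    then have "incr m t s = 0" unfolding incr_def by (intro sum.neutral) auto
    with nz show False by simp
  qed
  then obtain \<sigma> where "\<sigma> < 3" "s = diff_node m (nat \<lfloor>2 ^ m * t\<rfloor>) \<sigma>" by blast
  moreover have "2 * nat \<lfloor>2 ^ m * t\<rfloor> + \<sigma> \<le> 2 ^ (m + 1)"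
    using i \<open>\<sigma> < 3\<close> unfolding power_add power_one_right by linarith
  then have "real (2 * nat \<lfloor>2 ^ m * t\<rfloor> + \<sigma>) \<le> real (2 ^ (m + 1))" by (rule of_nat_mono)
  then have "real (2 * nat \<lfloor>2 ^ m * t\<rfloor> + \<sigma>) \<le> 2 ^ (m + 1)" by simp
  ultimately show ?thesis by (simp add: diff_node_def)
qed

lemma sum_interp:
  assumes "0 \<le> t" "t \<le> 1" shows "(\<Sum>s\<in>gridpts n. interp n t s) = 1"
proof -
  have "node n t 0 \<in> gridpts n" "node n t 1 \<in> gridpts n" using assms by (auto intro: node_gridpts)
  then show ?thesis unfolding interp_def sum.distrib sum_distrib_left[symmetric]
    using finite_gridpts[of n] by (simp add: of_bool_def)
qed

section \<open>Tensor interpolation on full and sparse grids\<close>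

definition levels :: "nat \<Rightarrow> nat \<Rightarrow> (nat \<Rightarrow> nat) set" where
  "levels d N = {m \<in> PiE {..<d} (\<lambda>_. {..N}). (\<Sum>j<d. m j) \<le> N}"

definition interp_tensor :: "nat \<Rightarrow> nat \<Rightarrow> ((nat \<Rightarrow> real) \<Rightarrow> real) \<Rightarrow> (nat \<Rightarrow> real) \<Rightarrow> real" where
  "interp_tensor d n g x = (\<Sum>s\<in>PiE {..<d} (\<lambda>_. gridpts n). (\<Prod>j<d. interp n (x j) (s j)) * g s)"

text \<open>Expand the product of the sums of layers. A term with layer 0 in some coordinate samples
  \<open>g\<close> only where that coordinate is 0 or 1, and there \<open>g\<close> vanishes; so
  only pure increments remain.\<close>

lemma interp_tensor_hierarchical:
  assumes "x \<in> cube d" "\<And>s. s \<in> cube d - open_cube d \<Longrightarrow> g s = 0"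
  shows "interp_tensor d n g x =
    (\<Sum>m\<in>PiE {..<d} (\<lambda>_. {..<n}). hcoeff d g m (cell_of d m x) * bump d m x)"
proof -
  let ?S = "PiE {..<d} (\<lambda>_. gridpts n)"
  have x: "0 \<le> x j" "x j \<le> 1" if "j < d" for j using assms(1) that by (auto simp: cube_def PiE_iff)
  have fin: "finite ?S" by (intro finite_PiE finite_gridpts) auto
  define T where "T \<kappa> = (\<Sum>s\<in>?S. (\<Prod>j<d. layer (x j) (\<kappa> j) (s j)) * g s)" for \<kappa>
  have "interp_tensor d n g x = (\<Sum>s\<in>?S. (\<Prod>j<d. \<Sum>\<kappa>\<le>n. layer (x j) \<kappa> (s j)) * g s)"
    unfolding interp_tensor_def
    by (intro sum.cong refl arg_cong2[of _ _ _ _ "(*)"] prod.cong interp_eq_sum_layers) (auto simp: x)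
  also have "\<dots> = (\<Sum>s\<in>?S. \<Sum>\<kappa>\<in>PiE {..<d} (\<lambda>_. {..n}). (\<Prod>j<d. layer (x j) (\<kappa> j) (s j)) * g s)"
    by (subst prod_sum_PiE) (auto simp: sum_distrib_right)
  also have "\<dots> = (\<Sum>\<kappa>\<in>PiE {..<d} (\<lambda>_. {..n}). T \<kappa>)" unfolding T_def by (rule sum.swap)
  also have "\<dots> = (\<Sum>\<kappa>\<in>{\<kappa> \<in> PiE {..<d} (\<lambda>_. {..n}). \<forall>j<d. 0 < \<kappa> j}. T \<kappa>)"
  proof (intro sum.mono_neutral_right ballI)
    fix \<kappa> assume "\<kappa> \<in> PiE {..<d} (\<lambda>_. {..n}) - {\<kappa> \<in> PiE {..<d} (\<lambda>_. {..n}). \<forall>j<d. 0 < \<kappa> j}"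
    then obtain j where j: "j < d" "\<kappa> j = 0" by auto
    show "T \<kappa> = 0" unfolding T_def
    proof (intro sum.neutral ballI)
      fix s assume s: "s \<in> ?S"
      show "(\<Prod>j<d. layer (x j) (\<kappa> j) (s j)) * g s = 0"
      proof (cases "\<forall>j<d. layer (x j) (\<kappa> j) (s j) \<noteq> 0")
        case True
        have "s \<in> cube d" unfolding cube_def
        proof (rule PiE_I)
          fix i assume "i \<in> {..<d}"
          then have i: "i < d" by simp
          with True have "layer (x i) (\<kappa> i) (s i) \<noteq> 0" by blast
          from layer_support[OF x[OF i] this] show "s i \<in> {0..1}" by simp
        next
          fix i assume "i \<notin> {..<d}"
          then show "s i = undefined" by (rule PiE_arb[OF s])
        qed
        moreover have "layer (x j) (\<kappa> j) (s j) \<noteq> 0" using True j(1) by blast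
        then have "interp 0 (x j) (s j) \<noteq> 0" by (simp add: layer_def j(2))
        then have "s j = 0 \<or> s j = 1" by (rule interp_0_support[OF x[OF j(1)]])
        then have "\<not> (0 < s j \<and> s j < 1)" by auto
        then have "s \<notin> open_cube d" using j(1) by (force simp: open_cube_def)
        ultimately show ?thesis using assms(2) by simp
      next
        case False
        then show ?thesis by auto
      qed
    qed
  qed (auto intro: finite_PiE)
  also have "\<dots> = (\<Sum>m\<in>PiE {..<d} (\<lambda>_. {..<n}). T (\<lambda>j\<in>{..<d}. Suc (m j)))"
    by (rule sum.reindex_bij_witness[of _ "\<lambda>m. \<lambda>j\<in>{..<d}. Suc (m j)" "\<lambda>\<kappa>. \<lambda>j\<in>{..<d}. \<kappa> j - 1"])
      (auto simp: PiE_iff extensional_def fun_eq_iff Suc_le_eq intro!: arg_cong[of _ _ T],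
        metis Suc_le_lessD Suc_pred lessThan_iff)
  also have "\<dots> = (\<Sum>m\<in>PiE {..<d} (\<lambda>_. {..<n}). hcoeff d g m (cell_of d m x) * bump d m x)"
  proof (intro sum.cong refl)
    fix m assume m: "m \<in> PiE {..<d} (\<lambda>_. {..<n})"
    have "T (\<lambda>j\<in>{..<d}. Suc (m j)) = (\<Sum>s\<in>?S. bump d m x * ((\<Prod>j<d. incr (m j) (x j) (s j)) * g s))"
      unfolding T_def bump_def by (intro sum.cong refl) (simp add: layer_def prod.distrib mult.assoc)
    also have "\<dots> = bump d m x * (\<Sum>s\<in>?S. (\<Prod>j<d. incr (m j) (x j) (s j)) * g s)"
      by (simp add: sum_distrib_left)
    also have "(\<Sum>s\<in>?S. (\<Prod>j<d. incr (m j) (x j) (s j)) * g s) = hcoeff d g m (cell_of d m x)"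
    proof (rule sum_incr_eq_hcoeff[OF finite_gridpts])
      fix j \<sigma> :: nat assume "j < d" "\<sigma> < 3"
      then show "diff_node (m j) (cell_of d m x j) \<sigma> \<in> gridpts n"
        using m nat_floor_le[OF x] by (intro diff_node_gridpts) (auto simp: cell_of_def PiE_iff)
    qed
    finally show "T (\<lambda>j\<in>{..<d}. Suc (m j)) = hcoeff d g m (cell_of d m x) * bump d m x"
      by (simp only: mult.commute)
  qed
  finally show ?thesis .
qed

text \<open>The weights are nonnegative, sum to 1 and sit within \<open>1 / 2 ^ n\<close> of
  \<open>x\<close> in each coordinate, so the interpolant is an average of nearby values.\<close>

lemma interp_tensor_error:
  assumes "x \<in> cube d" "\<And>s. s \<in> cube d \<Longrightarrow> (\<And>j. j < d \<Longrightarrow> \<bar>s j - x j\<bar> \<le> 1 / 2 ^ n) \<Longrightarrow> \<bar>g x - g s\<bar> \<le> e"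
  shows "\<bar>g x - interp_tensor d n g x\<bar> \<le> e"
proof -
  let ?S = "PiE {..<d} (\<lambda>_. gridpts n)"
  define w where "w s = (\<Prod>j<d. interp n (x j) (s j))" for s
  have x: "0 \<le> x j" "x j \<le> 1" if "j < d" for j using assms(1) that by (auto simp: cube_def PiE_iff)
  have "(\<Sum>s\<in>?S. w s) = (\<Prod>j<d. \<Sum>s\<in>gridpts n. interp n (x j) s)"
    unfolding w_def by (rule prod_sum_PiE[symmetric]) (auto simp: finite_gridpts)
  also have "\<dots> = 1" by (intro prod.neutral ballI sum_interp) (auto simp: x)
  finally have sum_w: "(\<Sum>s\<in>?S. w s) = 1" .
  have w0: "0 \<le> w s" for s unfolding w_def by (intro prod_nonneg interp_nonneg)
  have "g x - interp_tensor d n g x = (\<Sum>s\<in>?S. w s * (g x - g s))"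
    unfolding interp_tensor_def w_def[symmetric] right_diff_distrib sum_subtractf
    by (simp add: sum_distrib_right[symmetric] sum_w)
  also have "\<bar>\<dots>\<bar> \<le> (\<Sum>s\<in>?S. w s * e)"
  proof (rule order_trans[OF sum_abs sum_mono])
    fix s assume s: "s \<in> ?S"
    show "\<bar>w s * (g x - g s)\<bar> \<le> w s * e"
    proof (cases "w s = 0")
      case False
      then have nz: "interp n (x j) (s j) \<noteq> 0" if "j < d" for j using that by (auto simp: w_def)
      have "s \<in> cube d" unfolding cube_def
      proof (rule PiE_I)
        fix i assume "i \<in> {..<d}"
        then have i: "i < d" by simp
        show "s i \<in> {0..1}" using interp_support(1,2)[OF x[OF i] nz[OF i]] by simp
      next
        fix i assume "i \<notin> {..<d}"
        then show "s i = undefined" by (rule PiE_arb[OF s])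
      qed
      moreover have "\<bar>s j - x j\<bar> \<le> 1 / 2 ^ n" if j: "j < d" for j
        using interp_support(3)[OF x[OF j] nz[OF j]] .
      ultimately have "\<bar>g x - g s\<bar> \<le> e" by (rule assms(2))
      then show ?thesis using w0[of s] by (simp add: abs_mult mult_left_mono)
    qed simp
  qed
  also have "\<dots> = e" by (simp add: sum_distrib_right[symmetric] sum_w)
  finally show ?thesis .
qed

lemma bump_eq_0_of_not_cell:
  assumes "x \<in> cube d" "cell_of d m x \<notin> cells d m" shows "bump d m x = 0"
proof -
  obtain j where j: "j < d" "\<not> nat \<lfloor>2 ^ m j * x j\<rfloor> < 2 ^ m j"
    using assms(2) by (auto simp: cells_def cell_of_def PiE_iff)
  have "0 \<le> x j" "x j \<le> 1" using assms(1) j(1) by (auto simp: cube_def PiE_iff)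
  then have "x j = 1" using cell_lt[of "x j" "m j"] j(2) by (cases "x j < 1") auto
  then have "zigzag (2 ^ (m j + 1) * x j) = 0" using zigzag_of_power[of "m j"] by simp
  then show ?thesis unfolding bump_def using j(1) by (intro prod_zero) auto
qed

text \<open>The full interpolant of level \<open>n\<close> tends to \<open>g x\<close> by continuity
  alone, and its part outside \<open>levels d N\<close> is bounded by the tail uniformly in
  \<open>n\<close>. A rate of convergence of the full grid never enters.\<close>

lemma sparse_grid_error:
  assumes x: "x \<in> cube d" and zero: "\<And>s. s \<in> cube d - open_cube d \<Longrightarrow> g s = 0"
    and cont: "\<And>e. 0 < e \<Longrightarrow> \<exists>\<delta>>0. \<forall>s\<in>cube d. (\<forall>j<d. \<bar>s j - x j\<bar> < \<delta>) \<longrightarrow> \<bar>g x - g s\<bar> < e"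
    and coeff: "\<And>m i. i \<in> cells d m \<Longrightarrow> \<bar>hcoeff d g m i\<bar> \<le> c * (1 / 4) ^ (\<Sum>j<d. m j)"
    and c: "0 \<le> c" and B: "\<And>n. tail_sum d n (N + 1) \<le> B"
  shows "\<bar>g x - (\<Sum>m\<in>levels d N. hcoeff d g m (cell_of d m x) * bump d m x)\<bar> \<le> c * B"
proof (rule field_le_epsilon)
  fix e :: real assume "0 < e"
  from cont[OF this] obtain \<delta> where \<delta>: "0 < \<delta>"
    "\<And>s. s \<in> cube d \<Longrightarrow> (\<forall>j<d. \<bar>s j - x j\<bar> < \<delta>) \<Longrightarrow> \<bar>g x - g s\<bar> < e" by blast
  obtain n0 where n0: "(1 / 2) ^ n0 < \<delta>" using real_arch_pow_inv[OF \<delta>(1), of "1 / 2"] by auto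
  define n where "n = max n0 (N + 1)"
  have "(1 / 2) ^ n \<le> (1 / 2 :: real) ^ n0" by (intro power_decreasing) (auto simp: n_def)
  with n0 have n: "1 / 2 ^ n < \<delta>" by (simp add: power_one_over)
  let ?h = "\<lambda>m. hcoeff d g m (cell_of d m x) * bump d m x"
  let ?P = "PiE {..<d} (\<lambda>_. {..<n})"
  have "PiE {..<d} (\<lambda>_. {..N}) \<subseteq> ?P" by (intro PiE_mono) (auto simp: n_def)
  then have sub: "levels d N \<subseteq> ?P" by (auto simp: levels_def)
  have fin: "finite ?P" by (intro finite_PiE) auto
  have "\<bar>g x - interp_tensor d n g x\<bar> \<le> e"
  proof (rule interp_tensor_error[OF x])
    fix s assume "s \<in> cube d" "\<And>j. j < d \<Longrightarrow> \<bar>s j - x j\<bar> \<le> 1 / 2 ^ n"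
    then have "\<forall>j<d. \<bar>s j - x j\<bar> < \<delta>" using n by fastforce
    then show "\<bar>g x - g s\<bar> \<le> e" using \<delta>(2)[OF \<open>s \<in> cube d\<close>] by simp
  qed
  moreover have "interp_tensor d n g x = sum ?h ?P" by (rule interp_tensor_hierarchical[OF x zero])
  moreover have "sum ?h ?P = sum ?h (?P - levels d N) + sum ?h (levels d N)"
    by (rule sum.subset_diff[OF sub fin])
  moreover have "\<bar>sum ?h (?P - levels d N)\<bar> \<le> c * B"
  proof -
    have "\<bar>sum ?h (?P - levels d N)\<bar> \<le> (\<Sum>m\<in>?P - levels d N. c * (1 / 4) ^ (\<Sum>j<d. m j))"
    proof (rule order_trans[OF sum_abs sum_mono])
      fix m
      show "\<bar>?h m\<bar> \<le> c * (1 / 4) ^ (\<Sum>j<d. m j)"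
      proof (cases "cell_of d m x \<in> cells d m")
        case True
        have "\<bar>?h m\<bar> = \<bar>hcoeff d g m (cell_of d m x)\<bar> * bump d m x"
          using bump_bounds[of d m x] by (simp add: abs_mult)
        also have "\<dots> \<le> c * (1 / 4) ^ (\<Sum>j<d. m j) * 1"
          using bump_bounds[of d m x] coeff[OF True] c by (intro mult_mono) auto
        finally show ?thesis by simp
      next
        case False
        then show ?thesis using bump_eq_0_of_not_cell[OF x False] c by simp
      qed
    qed
    also have "\<dots> \<le> (\<Sum>m\<in>?P. c * (if N + 1 \<le> (\<Sum>j<d. m j) then (1 / 4) ^ (\<Sum>j<d. m j) else 0))"
    proof (rule order_trans[OF _ sum_mono2[OF fin, of "?P - levels d N"]])
      show "(\<Sum>m\<in>?P - levels d N. c * (1 / 4) ^ (\<Sum>j<d. m j)) \<le>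
         (\<Sum>m\<in>?P - levels d N. c * (if N + 1 \<le> (\<Sum>j<d. m j) then (1 / 4) ^ (\<Sum>j<d. m j) else 0))"
      proof (rule sum_mono)
        fix m assume m: "m \<in> ?P - levels d N"
        have "N < (\<Sum>j<d. m j)"
        proof (rule ccontr)
          assume le: "\<not> N < (\<Sum>j<d. m j)"
          have "m j \<le> N" if "j < d" for j
            using le member_le_sum[of j "{..<d}" m] that by simp
          then have "m \<in> levels d N" using m le by (auto simp: levels_def PiE_iff)
          then show False using m by simp
        qed
        then show "c * (1 / 4) ^ (\<Sum>j<d. m j) \<le> c * (if N + 1 \<le> (\<Sum>j<d. m j) then (1 / 4) ^ (\<Sum>j<d. m j) else 0)"
          by simp
      qed
    qed (use c in auto)
    also have "\<dots> = c * tail_sum d n (N + 1)" by (simp add: tail_sum_def sum_distrib_left)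
    also have "\<dots> \<le> c * B" using c B by (intro mult_left_mono) auto
    finally show ?thesis .
  qed
  ultimately show "\<bar>g x - sum ?h (levels d N)\<bar> \<le> c * B + e" by linarith
qed

subsection \<open>Mollified hat functions\<close>

primrec diffn :: "nat \<Rightarrow> (real \<Rightarrow> real) \<Rightarrow> bool" where
  "diffn 0 f \<longleftrightarrow> True"
| "diffn (Suc n) f \<longleftrightarrow> (\<exists>f'. (\<forall>x. (f has_real_derivative f' x) (at x)) \<and> diffn n f')"

definition smooth :: "(real \<Rightarrow> real) \<Rightarrow> bool" where "smooth f \<longleftrightarrow> (\<forall>n. diffn n f)"

lemma diffn_Suc_imp: "diffn (Suc n) f \<Longrightarrow> diffn n f"
  by (induction n arbitrary: f) auto

lemma diffn_const: "diffn n (\<lambda>x. c)"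
proof (induction n arbitrary: c)
  case (Suc n)
  then show ?case by (auto intro!: exI[of _ "\<lambda>x. 0"])
qed simp

lemma diffn_add: "diffn n f \<Longrightarrow> diffn n g \<Longrightarrow> diffn n (\<lambda>x. f x + g x)"
proof (induction n arbitrary: f g)
  case (Suc n)
  then obtain f' g' where "\<And>x. (f has_real_derivative f' x) (at x)" "diffn n f'"
    "\<And>x. (g has_real_derivative g' x) (at x)" "diffn n g'" by auto
  then show ?case using Suc.IH
    by (auto intro!: exI[of _ "\<lambda>x. f' x + g' x"] derivative_intros)
qed simp

lemma diffn_mult: "diffn n f \<Longrightarrow> diffn n g \<Longrightarrow> diffn n (\<lambda>x. f x * g x)"
proof (induction n arbitrary: f g)
  case (Suc n)
  obtain f' g' where *: "\<And>x. (f has_real_derivative f' x) (at x)" "diffn n f'"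
    "\<And>x. (g has_real_derivative g' x) (at x)" "diffn n g'" using Suc.prems by auto
  have "diffn n f" "diffn n g" using Suc.prems diffn_Suc_imp by blast+
  then have "diffn n (\<lambda>x. f' x * g x + f x * g' x)" using * Suc.IH by (intro diffn_add) auto
  moreover have "((\<lambda>x. f x * g x) has_real_derivative f' x * g x + f x * g' x) (at x)" for x
    using DERIV_mult[OF *(1)[of x] *(3)[of x]] by (simp add: mult.commute add.commute)
  ultimately show ?case unfolding diffn.simps by (intro exI[of _ "\<lambda>x. f' x * g x + f x * g' x"]) blast
qed simp

lemma diffn_affine: "diffn n f \<Longrightarrow> diffn n (\<lambda>x. f (a * x + b))"
proof (induction n arbitrary: f)
  case (Suc n)
  obtain f' where *: "\<And>x. (f has_real_derivative f' x) (at x)" "diffn n f'" using Suc.prems by auto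
  have "((\<lambda>x. f (a * x + b)) has_real_derivative f' (a * x + b) * a) (at x)" for x
    by (rule DERIV_chain'[of "\<lambda>x. a * x + b", OF _ *(1)]) (auto intro!: derivative_eq_intros)
  moreover have "diffn n (\<lambda>x. f' (a * x + b) * a)" using *(2) Suc.IH by (intro diffn_mult diffn_const) auto
  ultimately show ?case unfolding diffn.simps by (intro exI[of _ "\<lambda>x. f' (a * x + b) * a"]) blast
qed simp

lemma smooth_const: "smooth (\<lambda>x. c)" and smooth_add: "smooth f \<Longrightarrow> smooth g \<Longrightarrow> smooth (\<lambda>x. f x + g x)"
  and smooth_mult: "smooth f \<Longrightarrow> smooth g \<Longrightarrow> smooth (\<lambda>x. f x * g x)"
  and smooth_affine: "smooth f \<Longrightarrow> smooth (\<lambda>x. f (a * x + b))"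
  by (auto simp: smooth_def intro: diffn_const diffn_add diffn_mult diffn_affine)

lemma smooth_antiderivative:
  assumes "\<And>x. (F has_real_derivative f x) (at x)" "smooth f" shows "smooth F"
  unfolding smooth_def
proof
  fix n show "diffn n F" using assms by (cases n) (auto simp: smooth_def)
qed

lemma smooth_DERIV: assumes "smooth f" shows "(f has_real_derivative deriv f x) (at x)"
proof -
  have "diffn (Suc 0) f" using assms by (simp add: smooth_def del: diffn.simps)
  then obtain f' where "\<forall>x. (f has_real_derivative f' x) (at x)" by auto
  then show ?thesis by (metis DERIV_imp_deriv)
qed

lemma smooth_deriv: assumes "smooth f" shows "smooth (deriv f)"
  unfolding smooth_def
proof
  fix n
  have "diffn (Suc n) f" using assms by (simp add: smooth_def del: diffn.simps)
  then obtain f' where f': "\<forall>x. (f has_real_derivative f' x) (at x)" "diffn n f'" by auto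
  then have "deriv f = f'" by (auto simp: fun_eq_iff intro: DERIV_imp_deriv)
  with f' show "diffn n (deriv f)" by simp
qed

lemma smooth_isCont: "smooth f \<Longrightarrow> isCont f x"
  using smooth_DERIV DERIV_isCont by blast

lemma smooth_continuous: "smooth f \<Longrightarrow> continuous_on A f"
  using smooth_isCont continuous_at_imp_continuous_on by blast

section \<open>Flat functions and smooth ramps\<close>

definition flat :: "real poly \<Rightarrow> real \<Rightarrow> real" where
  "flat p x = (if 0 < x then poly p (1 / x) * exp (- (1 / x)) else 0)"

lemma tendsto_poly_exp: "((\<lambda>y. poly p y * exp (- y)) \<longlongrightarrow> (0 :: real)) at_top"
proof -
  have "((\<lambda>y. \<Sum>i\<le>degree p. coeff p i * (y ^ i / exp y)) \<longlongrightarrow> (\<Sum>i\<le>degree p. coeff p i * 0)) at_top"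
    by (intro tendsto_sum tendsto_mult tendsto_const tendsto_power_div_exp_0)
  then show ?thesis by (simp add: poly_altdef sum_distrib_right exp_minus divide_inverse mult.assoc)
qed

text \<open>Allowing every polynomial makes the family closed under differentiation: with
  \<open>y = 1 / x\<close>, the derivative of \<open>p(y) exp(-y)\<close> in \<open>x\<close> is
  \<open>y^2 (p - p')(y) exp(-y)\<close>. Smoothness is then a single induction.\<close>

lemma flat_DERIV: "(flat p has_real_derivative flat ([:0, 0, 1:] * (p - pderiv p)) x) (at x)"
proof -
  consider "x < 0" | "x = 0" | "0 < x" by linarith
  then show ?thesis
  proof cases
    case 1
    have "((\<lambda>_. 0) has_real_derivative 0) (at x)" by simp
    moreover have "eventually (\<lambda>y. y \<in> {..<0}) (nhds x)" using 1 by (intro eventually_nhds_in_open) auto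
    then have "eventually (\<lambda>y. flat p y = 0) (nhds x)" by eventually_elim (simp add: flat_def)
    ultimately have "(flat p has_real_derivative 0) (at x)"
      by (subst DERIV_cong_ev[OF refl _ refl]) auto
    then show ?thesis using 1 by (simp add: flat_def)
  next
    case 2
    have "((\<lambda>h. (flat p (0 + h) - flat p 0) / h) \<longlongrightarrow> 0) (at 0)"
    proof (rule filterlim_split_at)
      have "eventually (\<lambda>h. h \<in> {-1<..<0}) (at_left (0::real))" by (rule eventually_at_left_real) simp
      then have "eventually (\<lambda>h. 0 = (flat p (0 + h) - flat p 0) / h) (at_left 0)"
        by eventually_elim (simp add: flat_def)
      then show "((\<lambda>h. (flat p (0 + h) - flat p 0) / h) \<longlongrightarrow> 0) (at_left 0)"
        by (rule Lim_transform_eventually[OF tendsto_const])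
    next
      have "((\<lambda>h. poly ([:0, 1:] * p) (inverse h) * exp (- inverse h)) \<longlongrightarrow> 0) (at_right 0)"
        by (rule filterlim_compose[OF tendsto_poly_exp filterlim_inverse_at_top_right])
      moreover have "eventually (\<lambda>h. h \<in> {0<..<1}) (at_right (0::real))" by (rule eventually_at_right_real) simp
      then have "eventually (\<lambda>h. poly ([:0, 1:] * p) (inverse h) * exp (- inverse h) = (flat p (0 + h) - flat p 0) / h) (at_right 0)"
        by eventually_elim (simp add: flat_def field_simps)
      ultimately show "((\<lambda>h. (flat p (0 + h) - flat p 0) / h) \<longlongrightarrow> 0) (at_right 0)"
        by (rule Lim_transform_eventually)
    qed
    then have "(flat p has_real_derivative 0) (at 0)" unfolding DERIV_def .
    then show ?thesis using 2 by (simp add: flat_def)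
  next
    case 3
    have "((\<lambda>x. poly p (1 / x) * exp (- (1 / x))) has_real_derivative
       flat ([:0, 0, 1:] * (p - pderiv p)) x) (at x)"
      using 3 by (auto intro!: derivative_eq_intros simp: flat_def field_simps power2_eq_square)
    moreover have "eventually (\<lambda>y. y \<in> {0<..}) (nhds x)" using 3 by (intro eventually_nhds_in_open) auto
    then have "eventually (\<lambda>y. flat p y = poly p (1 / y) * exp (- (1 / y))) (nhds x)"
      by eventually_elim (simp add: flat_def)
    ultimately show ?thesis by (subst DERIV_cong_ev[OF refl _ refl]) auto
  qed
qed

lemma smooth_flat: "smooth (flat p)"
  unfolding smooth_def
proof
  fix n show "diffn n (flat p)"
  proof (induction n arbitrary: p)
    case (Suc n)
    then show ?case using flat_DERIV by auto
  qed simp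
qed

lemma antiderivative_exists:
  fixes f :: "real \<Rightarrow> real"
  assumes "\<And>x. isCont f x" shows "\<exists>F. F a = 0 \<and> (\<forall>x. (F has_real_derivative f x) (at x))"
proof -
  have "\<exists>F. \<forall>x :: real. -\<infinity> < ereal x \<longrightarrow> ereal x < \<infinity> \<longrightarrow> (F has_vector_derivative f x) (at x)"
    by (rule einterval_antiderivative) (use assms in auto)
  then obtain F where F: "\<And>x. (F has_real_derivative f x) (at x)"
    by (auto simp: has_real_derivative_iff_has_vector_derivative)
  have "((\<lambda>x. F x - F a) has_real_derivative f x) (at x)" for x
    using DERIV_diff[OF F[of x] DERIV_const[of "F a"]] by simp
  then show ?thesis by (intro exI[of _ "\<lambda>x. F x - F a"]) simp
qed

lemma zero_deriv_imp_eq: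
  fixes F :: "real \<Rightarrow> real"
  assumes "\<And>x. (F has_real_derivative f x) (at x)" "\<And>x. a \<le> x \<Longrightarrow> x \<le> b \<Longrightarrow> f x = 0" "a \<le> b"
  shows "F a = F b"
proof (cases "a = b")
  case False
  then have "a < b" using assms(3) by simp
  then obtain z where "a < z" "z < b" "F b - F a = (b - a) * f z" using MVT2[OF _ assms(1)] by blast
  then show ?thesis using assms(2)[of z] by simp
qed simp

text \<open>\<open>r\<close> is a mollified ReLU, \<open>S\<close> its derivative, a smooth step,
  and \<open>k\<close> a bump of mass 1. The offset \<open>\<kappa>\<close> past 1 may stay
  unspecified, since second differences remove it.\<close>

lemma smooth_ramp:
  "\<exists>(r :: real \<Rightarrow> real) S k \<kappa>. (\<forall>x. (r has_real_derivative S x) (at x)) \<and>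
    (\<forall>x. (S has_real_derivative k x) (at x)) \<and> smooth r \<and> smooth k \<and>
    (\<forall>x. 0 \<le> k x) \<and> (\<forall>x. x \<le> 0 \<or> 1 \<le> x \<longrightarrow> k x = 0) \<and>
    (\<forall>x. 0 \<le> S x \<and> S x \<le> 1) \<and> mono S \<and> (\<forall>x\<le>0. S x = 0) \<and> (\<forall>x\<ge>1. S x = 1) \<and>
    (\<forall>x\<le>0. r x = 0) \<and> (\<forall>x\<ge>1. r x = x - \<kappa>)"
proof -
  define k0 where "k0 x = flat 1 x * flat 1 (1 - x)" for x
  have "smooth (\<lambda>x. flat 1 ((- 1) * x + 1))" by (rule smooth_affine[OF smooth_flat])
  then have k0_smooth: "smooth k0" unfolding k0_def using smooth_mult[OF smooth_flat] by simp
  have k0: "0 \<le> k0 x" "x \<le> 0 \<or> 1 \<le> x \<Longrightarrow> k0 x = 0" "0 < x \<Longrightarrow> x < 1 \<Longrightarrow> 0 < k0 x" for x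
    by (auto simp: k0_def flat_def)
  obtain F where F: "F 0 = 0" "\<And>x. (F has_real_derivative k0 x) (at x)"
    using antiderivative_exists[of k0 0] smooth_isCont[OF k0_smooth] by blast
  have F_mono: "F x \<le> F y" if "x \<le> y" for x y
    using that F(2) k0(1) by (intro DERIV_nonneg_imp_nondecreasing[OF that]) blast
  have F0: "F x = 0" if "x \<le> 0" for x
    using zero_deriv_imp_eq[OF F(2), of x 0] k0(2) that F(1) by auto
  have F1: "F x = F 1" if "1 \<le> x" for x
    using zero_deriv_imp_eq[OF F(2), of 1 x] k0(2) that by auto
  have "0 < F 1"
  proof -
    obtain z where "0 < z" "z < 1" "F 1 - F 0 = (1 - 0) * k0 z" using MVT2[OF _ F(2), of 0 1] by auto
    then show ?thesis using k0(3)[of z] F(1) by simp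
  qed
  define c where "c = F 1"
  have c: "0 < c" using \<open>0 < F 1\<close> by (simp add: c_def)
  define S where "S x = F x / c" for x
  define k where "k x = k0 x / c" for x
  have S_D: "(S has_real_derivative k x) (at x)" for x
    unfolding S_def k_def using DERIV_cdivide[OF F(2)] .
  have k_smooth: "smooth k" unfolding k_def divide_inverse by (intro smooth_mult k0_smooth smooth_const)
  have S_smooth: "smooth S" by (rule smooth_antiderivative[OF S_D k_smooth])
  have S_mono: "S x \<le> S y" if "x \<le> y" for x y using F_mono[OF that] c by (simp add: S_def divide_right_mono)
  have S0: "S x = 0" if "x \<le> 0" for x using F0[OF that] by (simp add: S_def)
  have S1: "S x = 1" if "1 \<le> x" for x using F1[OF that] c by (simp add: S_def c_def)
  have S_b: "0 \<le> S x \<and> S x \<le> 1" for x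
    using S_mono[of 0 x] S_mono[of x 1] S0[of x] S0[of 0] S1[of x] S1[of 1] by (cases "x \<le> 0"; cases "1 \<le> x") auto
  obtain r where r: "r 0 = 0" "\<And>x. (r has_real_derivative S x) (at x)"
    using antiderivative_exists[of S 0] smooth_isCont[OF S_smooth] by blast
  have r_smooth: "smooth r" by (rule smooth_antiderivative[OF r(2) S_smooth])
  have r0: "r x = 0" if "x \<le> 0" for x using zero_deriv_imp_eq[OF r(2), of x 0] S0 that r(1) by auto
  have r1: "r x = x - (1 - r 1)" if "1 \<le> x" for x
  proof -
    have "((\<lambda>x. r x - x) has_real_derivative S x - 1) (at x)" for x
      by (intro DERIV_diff r(2) DERIV_ident)
    from zero_deriv_imp_eq[OF this, of 1 x] S1 that show ?thesis by simp
  qed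
  have kb: "0 \<le> k x" "x \<le> 0 \<or> 1 \<le> x \<Longrightarrow> k x = 0" for x using k0 c by (auto simp: k_def)
  have "mono S" using S_mono by (simp add: monoI)
  then show ?thesis
    by - (rule exI[of _ r], rule exI[of _ S], rule exI[of _ k], rule exI[of _ "1 - r 1"],
      use r(2) S_D r_smooth k_smooth kb S_b S0 S1 r0 r1 in blast)
qed

subsection \<open>Hierarchical coefficients and the weak derivative\<close>

lemma sum_lessThan_3: "(\<Sum>\<sigma><3. F \<sigma>) = F 0 + F 1 + (F (2::nat) :: real)"
  by (simp add: eval_nat_numeral)

text \<open>The stencil applied to three mollified ramps gives a smoothed multiple of a hat. Its
  second derivative is the same stencil applied to three probability densities near the nodes, so
  integrating a function against it approximates the surplus of that function.\<close>

lemma mollified_hat: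
  fixes h b \<epsilon> :: real
  assumes h: "0 < h" "0 \<le> b - h" "b + h \<le> 1" and \<epsilon>: "0 < \<epsilon>" "\<epsilon> < h / 4"
  shows "\<exists>\<eta> kk lo hi. smooth \<eta> \<and> 0 < lo \<and> lo \<le> hi \<and> hi < 1 \<and> hi - lo \<le> 2 * h \<and>
    (\<forall>x. x \<notin> {lo..hi} \<longrightarrow> \<eta> x = 0) \<and> (\<forall>x. \<bar>\<eta> x\<bar> \<le> h) \<and>
    (\<forall>x. deriv (deriv \<eta>) x = (\<Sum>\<sigma><3. diff_coeff \<sigma> * kk \<sigma> x)) \<and>
    (\<forall>\<sigma><3. \<forall>x. 0 \<le> kk \<sigma> x) \<and>
    (\<forall>\<sigma><3. \<forall>x. kk \<sigma> x \<noteq> 0 \<longrightarrow> 0 < x \<and> x < 1 \<and> \<bar>x - (b + (real \<sigma> - 1) * h)\<bar> \<le> 3 * \<epsilon>) \<and>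
    (\<forall>\<sigma><3. has_bochner_integral lborel (kk \<sigma>) 1)"
proof -
  from smooth_ramp obtain r S k \<kappa> where R: "\<forall>x. ((r :: real \<Rightarrow> real) has_real_derivative S x) (at x)"
    "\<forall>x. (S has_real_derivative k x) (at x)" "smooth r" "smooth k"
    "\<forall>x. 0 \<le> k x" "\<forall>x. x \<le> 0 \<or> 1 \<le> x \<longrightarrow> k x = 0"
    "\<forall>x. 0 \<le> S x \<and> S x \<le> 1" "mono S" "\<forall>x\<le>0. S x = 0" "\<forall>x\<ge>1. S x = 1"
    "\<forall>x\<le>0. r x = 0" "\<forall>x\<ge>1. r x = x - \<kappa>"
    by (elim exE conjE)
  note r = R(1)[rule_format] and S = R(2)[rule_format] and sm = R(3) and smk = R(4) and
    k0 = R(5)[rule_format] R(6)[rule_format] and Sb = R(7)[rule_format] and Sm = monoD[OF R(8)] and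
    S0 = R(9)[rule_format] and S1 = R(10)[rule_format] and r0 = R(11)[rule_format] and r1 = R(12)[rule_format]
  \<comment> \<open>The kinks are pulled inwards by \<open>2 * \<epsilon>\<close>, so that the
    support stays strictly inside the unit interval even when the cell touches 0 or 1.\<close>
  define pt where "pt \<sigma> = b + (real \<sigma> - 1) * (h - 2 * \<epsilon>)" for \<sigma> :: nat
  have pt: "pt 0 = b - h + 2 * \<epsilon>" "pt 1 = b" "pt (Suc 0) = b" "pt 2 = b + h - 2 * \<epsilon>" by (auto simp: pt_def)
  have arg_D: "((\<lambda>x. (x - p) / \<epsilon>) has_real_derivative 1 / \<epsilon>) (at x)" for p x
    using \<epsilon> by (auto intro!: derivative_eq_intros)
  have Sp_D: "((\<lambda>x. S ((x - p) / \<epsilon>)) has_real_derivative k ((x - p) / \<epsilon>) / \<epsilon>) (at x)" for p x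
    using DERIV_chain'[OF arg_D S] by simp
  have rp_D: "((\<lambda>x. \<epsilon> * r ((x - p) / \<epsilon>)) has_real_derivative S ((x - p) / \<epsilon>)) (at x)" for p x
    using DERIV_cmult[OF DERIV_chain'[OF arg_D r], of \<epsilon>] \<epsilon> by simp
  define \<eta> where "\<eta> x = (\<Sum>\<sigma><3. diff_coeff \<sigma> * (\<epsilon> * r ((x - pt \<sigma>) / \<epsilon>)))" for x
  define \<eta>1 where "\<eta>1 x = (\<Sum>\<sigma><3. diff_coeff \<sigma> * S ((x - pt \<sigma>) / \<epsilon>))" for x
  define kk where "kk \<sigma> x = k ((x - pt \<sigma>) / \<epsilon>) / \<epsilon>" for \<sigma> x
  define lo where "lo = pt 0"
  define hi where "hi = pt 2 + \<epsilon>"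
  have \<eta>_D: "(\<eta> has_real_derivative \<eta>1 x) (at x)" for x
    unfolding \<eta>_def \<eta>1_def by (intro DERIV_sum DERIV_cmult rp_D)
  have \<eta>1_D: "(\<eta>1 has_real_derivative (\<Sum>\<sigma><3. diff_coeff \<sigma> * kk \<sigma> x)) (at x)" for x
    unfolding \<eta>1_def kk_def by (intro DERIV_sum DERIV_cmult Sp_D)
  have "deriv \<eta> = \<eta>1" using \<eta>_D by (auto simp: fun_eq_iff intro: DERIV_imp_deriv)
  then have dd: "deriv (deriv \<eta>) x = (\<Sum>\<sigma><3. diff_coeff \<sigma> * kk \<sigma> x)" for x
    using DERIV_imp_deriv[OF \<eta>1_D] by simp
  have smp: "smooth (\<lambda>x. c * (\<epsilon> * r ((x - p) / \<epsilon>)))" for c p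
  proof -
    have "smooth (\<lambda>x. r ((1 / \<epsilon>) * x + (- p / \<epsilon>)))" by (rule smooth_affine[OF sm])
    then have "smooth (\<lambda>x. r ((x - p) / \<epsilon>))" by (simp add: diff_divide_distrib)
    then show ?thesis by (intro smooth_mult smooth_const)
  qed
  have \<eta>_smooth: "smooth \<eta>"
    unfolding \<eta>_def sum_lessThan_3 by (intro smooth_add smp)
  have lohi: "0 < lo" "lo \<le> hi" "hi < 1" "hi - lo \<le> 2 * h"
    using h \<epsilon> by (auto simp: lo_def hi_def pt)
  have \<eta>_left: "\<eta> x = 0" if "x \<le> lo" for x
  proof -
    have "(x - pt \<sigma>) / \<epsilon> \<le> 0" if "\<sigma> \<in> {0, 1, 2}" for \<sigma>
      using that \<open>x \<le> lo\<close> \<epsilon> h by (intro divide_nonpos_pos) (auto simp: lo_def pt)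
    then show ?thesis unfolding \<eta>_def sum_lessThan_3 by (simp add: r0)
  qed
  \<comment> \<open>Past the last kink all three ramps are affine with the same offset. The stencil
    kills affine functions because its nodes are equally spaced and its weights sum to 0.\<close>
  have \<eta>_right: "\<eta> x = 0" if "hi \<le> x" for x
  proof -
    have "1 \<le> (x - pt \<sigma>) / \<epsilon>" if "\<sigma> \<in> {0, 1, 2}" for \<sigma>
      using that \<open>hi \<le> x\<close> \<epsilon> h by (auto simp: hi_def pt le_divide_eq)
    note ge = this
    have "\<epsilon> * r ((x - pt \<sigma>) / \<epsilon>) = x - pt \<sigma> - \<epsilon> * \<kappa>" if "\<sigma> \<in> {0, 1, 2}" for \<sigma>
      unfolding r1[OF ge[OF that]] using \<epsilon> by (simp add: field_simps)
    note q = this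
    have "\<epsilon> * r ((x - pt 0) / \<epsilon>) = x - pt 0 - \<epsilon> * \<kappa>" "\<epsilon> * r ((x - pt 1) / \<epsilon>) = x - pt 1 - \<epsilon> * \<kappa>"
      "\<epsilon> * r ((x - pt 2) / \<epsilon>) = x - pt 2 - \<epsilon> * \<kappa>" by (rule q; simp)+
    then show ?thesis unfolding \<eta>_def sum_lessThan_3 by (simp only: diff_coeff_def pt) (simp add: field_simps)
  qed
  \<comment> \<open>\<open>S\<close> is monotone with values in \<open>[0,1]\<close>, so its second
    difference is at most 1/2; over a support of length at most \<open>2 * h\<close> this yields the
    bound \<open>h\<close> for \<open>\<eta>\<close>.\<close>
  have \<eta>1_bound: "\<bar>\<eta>1 x\<bar> \<le> 1 / 2" for x
  proof -
    have S_ord: "S ((x - pt 2) / \<epsilon>) \<le> S ((x - pt 1) / \<epsilon>)" "S ((x - pt 1) / \<epsilon>) \<le> S ((x - pt 0) / \<epsilon>)"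
      using \<epsilon> h by (auto intro!: Sm divide_right_mono simp: pt)
    have "\<eta>1 x = S ((x - pt 1) / \<epsilon>) - S ((x - pt 0) / \<epsilon>) / 2 - S ((x - pt 2) / \<epsilon>) / 2"
      unfolding \<eta>1_def sum_lessThan_3 by (simp add: diff_coeff_def)
    then show ?thesis
      using S_ord Sb[of "(x - pt 0) / \<epsilon>"] Sb[of "(x - pt 2) / \<epsilon>"] by linarith
  qed
  have \<eta>_bound: "\<bar>\<eta> x\<bar> \<le> h" for x
  proof (cases "lo \<le> x \<and> x \<le> hi")
    case True
    have "norm (\<eta> x - \<eta> lo) \<le> 1 / 2 * norm (x - lo)"
      by (rule field_differentiable_bound[of UNIV _ \<eta>1]) (use \<eta>_D \<eta>1_bound in auto)
    then show ?thesis using True lohi(4) \<eta>_left[of lo] by simp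
  next
    case False
    then show ?thesis using \<eta>_left[of x] \<eta>_right[of x] h by fastforce
  qed
  have kk_supp: "pt \<sigma> < x \<and> x < pt \<sigma> + \<epsilon>" if "kk \<sigma> x \<noteq> 0" for \<sigma> x
  proof -
    have "\<not> ((x - pt \<sigma>) / \<epsilon> \<le> 0 \<or> 1 \<le> (x - pt \<sigma>) / \<epsilon>)" using that k0(2) by (auto simp: kk_def)
    then show ?thesis using \<epsilon> by (auto simp: field_simps)
  qed
  have kk_near: "0 < x \<and> x < 1 \<and> \<bar>x - (b + (real \<sigma> - 1) * h)\<bar> \<le> 3 * \<epsilon>" if "\<sigma> < 3" "kk \<sigma> x \<noteq> 0" for \<sigma> x
  proof -
    have "\<sigma> = 0 \<or> \<sigma> = 1 \<or> \<sigma> = 2" using that(1) by auto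
    then show ?thesis using kk_supp[OF that(2)] h \<epsilon> by (elim disjE) (auto simp: pt abs_le_iff)
  qed
  have kk_int: "has_bochner_integral lborel (kk \<sigma>) 1" for \<sigma>
  proof -
    have "isCont (\<lambda>x. k ((x - pt \<sigma>) / \<epsilon>) / \<epsilon>) x" for x
      by (intro continuous_intros continuous_within_compose3[OF smooth_isCont[OF smk]]) (use \<epsilon> in auto)
    then have "has_bochner_integral lborel (\<lambda>x. k ((x - pt \<sigma>) / \<epsilon>) / \<epsilon> * indicator {pt \<sigma>..pt \<sigma> + \<epsilon>} x)
      (S ((pt \<sigma> + \<epsilon> - pt \<sigma>) / \<epsilon>) - S ((pt \<sigma> - pt \<sigma>) / \<epsilon>))"
      using \<epsilon> by (intro has_bochner_integral_FTC_Icc_real[where F = "\<lambda>x. S ((x - pt \<sigma>) / \<epsilon>)"] Sp_D) auto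
    also have "(\<lambda>x. k ((x - pt \<sigma>) / \<epsilon>) / \<epsilon> * indicator {pt \<sigma>..pt \<sigma> + \<epsilon>} x) = kk \<sigma>"
      using kk_supp[of \<sigma>] by (fastforce simp: fun_eq_iff kk_def indicator_def)
    finally show ?thesis using \<epsilon> by (simp add: S0 S1)
  qed
  have \<eta>_out: "\<eta> x = 0" if "x \<notin> {lo..hi}" for x
    using that \<eta>_left[of x] \<eta>_right[of x] by fastforce
  have kk_nonneg: "0 \<le> kk \<sigma> x" for \<sigma> x using k0(1) \<epsilon> by (simp add: kk_def)
  show ?thesis
    by (rule exI[of _ \<eta>], rule exI[of _ kk], rule exI[of _ lo], rule exI[of _ hi])
      (use \<eta>_smooth lohi \<eta>_out \<eta>_bound dd kk_nonneg kk_near kk_int in blast)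
qed

section \<open>Tensor products as test functions\<close>

definition tensor :: "nat \<Rightarrow> (nat \<Rightarrow> real \<Rightarrow> real) \<Rightarrow> (nat \<Rightarrow> real) \<Rightarrow> real" where
  "tensor d \<eta> x = (\<Prod>j<d. \<eta> j (x j))"

lemma tensor_upd:
  assumes "i < d"
  shows "tensor d \<eta> (x(i := t)) = (\<Prod>j\<in>{..<d} - {i}. \<eta> j (x j)) * \<eta> i t"
proof -
  have "tensor d \<eta> (x(i := t)) = \<eta> i t * (\<Prod>j\<in>{..<d} - {i}. \<eta> j ((x(i := t)) j))"
    unfolding tensor_def using assms by (subst prod.remove[of _ i]) auto
  also have "(\<Prod>j\<in>{..<d} - {i}. \<eta> j ((x(i := t)) j)) = (\<Prod>j\<in>{..<d} - {i}. \<eta> j (x j))"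
    by (intro prod.cong) auto
  finally show ?thesis by (simp only: mult.commute)
qed

lemma tensor_DERIV:
  assumes "i < d" "smooth (\<eta> i)"
  shows "((\<lambda>t. tensor d \<eta> (x(i := t))) has_real_derivative tensor d (\<eta>(i := deriv (\<eta> i))) (x(i := t))) (at t)"
proof -
  have "tensor d (\<eta>(i := deriv (\<eta> i))) (x(i := t)) = (\<Prod>j\<in>{..<d} - {i}. \<eta> j (x j)) * deriv (\<eta> i) t"
    unfolding tensor_upd[OF assms(1)] by (intro arg_cong2[of _ _ _ _ "(*)"] prod.cong) auto
  then show ?thesis
    unfolding tensor_upd[OF assms(1)] by (auto intro!: DERIV_cmult smooth_DERIV assms(2))
qed

lemma partial_deriv_tensor:
  assumes "i < d" "smooth (\<eta> i)"
  shows "partial_deriv i (tensor d \<eta>) = tensor d (\<eta>(i := deriv (\<eta> i)))"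
proof
  fix x
  show "partial_deriv i (tensor d \<eta>) x = tensor d (\<eta>(i := deriv (\<eta> i))) x"
    unfolding partial_deriv_def using DERIV_imp_deriv[OF tensor_DERIV[of i d \<eta> x "x i", OF assms]] by simp
qed

lemma continuous_on_tensor:
  assumes "\<And>j. j < d \<Longrightarrow> smooth (\<eta> j)" shows "continuous_on A (tensor d \<eta>)"
  unfolding tensor_def
proof (intro continuous_on_prod)
  fix j assume "j \<in> {..<d}"
  then have "continuous_on UNIV (\<eta> j)" using assms smooth_continuous by auto
  moreover have "continuous_on A (\<lambda>x :: nat \<Rightarrow> real. x j)"
    by (rule continuous_on_subset[OF continuous_on_product_coordinates]) simp
  ultimately show "continuous_on A (\<lambda>x. \<eta> j (x j))"
    by (rule continuous_on_compose2[of UNIV "\<eta> j" A "\<lambda>x. x j"]) simp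
qed

lemma C_times_tensor:
  assumes "\<And>j. j < d \<Longrightarrow> smooth (\<eta> j)" shows "C_times d m (tensor d \<eta>)"
  using assms
proof (induction m arbitrary: \<eta>)
  case 0
  then show ?case by (simp add: continuous_on_tensor)
next
  case (Suc m)
  have "C_times d m (partial_deriv i (tensor d \<eta>))" if "i < d" for i
    unfolding partial_deriv_tensor[of i d \<eta>, OF that Suc.prems[OF that]]
    by (rule Suc.IH) (use Suc.prems smooth_deriv that in auto)
  moreover have "(\<lambda>t. tensor d \<eta> (x(i := t))) differentiable at (x i)" if "i < d" for i x
    using tensor_DERIV[of i d \<eta> x, OF that Suc.prems[OF that]] by (auto simp: real_differentiable_def)
  ultimately show ?case using Suc.prems by (simp add: continuous_on_tensor)
qed

lemma classical_D_tensor: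
  assumes "\<And>j. j < d \<Longrightarrow> smooth (\<eta> j)"
  shows "classical_D d (\<lambda>_. 2) (tensor d \<eta>) = tensor d (\<lambda>j. deriv (deriv (\<eta> j)))"
proof -
  have "fold (\<lambda>i. partial_deriv i ^^ 2) [0..<n] (tensor d \<eta>) = tensor d (\<lambda>j. if j < n then deriv (deriv (\<eta> j)) else \<eta> j)"
    if "n \<le> d" for n
    using that
  proof (induction n)
    case 0
    then show ?case by simp
  next
    case (Suc n)
    let ?\<eta> = "\<lambda>j. if j < n then deriv (deriv (\<eta> j)) else \<eta> j"
    have n: "n < d" using Suc by simp
    have "(partial_deriv n ^^ 2) (tensor d ?\<eta>) = partial_deriv n (partial_deriv n (tensor d ?\<eta>))"
      by (simp add: numeral_2_eq_2)
    also have "partial_deriv n (tensor d ?\<eta>) = tensor d (?\<eta>(n := deriv (\<eta> n)))"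
      using partial_deriv_tensor[of n d ?\<eta>] n assms by simp
    also have "partial_deriv n \<dots> = tensor d (?\<eta>(n := deriv (deriv (\<eta> n))))"
      using partial_deriv_tensor[of n d "?\<eta>(n := deriv (\<eta> n))"] n assms smooth_deriv by simp
    also have "?\<eta>(n := deriv (deriv (\<eta> n))) = (\<lambda>j. if j < Suc n then deriv (deriv (\<eta> j)) else \<eta> j)"
      by (auto simp: fun_eq_iff less_Suc_eq)
    finally show ?case using Suc by simp
  qed
  from this[of d] have "classical_D d (\<lambda>_. 2) (tensor d \<eta>) = tensor d (\<lambda>j. if j < d then deriv (deriv (\<eta> j)) else \<eta> j)"
    by (simp add: classical_D_def)
  also have "\<dots> = tensor d (\<lambda>j. deriv (deriv (\<eta> j)))" by (simp add: tensor_def fun_eq_iff)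
  finally show ?thesis .
qed

text \<open>Points are functions on all of \<open>nat\<close>, so the box is a product over
  \<open>UNIV\<close> with one-point factors outside \<open>{..<d}\<close>, to which Tychonoff
  applies.\<close>

lemma compact_box: "compact (PiE {..<d} (\<lambda>j. {lo j..hi j :: real}))"
proof -
  have "PiE {..<d} (\<lambda>j. {lo j..hi j}) = PiE UNIV (\<lambda>j. if j < d then {lo j..hi j} else {undefined})"
    by (auto simp: PiE_iff extensional_def split: if_splits)
  moreover have "compactin (product_topology (\<lambda>i. euclidean) UNIV) (PiE UNIV (\<lambda>j. if j < d then {lo j..hi j} else {undefined}))"
    by (subst compactin_PiE) auto
  ultimately show ?thesis by (simp add: euclidean_product_topology)
qed

lemma test_function_tensor:
  assumes "\<And>j. j < d \<Longrightarrow> smooth (\<eta> j)" "\<And>j. j < d \<Longrightarrow> 0 < lo j \<and> hi j < 1"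
    "\<And>j x. j < d \<Longrightarrow> x \<notin> {lo j..hi j} \<Longrightarrow> \<eta> j x = 0"
  shows "test_function d (tensor d \<eta>)"
  unfolding test_function_def
proof (intro conjI allI exI[of _ "PiE {..<d} (\<lambda>j. {lo j..hi j})"] ballI)
  show "PiE {..<d} (\<lambda>j. {lo j..hi j}) \<subseteq> open_cube d"
    unfolding open_cube_def using assms(2) by (intro PiE_mono) fastforce
  fix x assume x: "x \<in> Rn d - PiE {..<d} (\<lambda>j. {lo j..hi j})"
  then obtain j where "j < d" "x j \<notin> {lo j..hi j}" by (auto simp: Rn_def PiE_iff)
  then show "tensor d \<eta> x = 0" unfolding tensor_def using assms(3) by (intro prod_zero) auto
qed (use assms in \<open>auto intro: C_times_tensor compact_box\<close>)

text \<open>All points of the cube agree outside \<open>{..<d}\<close>, so only finitely many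
  factors of a basic neighbourhood matter and they have a common radius.\<close>

lemma continuous_on_cube_delta:
  fixes g :: "(nat \<Rightarrow> real) \<Rightarrow> real"
  assumes "continuous_on (cube d) g" "p \<in> cube d" "0 < e"
  shows "\<exists>\<delta>>0. \<forall>x\<in>cube d. (\<forall>j<d. \<bar>x j - p j\<bar> < \<delta>) \<longrightarrow> \<bar>g p - g x\<bar> < e"
proof -
  have "open (ball (g p) e)" "g p \<in> ball (g p) e" using assms(3) by auto
  then obtain A where A: "open A" "p \<in> A" "\<And>x. x \<in> cube d \<Longrightarrow> x \<in> A \<Longrightarrow> g x \<in> ball (g p) e"
    using assms(1,2) unfolding continuous_on_topological by metis
  from A(1) have "openin (product_topology (\<lambda>i. euclidean) UNIV) A" by (simp add: open_fun_def)
  from product_topology_open_contains_basis[OF this A(2)] obtain X where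
    X: "p \<in> PiE UNIV X" "\<And>i. open (X i)" "PiE UNIV X \<subseteq> A" by auto
  have "\<forall>j. \<exists>r>0. ball (p j) r \<subseteq> X j"
  proof
    fix j
    have "p j \<in> X j" using X(1) by auto
    then show "\<exists>r>0. ball (p j) r \<subseteq> X j" using X(2)[of j] open_contains_ball by blast
  qed
  then obtain r where r: "\<And>j. 0 < r j" "\<And>j. ball (p j) (r j) \<subseteq> X j" by metis
  define \<delta> where "\<delta> = Min (insert 1 (r ` {..<d}))"
  have "0 < \<delta>" using r(1) by (auto simp: \<delta>_def)
  moreover have "\<bar>g p - g x\<bar> < e" if x: "x \<in> cube d" "\<forall>j<d. \<bar>x j - p j\<bar> < \<delta>" for x
  proof -
    have "x j \<in> X j" for j
    proof (cases "j < d")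
      case True
      then have "\<delta> \<le> r j" unfolding \<delta>_def by (intro Min_le) auto
      then have "x j \<in> ball (p j) (r j)" using x(2) True by (auto simp: dist_real_def abs_minus_commute)
      then show ?thesis using r(2)[of j] by blast
    next
      case False
      then have "x j = p j" using x(1) assms(2) by (auto simp: cube_def PiE_iff extensional_def)
      then show ?thesis using X(1) by auto
    qed
    then have "x \<in> A" using X(3) by auto
    then show ?thesis using A(3)[OF x(1)] by (simp add: dist_real_def)
  qed
  ultimately show ?thesis by blast
qed


section \<open>Lebesgue measure on the cube\<close>

lemma product_sigma_finite_lborel: "product_sigma_finite (\<lambda>_ :: nat. lborel :: real measure)"
  by (rule product_sigma_finite.intro) (rule sigma_finite_lborel)

abbreviation borel_Rn :: "nat \<Rightarrow> (nat \<Rightarrow> real) measure" where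
  "borel_Rn d \<equiv> Pi\<^sub>M {..<d} (\<lambda>_. lborel)"

lemma has_bochner_integral_tensor:
  assumes "\<And>j. j < d \<Longrightarrow> has_bochner_integral lborel (u j) (c j)"
  shows "has_bochner_integral (lebesgue_Rn d) (tensor d u) (\<Prod>j<d. c j)"
proof -
  interpret product_sigma_finite "\<lambda>_ :: nat. lborel :: real measure" by (rule product_sigma_finite_lborel)
  have u: "integrable lborel (u j)" "integral\<^sup>L lborel (u j) = c j" if "j < d" for j
    using assms[OF that] by (auto simp: has_bochner_integral_iff)
  have 1: "integrable (borel_Rn d) (tensor d u)" unfolding tensor_def
    by (rule product_integrable_prod) (use u in auto)
  have 2: "integral\<^sup>L (borel_Rn d) (tensor d u) = (\<Prod>j<d. c j)"
    unfolding tensor_def by (subst product_integral_prod) (use u in auto)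
  have 3: "tensor d u \<in> borel_measurable (borel_Rn d)" using 1 by (rule borel_measurable_integrable)
  show ?thesis using 1 2
    by (simp add: has_bochner_integral_iff lebesgue_Rn_def integrable_completion[OF 3] integral_completion[OF 3])
qed

lemma open_cube_subset_cube: "open_cube d \<subseteq> cube d"
  unfolding open_cube_def cube_def by (intro PiE_mono) auto

lemma sets_cube: "cube d \<in> sets (lebesgue_Rn d)" "open_cube d \<in> sets (lebesgue_Rn d)"
proof -
  have "cube d \<in> sets (borel_Rn d)" "open_cube d \<in> sets (borel_Rn d)"
    unfolding cube_def open_cube_def by (auto intro!: sets_PiM_I_finite)
  then show "cube d \<in> sets (lebesgue_Rn d)" "open_cube d \<in> sets (lebesgue_Rn d)"
    by (auto simp: lebesgue_Rn_def)
qed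

lemma space_lebesgue_Rn: "space (lebesgue_Rn d) = Rn d"
  by (simp add: lebesgue_Rn_def space_PiM Rn_def)

lemma AE_lebesgue_cube: "(AE x in lebesgue_cube d. P x) \<longleftrightarrow> (AE x in lebesgue_Rn d. x \<in> cube d \<longrightarrow> P x)"
  unfolding lebesgue_cube_def by (rule AE_restrict_space_iff) (simp add: sets_cube)

text \<open>If \<open>u\<close> is not integrable, its integral is 0 by convention and the bound
  still holds. For the product of weak derivative and test function it is then enough to check a
  bound almost everywhere.\<close>

lemma abs_integral_le:
  fixes u v :: "'a \<Rightarrow> real"
  assumes "has_bochner_integral M v c" "AE x in M. \<bar>u x\<bar> \<le> v x"
  shows "\<bar>integral\<^sup>L M u\<bar> \<le> c"
proof -
  have v: "integrable M v" "integral\<^sup>L M v = c" using assms(1) by (auto simp: has_bochner_integral_iff)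
  have "0 \<le> integral\<^sup>L M v"
    by (rule integral_nonneg_AE) (use assms(2) in eventually_elim, linarith)
  then show ?thesis
  proof (cases "integrable M u")
    case True
    have "\<bar>integral\<^sup>L M u\<bar> \<le> integral\<^sup>L M (\<lambda>x. \<bar>u x\<bar>)" by (rule integral_abs_bound)
    also have "\<dots> \<le> integral\<^sup>L M v" using True v assms(2) by (intro integral_mono_AE) auto
    finally show ?thesis using v by simp
  qed (use v in \<open>simp add: not_integrable_integral_eq\<close>)
qed

lemma esssup_bound:
  assumes "esssup M (\<lambda>x. ennreal \<bar>u x\<bar>) \<le> ennreal c" "0 \<le> c" shows "AE x in M. \<bar>u x\<bar> \<le> c"
  using esssup_AE[of "\<lambda>x. ennreal \<bar>u x\<bar>" M]
proof eventually_elim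
  case (elim x)
  then have "ennreal \<bar>u x\<bar> \<le> ennreal c" using assms(1) by (rule order_trans)
  then show ?case using assms(2) by simp
qed

lemma L_infty_bounded:
  assumes "f \<in> L_infty M" obtains c where "0 \<le> c" "AE x in M. \<bar>f x\<bar> \<le> c"
proof -
  have "esssup M (\<lambda>x. ennreal \<bar>f x\<bar>) < \<infinity>" using assms by (simp add: L_infty_def Lp_norm_def)
  then obtain c where "0 \<le> c" "esssup M (\<lambda>x. ennreal \<bar>f x\<bar>) = ennreal c"
    by (cases "esssup M (\<lambda>x. ennreal \<bar>f x\<bar>)") auto
  then show ?thesis using esssup_bound[of M f c] that by simp
qed

text \<open>One test function, two estimates: the side of the identity with \<open>f\<close> tends
  to the surplus of \<open>g\<close> as the mollification shrinks, and the side with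
  \<open>w\<close> is at most the volume of the cell times the height of the test function.\<close>

lemma hcoeff_bound:
  assumes f: "f \<in> borel_measurable (lebesgue_cube d)" "AE x in lebesgue_cube d. \<bar>f x\<bar> \<le> c"
    and g: "continuous_on (cube d) g" "AE x in lebesgue_cube d. f x = g x"
    and w: "is_weak_deriv d (\<lambda>_. 2) f w" "AE x in lebesgue_cube d. \<bar>w x\<bar> \<le> 1"
    and i: "i \<in> cells d m"
  shows "\<bar>hcoeff d g m i\<bar> \<le> (1 / 2) ^ d * (1 / 4) ^ (\<Sum>j<d. m j)"
proof -
  let ?M = "lebesgue_Rn d" and ?P = "PiE {..<d} (\<lambda>_. {..<3 :: nat})"
  define h where "h j = 1 / (2 :: real) ^ (m j + 1)" for j
  define b where "b j = real (2 * i j + 1) / 2 ^ (m j + 1)" for j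
  have h0: "0 < h j" for j by (simp add: h_def)
  have node_eq: "b j + (real \<sigma> - 1) * h j = diff_node (m j) (i j) \<sigma>" for j \<sigma>
    by (simp add: b_def h_def diff_node_def field_simps)
  have bh: "0 \<le> b j - h j" "b j + h j \<le> 1" if j: "j < d" for j
  proof -
    show "0 \<le> b j - h j" by (simp add: b_def h_def diff_divide_distrib[symmetric])
    have "i j + 1 \<le> 2 ^ m j" using i j by (auto simp: cells_def PiE_iff Suc_le_eq)
    from of_nat_mono[OF this, where 'a = real] have "real (i j) + 1 \<le> 2 ^ m j" by simp
    then show "b j + h j \<le> 1" by (simp add: b_def h_def add_divide_distrib[symmetric])
  qed
  define pt where "pt \<sigma> = (\<lambda>j\<in>{..<d}. diff_node (m j) (i j) (\<sigma> j))" for \<sigma>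
  define C where "C \<sigma> = (\<Prod>j<d. diff_coeff (\<sigma> j))" for \<sigma>
  have finP: "finite ?P" by (intro finite_PiE) auto
  have pt: "pt \<sigma> \<in> cube d" if "\<sigma> \<in> ?P" for \<sigma>
  proof -
    have "diff_node (m j) (i j) (\<sigma> j) \<in> {0..1}" if "j < d" for j
    proof -
      have "\<sigma> j = 0 \<or> \<sigma> j = 1 \<or> \<sigma> j = 2" using \<open>\<sigma> \<in> ?P\<close> that by (force simp: PiE_iff)
      then show ?thesis using bh[OF that] h0[of j] unfolding node_eq[symmetric] by (elim disjE) auto
    qed
    then show ?thesis by (auto simp: pt_def cube_def)
  qed
  have AEf: "AE x in ?M. x \<in> cube d \<longrightarrow> \<bar>f x\<bar> \<le> c" and AEg: "AE x in ?M. x \<in> cube d \<longrightarrow> f x = g x"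
    and AEw: "AE x in ?M. x \<in> cube d \<longrightarrow> \<bar>w x\<bar> \<le> 1"
    using f(2) g(2) w(2) by (simp_all add: AE_lebesgue_cube)
  have f_meas: "(\<lambda>x. indicator (open_cube d) x * f x) \<in> borel_measurable ?M"
  proof -
    have "(\<lambda>x. f x * indicator (cube d) x) \<in> borel_measurable ?M"
      using f(1) borel_measurable_restrict_space_iff[of "cube d" ?M f] sets_cube
      by (simp add: lebesgue_cube_def mult.commute)
    then have "(\<lambda>x. indicator (open_cube d) x * (f x * indicator (cube d) x)) \<in> borel_measurable ?M"
      by (rule borel_measurable_times[OF borel_measurable_indicator[OF sets_cube(2)]])
    also have "(\<lambda>x. indicator (open_cube d) x * (f x * indicator (cube d) x)) = (\<lambda>x. indicator (open_cube d) x * f x)"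
      using open_cube_subset_cube by (auto simp: fun_eq_iff indicator_def)
    finally show ?thesis .
  qed
  \<comment> \<open>\<open>h j\<close> is half the side of the cell, so height \<open>h j\<close>
    times support length \<open>2 * h j\<close> is \<open>1 / 2 * (1 / 4) ^ m j\<close>. These
    halves are the source of the decisive factor \<open>(1 / 2) ^ d\<close>.\<close>
  have hprod: "(\<Prod>j<d. h j * (2 * h j)) = (1 / 2) ^ d * (1 / 4) ^ (\<Sum>j<d. m j)"
  proof -
    have "h j * (2 * h j) = 1 / 2 * (1 / 4) ^ m j" for j
    proof -
      have "(4 :: real) ^ m j = 2 ^ m j * 2 ^ m j" by (simp add: power_mult_distrib[symmetric])
      then show ?thesis by (simp add: h_def power_one_over)
    qed
    then have "(\<Prod>j<d. h j * (2 * h j)) = (\<Prod>j<d. 1 / 2 * (1 / 4) ^ m j)" by (simp only:)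
    then show ?thesis unfolding prod.distrib power_sum by simp
  qed
  have key: "\<bar>\<Sum>\<sigma>\<in>?P. C \<sigma> * g (pt \<sigma>)\<bar> \<le> (1 / 2) ^ d * (1 / 4) ^ (\<Sum>j<d. m j) + e * (\<Sum>\<sigma>\<in>?P. \<bar>C \<sigma>\<bar>)"
    if e: "0 < e" for e
  proof -
    have "\<forall>\<sigma>\<in>?P. \<exists>\<delta>>0. \<forall>x\<in>cube d. (\<forall>j<d. \<bar>x j - pt \<sigma> j\<bar> < \<delta>) \<longrightarrow> \<bar>g (pt \<sigma>) - g x\<bar> < e"
      using continuous_on_cube_delta[OF g(1) pt e] by blast
    then obtain \<delta> where \<delta>: "\<And>\<sigma>. \<sigma> \<in> ?P \<Longrightarrow> 0 < \<delta> \<sigma>"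
      "\<And>\<sigma> x. \<sigma> \<in> ?P \<Longrightarrow> x \<in> cube d \<Longrightarrow> (\<forall>j<d. \<bar>x j - pt \<sigma> j\<bar> < \<delta> \<sigma>) \<Longrightarrow> \<bar>g (pt \<sigma>) - g x\<bar> < e"
      by metis
    define D where "D = insert 1 (\<delta> ` ?P \<union> h ` {..<d})"
    have finD: "finite D" "D \<noteq> {}" using finP by (auto simp: D_def)
    have D0: "0 < Min D" using finD \<delta>(1) h0 by (auto simp: D_def)
    \<comment> \<open>Any divisor above 4 serves: both
      \<open>3 * \<epsilon> < \<delta> \<sigma>\<close> and \<open>\<epsilon> < h j / 4\<close> must
      hold.\<close>
    define \<epsilon> where "\<epsilon> = Min D / 5"
    have \<epsilon>: "0 < \<epsilon>" "\<And>\<sigma>. \<sigma> \<in> ?P \<Longrightarrow> 3 * \<epsilon> < \<delta> \<sigma>" "\<And>j. j < d \<Longrightarrow> \<epsilon> < h j / 4"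
    proof -
      show "0 < \<epsilon>" using D0 by (simp add: \<epsilon>_def)
      show "3 * \<epsilon> < \<delta> \<sigma>" if "\<sigma> \<in> ?P" for \<sigma>
      proof -
        have "Min D \<le> \<delta> \<sigma>" by (rule Min_le) (use finD that in \<open>auto simp: D_def\<close>)
        then show ?thesis using D0 by (simp add: \<epsilon>_def)
      qed
      show "\<epsilon> < h j / 4" if "j < d" for j
      proof -
        have "Min D \<le> h j" by (rule Min_le) (use finD that in \<open>auto simp: D_def\<close>)
        then show ?thesis using D0 by (simp add: \<epsilon>_def)
      qed
    qed
    have "\<forall>j. \<exists>p. j < d \<longrightarrow> (case p of (\<eta>, kk, lo, hi) \<Rightarrow> smooth \<eta> \<and> 0 < lo \<and> lo \<le> hi \<and> hi < 1 \<and> hi - lo \<le> 2 * h j \<and>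
      (\<forall>x. x \<notin> {lo..hi} \<longrightarrow> \<eta> x = 0) \<and> (\<forall>x. \<bar>\<eta> x\<bar> \<le> h j) \<and>
      (\<forall>x. deriv (deriv \<eta>) x = (\<Sum>\<sigma><3. diff_coeff \<sigma> * kk \<sigma> x)) \<and>
      (\<forall>\<sigma><3. \<forall>x. 0 \<le> kk \<sigma> x) \<and>
      (\<forall>\<sigma><3. \<forall>x. kk \<sigma> x \<noteq> 0 \<longrightarrow> 0 < x \<and> x < 1 \<and> \<bar>x - (b j + (real \<sigma> - 1) * h j)\<bar> \<le> 3 * \<epsilon>) \<and>
      (\<forall>\<sigma><3. has_bochner_integral lborel (kk \<sigma>) 1))"
      unfolding split_paired_Ex prod.case using mollified_hat[OF h0 bh \<epsilon>(1,3)] by blast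
    from choice[OF this] obtain p where p: "\<And>j. j < d \<Longrightarrow> (case p j of (\<eta>, kk, lo, hi) \<Rightarrow> smooth \<eta> \<and> 0 < lo \<and> lo \<le> hi \<and> hi < 1 \<and> hi - lo \<le> 2 * h j \<and>
      (\<forall>x. x \<notin> {lo..hi} \<longrightarrow> \<eta> x = 0) \<and> (\<forall>x. \<bar>\<eta> x\<bar> \<le> h j) \<and>
      (\<forall>x. deriv (deriv \<eta>) x = (\<Sum>\<sigma><3. diff_coeff \<sigma> * kk \<sigma> x)) \<and>
      (\<forall>\<sigma><3. \<forall>x. 0 \<le> kk \<sigma> x) \<and>
      (\<forall>\<sigma><3. \<forall>x. kk \<sigma> x \<noteq> 0 \<longrightarrow> 0 < x \<and> x < 1 \<and> \<bar>x - (b j + (real \<sigma> - 1) * h j)\<bar> \<le> 3 * \<epsilon>) \<and>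
      (\<forall>\<sigma><3. has_bochner_integral lborel (kk \<sigma>) 1))" by blast
    define \<eta> kk lo hi where "\<eta> j = fst (p j)" and "kk j = fst (snd (p j))" and "lo j = fst (snd (snd (p j)))"
      and "hi j = snd (snd (snd (p j)))" for j
    note defs = \<eta>_def kk_def lo_def hi_def
    note p' = p[unfolded case_prod_beta, folded defs]
    have sm: "smooth (\<eta> j)" and lohi: "0 < lo j" "lo j \<le> hi j" "hi j < 1" "hi j - lo j \<le> 2 * h j"
      and out: "\<And>x. x \<notin> {lo j..hi j} \<Longrightarrow> \<eta> j x = 0" and bd: "\<And>x. \<bar>\<eta> j x\<bar> \<le> h j"
      and dd: "\<And>x. deriv (deriv (\<eta> j)) x = (\<Sum>\<sigma><3. diff_coeff \<sigma> * kk j \<sigma> x)"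
      and k0: "\<And>\<sigma> x. \<sigma> < 3 \<Longrightarrow> 0 \<le> kk j \<sigma> x"
      and ks: "\<And>\<sigma> x. \<sigma> < 3 \<Longrightarrow> kk j \<sigma> x \<noteq> 0 \<Longrightarrow> 0 < x \<and> x < 1 \<and> \<bar>x - diff_node (m j) (i j) \<sigma>\<bar> \<le> 3 * \<epsilon>"
      and ki: "\<And>\<sigma>. \<sigma> < 3 \<Longrightarrow> has_bochner_integral lborel (kk j \<sigma>) 1" if "j < d" for j
      using p'[OF that] unfolding node_eq by blast+
    define \<phi> where "\<phi> = tensor d \<eta>"
    \<comment> \<open>\<open>K \<sigma>\<close> is a probability density concentrated near the grid
      point \<open>pt \<sigma>\<close>.\<close>
    define K where "K \<sigma> = tensor d (\<lambda>j. kk j (\<sigma> j))" for \<sigma>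
    have "test_function d \<phi>" unfolding \<phi>_def
      by (rule test_function_tensor[of d \<eta> lo hi]) (use sm lohi out in auto)
    with w(1) have "(LINT x:open_cube d|?M. f x * classical_D d (\<lambda>_. 2) \<phi> x) =
        (-1) ^ (\<Sum>i<d. 2) * (LINT x:open_cube d|?M. w x * \<phi> x)"
      unfolding is_weak_deriv_def by blast
    moreover have "(-1 :: real) ^ (\<Sum>i<d. 2) = 1" by (simp add: power_mult[symmetric] mult.commute[of d])
    moreover have "classical_D d (\<lambda>_. 2) \<phi> x = (\<Sum>\<sigma>\<in>?P. C \<sigma> * K \<sigma> x)" for x
    proof -
      have "classical_D d (\<lambda>_. 2) \<phi> x = (\<Prod>j<d. \<Sum>\<sigma><3. diff_coeff \<sigma> * kk j \<sigma> (x j))"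
        unfolding \<phi>_def by (subst classical_D_tensor) (use sm dd in \<open>auto simp: tensor_def\<close>)
      also have "\<dots> = (\<Sum>\<sigma>\<in>?P. \<Prod>j<d. diff_coeff (\<sigma> j) * kk j (\<sigma> j) (x j))" by (rule prod_sum_PiE) auto
      finally show ?thesis by (simp add: prod.distrib C_def K_def tensor_def)
    qed
    ultimately have weak: "(LINT x|?M. indicator (open_cube d) x * f x * (\<Sum>\<sigma>\<in>?P. C \<sigma> * K \<sigma> x)) =
        (LINT x|?M. indicator (open_cube d) x * (w x * \<phi> x))"
      by (simp add: set_lebesgue_integral_def mult.assoc)
    have K: "has_bochner_integral ?M (K \<sigma>) 1" if "\<sigma> \<in> ?P" for \<sigma>
      using has_bochner_integral_tensor[of d "\<lambda>j. kk j (\<sigma> j)" "\<lambda>_. 1"] ki that by (auto simp: K_def PiE_iff)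
    have K0: "0 \<le> K \<sigma> x" if "\<sigma> \<in> ?P" for \<sigma> x
      unfolding K_def tensor_def using that k0 by (intro prod_nonneg) (auto simp: PiE_iff)
    have Ks: "x \<in> open_cube d \<and> \<bar>g (pt \<sigma>) - g x\<bar> < e" if \<sigma>: "\<sigma> \<in> ?P" and x: "x \<in> Rn d" "K \<sigma> x \<noteq> 0" for \<sigma> x
    proof -
      have nz: "kk j (\<sigma> j) (x j) \<noteq> 0" if "j < d" for j using x(2) that by (auto simp: K_def tensor_def)
      have s: "0 < x j \<and> x j < 1 \<and> \<bar>x j - diff_node (m j) (i j) (\<sigma> j)\<bar> \<le> 3 * \<epsilon>" if "j < d" for j
        using ks[OF that _ nz[OF that]] \<sigma> that by (auto simp: PiE_iff)
      have o: "x \<in> open_cube d" using s x(1) by (auto simp: open_cube_def Rn_def PiE_iff)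
      moreover have "\<bar>x j - pt \<sigma> j\<bar> < \<delta> \<sigma>" if "j < d" for j using s[OF that] \<epsilon>(2)[OF \<sigma>] that by (simp add: pt_def)
      ultimately show ?thesis using \<delta>(2)[OF \<sigma>] open_cube_subset_cube by blast
    qed
    define J where "J \<sigma> = (LINT x|?M. indicator (open_cube d) x * f x * K \<sigma> x)" for \<sigma>
    have c0: "AE x in ?M. \<bar>indicator (open_cube d) x * f x\<bar> \<le> \<bar>c\<bar>"
      using AEf by eventually_elim (use open_cube_subset_cube in \<open>auto simp: indicator_def\<close>)
    have int: "integrable ?M (\<lambda>x. indicator (open_cube d) x * f x * K \<sigma> x)" if \<sigma>: "\<sigma> \<in> ?P" for \<sigma>
    proof (rule Bochner_Integration.integrable_bound)
      have "integrable ?M (K \<sigma>)" using K[OF \<sigma>] by (simp add: has_bochner_integral_iff)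
      then show "integrable ?M (\<lambda>x. \<bar>c\<bar> * K \<sigma> x)" "(\<lambda>x. indicator (open_cube d) x * f x * K \<sigma> x) \<in> borel_measurable ?M"
        using f_meas by (auto dest: borel_measurable_integrable)
      show "AE x in ?M. norm (indicator (open_cube d) x * f x * K \<sigma> x) \<le> norm (\<bar>c\<bar> * K \<sigma> x)"
        using c0
      proof eventually_elim
        case (elim x)
        then show ?case using K0[OF \<sigma>, of x] by (simp add: abs_mult mult_right_mono)
      qed
    qed
    have J: "\<bar>J \<sigma> - g (pt \<sigma>)\<bar> \<le> e" if \<sigma>: "\<sigma> \<in> ?P" for \<sigma>
    proof -
      have "integrable ?M (K \<sigma>)" "integral\<^sup>L ?M (K \<sigma>) = 1" using K[OF \<sigma>] by (auto simp: has_bochner_integral_iff)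
      then have "J \<sigma> - g (pt \<sigma>) = (LINT x|?M. indicator (open_cube d) x * f x * K \<sigma> x - g (pt \<sigma>) * K \<sigma> x)"
        unfolding J_def using int[OF \<sigma>] by simp
      also have "\<bar>\<dots>\<bar> \<le> e * 1"
      proof (rule abs_integral_le)
        show "has_bochner_integral ?M (\<lambda>x. e * K \<sigma> x) (e * 1)"
          by (rule has_bochner_integral_mult_right) (rule K[OF \<sigma>])
        show "AE x in ?M. \<bar>indicator (open_cube d) x * f x * K \<sigma> x - g (pt \<sigma>) * K \<sigma> x\<bar> \<le> e * K \<sigma> x"
          using AEg AE_space
        proof eventually_elim
          case (elim x)
          show ?case
          proof (cases "K \<sigma> x = 0")
            case False
            then have s: "x \<in> open_cube d" "\<bar>g (pt \<sigma>) - g x\<bar> < e"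
              using Ks[OF \<sigma>, of x] elim by (auto simp: space_lebesgue_Rn)
            then have "f x = g x" using elim open_cube_subset_cube by blast
            then have "indicator (open_cube d) x * f x * K \<sigma> x - g (pt \<sigma>) * K \<sigma> x = (g x - g (pt \<sigma>)) * K \<sigma> x"
              using s by (simp add: algebra_simps)
            also have "\<bar>\<dots>\<bar> = \<bar>g x - g (pt \<sigma>)\<bar> * K \<sigma> x" using K0[OF \<sigma>, of x] by (simp add: abs_mult)
            also have "\<dots> \<le> e * K \<sigma> x" using s(2) K0[OF \<sigma>, of x] by (intro mult_right_mono) auto
            finally show ?thesis .
          qed simp
        qed
      qed
      finally show ?thesis by simp
    qed
    have "(LINT x|?M. indicator (open_cube d) x * f x * (\<Sum>\<sigma>\<in>?P. C \<sigma> * K \<sigma> x)) = (\<Sum>\<sigma>\<in>?P. C \<sigma> * J \<sigma>)"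
    proof -
      have "(LINT x|?M. indicator (open_cube d) x * f x * (\<Sum>\<sigma>\<in>?P. C \<sigma> * K \<sigma> x)) =
        (LINT x|?M. (\<Sum>\<sigma>\<in>?P. C \<sigma> * (indicator (open_cube d) x * f x * K \<sigma> x)))"
        by (intro Bochner_Integration.integral_cong refl) (simp add: sum_distrib_left mult_ac)
      also have "\<dots> = (\<Sum>\<sigma>\<in>?P. LINT x|?M. C \<sigma> * (indicator (open_cube d) x * f x * K \<sigma> x))"
        by (rule Bochner_Integration.integral_sum) (use int in \<open>auto intro: integrable_mult_right\<close>)
      finally show ?thesis by (simp add: J_def)
    qed
    moreover have "\<bar>LINT x|?M. indicator (open_cube d) x * (w x * \<phi> x)\<bar> \<le> (\<Prod>j<d. h j * (2 * h j))"
    proof -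
      let ?v = "\<lambda>j x. h j * indicator {lo j..hi j} x :: real"
      have "has_bochner_integral ?M (tensor d ?v) (\<Prod>j<d. h j * (hi j - lo j))"
      proof (rule has_bochner_integral_tensor)
        fix j assume j: "j < d"
        have "has_bochner_integral lborel (indicator {lo j..hi j} :: real \<Rightarrow> real) (measure lborel {lo j..hi j})"
          by (rule has_bochner_integral_real_indicator) (auto simp: emeasure_lborel_Icc_eq)
        then show "has_bochner_integral lborel (?v j) (h j * (hi j - lo j))"
          using lohi(2)[OF j] by (auto intro!: has_bochner_integral_mult_right)
      qed
      moreover have "AE x in ?M. \<bar>indicator (open_cube d) x * (w x * \<phi> x)\<bar> \<le> tensor d ?v x"
        using AEw
      proof eventually_elim
        case (elim x)
        have "\<bar>\<phi> x\<bar> = (\<Prod>j<d. \<bar>\<eta> j (x j)\<bar>)" by (simp add: \<phi>_def tensor_def abs_prod)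
        also have "\<dots> \<le> tensor d ?v x" unfolding tensor_def
        proof (rule prod_mono)
          fix j assume "j \<in> {..<d}"
          then have j: "j < d" by simp
          show "0 \<le> \<bar>\<eta> j (x j)\<bar> \<and> \<bar>\<eta> j (x j)\<bar> \<le> ?v j (x j)"
            using out[OF j, of "x j"] bd[OF j, of "x j"] by (cases "x j \<in> {lo j..hi j}") auto
        qed
        finally have \<phi>v: "\<bar>\<phi> x\<bar> \<le> tensor d ?v x" .
        show ?case
        proof (cases "x \<in> open_cube d")
          case True
          then have "\<bar>w x\<bar> \<le> 1" using elim open_cube_subset_cube by blast
          then have "\<bar>w x\<bar> * \<bar>\<phi> x\<bar> \<le> 1 * \<bar>\<phi> x\<bar>" by (intro mult_right_mono) auto
          then show ?thesis using True \<phi>v by (simp add: abs_mult)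
        next
          case False
          then show ?thesis using \<phi>v by simp
        qed
      qed
      ultimately have "\<bar>LINT x|?M. indicator (open_cube d) x * (w x * \<phi> x)\<bar> \<le> (\<Prod>j<d. h j * (hi j - lo j))"
        by (rule abs_integral_le)
      also have "\<dots> \<le> (\<Prod>j<d. h j * (2 * h j))"
        using lohi h0 by (intro prod_mono conjI mult_nonneg_nonneg mult_left_mono) (auto simp: less_imp_le)
      finally show ?thesis .
    qed
    ultimately have "\<bar>\<Sum>\<sigma>\<in>?P. C \<sigma> * J \<sigma>\<bar> \<le> (1 / 2) ^ d * (1 / 4) ^ (\<Sum>j<d. m j)"
      using weak hprod by simp
    moreover have "\<bar>(\<Sum>\<sigma>\<in>?P. C \<sigma> * g (pt \<sigma>)) - (\<Sum>\<sigma>\<in>?P. C \<sigma> * J \<sigma>)\<bar> \<le> e * (\<Sum>\<sigma>\<in>?P. \<bar>C \<sigma>\<bar>)"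
    proof -
      have "(\<Sum>\<sigma>\<in>?P. C \<sigma> * g (pt \<sigma>)) - (\<Sum>\<sigma>\<in>?P. C \<sigma> * J \<sigma>) = (\<Sum>\<sigma>\<in>?P. C \<sigma> * (g (pt \<sigma>) - J \<sigma>))"
        by (simp add: sum_subtractf right_diff_distrib)
      also have "\<bar>\<dots>\<bar> \<le> (\<Sum>\<sigma>\<in>?P. \<bar>C \<sigma>\<bar> * e)"
        using J by (intro order_trans[OF sum_abs sum_mono]) (auto simp: abs_mult abs_minus_commute intro: mult_left_mono)
      finally show ?thesis by (simp add: sum_distrib_left mult.commute)
    qed
    ultimately show ?thesis by linarith
  qed
  have "\<bar>\<Sum>\<sigma>\<in>?P. C \<sigma> * g (pt \<sigma>)\<bar> \<le> (1 / 2) ^ d * (1 / 4) ^ (\<Sum>j<d. m j)"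
  proof (rule field_le_epsilon)
    fix t :: real assume "0 < t"
    \<comment> \<open>The error term goes to 0 with \<open>e = t / (s + 1)\<close>; adding 1 avoids
      a zero denominator.\<close>
    define s where "s = (\<Sum>\<sigma>\<in>?P. \<bar>C \<sigma>\<bar>)"
    have s: "0 \<le> s" by (simp add: s_def sum_nonneg)
    have "0 < t / (s + 1)" using \<open>0 < t\<close> s by simp
    moreover have "t / (s + 1) * s \<le> t" using \<open>0 < t\<close> s by (simp add: field_simps)
    ultimately show "\<bar>\<Sum>\<sigma>\<in>?P. C \<sigma> * g (pt \<sigma>)\<bar> \<le> (1 / 2) ^ d * (1 / 4) ^ (\<Sum>j<d. m j) + t"
      using key[of "t / (s + 1)"] unfolding s_def[symmetric] by linarith
  qed
  then show ?thesis by (simp add: hcoeff_def C_def pt_def)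
qed

subsection \<open>The approximating network\<close>

lemma net_grouped_sum:
  assumes "finite \<Lambda>" "card \<Lambda> \<le> S * P" "\<And>m. m \<in> \<Lambda> \<Longrightarrow> net G W D {k m}" "finite G"
  shows "net G (P * W + 2 * (card G + 1)) (S * D) {\<lambda>x. \<Sum>m\<in>\<Lambda>. k m x}"
proof -
  obtain e where e: "bij_betw e {..<card \<Lambda>} \<Lambda>"
    using ex_bij_betw_nat_finite[OF assms(1)] by (auto simp: atLeast0LessThan)
  \<comment> \<open>Places past \<open>card \<Lambda>\<close> hold the zero function, so that every
    round has exactly \<open>P\<close> members.\<close>
  define F where "F i = (\<lambda>x. if i < card \<Lambda> then k (e i) x else 0)" for i
  have F: "net G W D {F i}" for i
  proof (cases "i < card \<Lambda>")
    case True
    then have "e i \<in> \<Lambda>" using e by (auto simp: bij_betw_def)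
    then show ?thesis using assms(3) True by (simp add: F_def)
  next
    case False
    then show ?thesis by (intro net_aff[OF net_empty]) (auto simp: F_def intro: aff_const)
  qed
  have "net G (P * W) D {\<lambda>x. \<Sum>i\<in>{s * P..<s * P + P}. F i x}" for s
  proof -
    have "net G (card {s * P..<s * P + P} * W) D (\<Union>i\<in>{s * P..<s * P + P}. {F i})"
      by (rule net_UN) (use F in auto)
    then have "net G (P * W) D (\<Union>i\<in>{s * P..<s * P + P}. {F i})" by simp
    moreover have "(\<lambda>x. \<Sum>i\<in>{s * P..<s * P + P}. F i x) \<in> aff (\<Union>i\<in>{s * P..<s * P + P}. {F i})"
      by (intro aff_sum aff_base) blast
    ultimately show ?thesis by (auto elim: net_aff)
  qed
  from net_serial_sum[OF assms(4), of S, OF this]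
  have "net G (P * W + 2 * (card G + 1)) (S * D) {\<lambda>x. \<Sum>s<S. \<Sum>i\<in>{s * P..<s * P + P}. F i x}"
    by (rule net_subset) auto
  moreover have "(\<Sum>s<S. \<Sum>i\<in>{s * P..<s * P + P}. F i x) = (\<Sum>m\<in>\<Lambda>. k m x)" for x
  proof -
    have "(\<Sum>s<S. \<Sum>i\<in>{s * P..<s * P + P}. F i x) = (\<Sum>i<S * P. F i x)" by (rule sum.nat_group)
    also have "\<dots> = (\<Sum>i<card \<Lambda>. k (e i) x)"
      using assms(2) by (intro sum.mono_neutral_cong_right) (auto simp: F_def)
    also have "\<dots> = (\<Sum>m\<in>\<Lambda>. k m x)" by (rule sum.reindex_bij_betw[OF e])
    finally show ?thesis .
  qed
  ultimately show ?thesis by simp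
qed

text \<open>\<open>net_unit\<close> wants its inputs in \<open>[0,1]\<close> at every point, while
  the network lives on the whole space. One layer of clamping provides this and is the identity on
  the cube.\<close>

lemma net_clamp_inputs:
  "net ((\<lambda>i x. x i) ` {..<d}) (2 * d) 1 ((\<lambda>i x. clamp01 (x i)) ` {..<d})"
proof -
  have "net ((\<lambda>i x. x i) ` {..<d}) 2 1 {\<lambda>x. clamp01 (x i)}" if "i \<in> {..<d}" for i
    using that by (intro net_clamp01 aff_base) auto
  from net_UN[of "{..<d}" _ 2 1 "\<lambda>i. {\<lambda>x. clamp01 (x i)}", OF _ this] have "net ((\<lambda>i x. x i) ` {..<d}) (d * 2) 1 (\<Union>i\<in>{..<d}. {\<lambda>x. clamp01 (x i)})" by simp
  then show ?thesis by (simp add: mult.commute UNION_singleton_eq_range)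
qed

lemma finite_levels: "finite (levels d n)" and card_levels: "card (levels d n) \<le> (n + 1) ^ d"
proof -
  have fin: "finite (PiE {..<d} (\<lambda>_. {..n}))" by (intro finite_PiE) auto
  then show "finite (levels d n)" by (auto simp: levels_def)
  have "card (levels d n) \<le> card (PiE {..<d} (\<lambda>_. {..n}))" using fin by (intro card_mono) (auto simp: levels_def)
  then show "card (levels d n) \<le> (n + 1) ^ d" by (simp add: card_PiE)
qed

text \<open>A crude bound for \<open>(4 / 3) ^ d\<close>, but just what the factor
  \<open>(1 / 2) ^ d\<close> of the coefficients absorbs; the summed network errors then carry no
  exponential in \<open>d\<close>.\<close>

lemma sum_levels_le: "(\<Sum>m\<in>levels d n. (1 / 4) ^ (\<Sum>j<d. m j)) \<le> (2 :: real) ^ d"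
proof -
  have fin: "finite (PiE {..<d} (\<lambda>_. {..n}))" by (intro finite_PiE) auto
  have "(\<Sum>m\<in>levels d n. (1 / 4) ^ (\<Sum>j<d. m j)) \<le> (\<Sum>m\<in>PiE {..<d} (\<lambda>_. {..n}). (1 / 4 :: real) ^ (\<Sum>j<d. m j))"
    using fin by (intro sum_mono2) (auto simp: levels_def)
  also have "\<dots> = (\<Prod>j<d. \<Sum>k\<le>n. (1 / 4) ^ k)"
    unfolding power_sum by (rule prod_sum_PiE[symmetric]) auto
  also have "\<dots> = (\<Sum>k<Suc n. (1 / 4) ^ k) ^ d" by (simp add: lessThan_Suc_atMost)
  also have "\<dots> \<le> 2 ^ d"
    using geometric_sum_le[of "1 / 4" "Suc n"] by (intro power_mono order_trans[OF geometric_sum_le] sum_nonneg) auto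
  finally show ?thesis .
qed

text \<open>The levels are processed in \<open>S\<close> successive rounds of \<open>P\<close> parallel levels.\<close>

lemma sparse_grid_network:
  assumes d: "1 \<le> d" and \<alpha>: "1 \<le> \<alpha>" and PS: "(2 * \<alpha> + 2 * \<beta> + 1) ^ d \<le> S * P" and P: "1 \<le> P"
    and coeff: "\<And>m i. i \<in> cells d m \<Longrightarrow> \<bar>hcoeff d g m i\<bar> \<le> (1 / 2) ^ d * (1 / 4) ^ (\<Sum>j<d. m j)"
  shows "\<exists>k. net ((\<lambda>i x. x i) ` {..<d}) (P * (d * (5 * 2 ^ \<alpha> + 16)) + 2 * (d + 1)) (1 + S * unit_depth d \<beta>) {k} \<and>
    (\<forall>x\<in>cube d. \<bar>k x - (\<Sum>m\<in>levels d (2 * \<alpha> + 2 * \<beta>). hcoeff d g m (cell_of d m x) * bump d m x)\<bar>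
       \<le> (real d + 4) / 4 ^ (2 * \<alpha> + 2 * \<beta>))"
proof -
  let ?n = "2 * \<alpha> + 2 * \<beta>" and ?X = "(\<lambda>i x. x i) ` {..<d} :: ((nat \<Rightarrow> real) \<Rightarrow> real) set"
  define \<xi> where "\<xi> j = (\<lambda>x :: nat \<Rightarrow> real. clamp01 (x j))" for j
  define G where "G = \<xi> ` {..<d}"
  have G: "finite G" "card G \<le> d" using card_image_le[of "{..<d}" \<xi>] by (auto simp: G_def)
  \<comment> \<open>The coefficient bound is known for cells only. Extension by 0 makes it global
    and changes nothing on the cube, as \<open>bump\<close> vanishes where the index leaves the
    range.\<close>
  define v where "v m i = (if i \<in> cells d m then hcoeff d g m i else 0)" for m i
  define a :: real where "a = (1 / 2) ^ d"
  have a: "0 < a" by (simp add: a_def)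
  have v: "\<bar>v m i\<bar> \<le> a * (1 / 4) ^ (\<Sum>j<d. m j)" for m i
    using coeff[of i m] a by (auto simp: v_def a_def)
  have "\<forall>m\<in>levels d ?n. \<exists>k. net G (d * (5 * 2 ^ \<alpha> + 16)) (unit_depth d \<beta>) {k} \<and>
    (\<forall>x. \<bar>k x - v m (cell_of d m (\<lambda>j. \<xi> j x)) * bump d m (\<lambda>j. \<xi> j x)\<bar> \<le>
       a * (1 / 4) ^ (\<Sum>j<d. m j) * ((real d + 4) / 4 ^ ?n))"
  proof
    fix m assume "m \<in> levels d ?n"
    then have m: "(\<Sum>j<d. m j) \<le> ?n" by (simp add: levels_def)
    show "\<exists>k. net G (d * (5 * 2 ^ \<alpha> + 16)) (unit_depth d \<beta>) {k} \<and>
      (\<forall>x. \<bar>k x - v m (cell_of d m (\<lambda>j. \<xi> j x)) * bump d m (\<lambda>j. \<xi> j x)\<bar> \<le>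
        a * (1 / 4) ^ (\<Sum>j<d. m j) * ((real d + 4) / 4 ^ ?n))"
      by (rule net_unit[OF G_def _ refl \<alpha> d m v]) (use a in \<open>auto simp: \<xi>_def clamp01_bounds\<close>)
  qed
  then obtain k where k: "\<And>m. m \<in> levels d ?n \<Longrightarrow> net G (d * (5 * 2 ^ \<alpha> + 16)) (unit_depth d \<beta>) {k m}"
    "\<And>m x. m \<in> levels d ?n \<Longrightarrow> \<bar>k m x - v m (cell_of d m (\<lambda>j. \<xi> j x)) * bump d m (\<lambda>j. \<xi> j x)\<bar> \<le>
       a * (1 / 4) ^ (\<Sum>j<d. m j) * ((real d + 4) / 4 ^ ?n)" by metis
  let ?W = "P * (d * (5 * 2 ^ \<alpha> + 16)) + 2 * (d + 1)"
  have "net G (P * (d * (5 * 2 ^ \<alpha> + 16)) + 2 * (card G + 1)) (S * unit_depth d \<beta>) {\<lambda>x. \<Sum>m\<in>levels d ?n. k m x}"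
    by (rule net_grouped_sum[OF finite_levels order_trans[OF card_levels PS] k(1) G(1)])
  then have 1: "net G ?W (S * unit_depth d \<beta>) {\<lambda>x. \<Sum>m\<in>levels d ?n. k m x}"
    by (rule net_mono) (use G in simp)
  have "net ?X ?W 1 G"
    unfolding G_def \<xi>_def by (rule net_mono[OF net_clamp_inputs]) simp
  from net_trans[OF 1 this] have net: "net ?X ?W (1 + S * unit_depth d \<beta>) {\<lambda>x. \<Sum>m\<in>levels d ?n. k m x}" .
  have "\<bar>(\<Sum>m\<in>levels d ?n. k m x) - (\<Sum>m\<in>levels d ?n. hcoeff d g m (cell_of d m x) * bump d m x)\<bar>
      \<le> (real d + 4) / 4 ^ ?n" if x: "x \<in> cube d" for x
  proof -
    have xi: "\<xi> j x = x j" if "j < d" for j using x that by (auto simp: \<xi>_def cube_def PiE_iff clamp01_id)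
    have cell: "cell_of d m (\<lambda>j. \<xi> j x) = cell_of d m x" and bump: "bump d m (\<lambda>j. \<xi> j x) = bump d m x" for m
      using xi by (auto simp: cell_of_def bump_def fun_eq_iff intro!: prod.cong)
    have vb: "v m (cell_of d m x) * bump d m x = hcoeff d g m (cell_of d m x) * bump d m x" for m
      using bump_eq_0_of_not_cell[OF x, of m] by (auto simp: v_def)
    have "\<bar>(\<Sum>m\<in>levels d ?n. k m x) - (\<Sum>m\<in>levels d ?n. hcoeff d g m (cell_of d m x) * bump d m x)\<bar>
      \<le> (\<Sum>m\<in>levels d ?n. a * (1 / 4) ^ (\<Sum>j<d. m j) * ((real d + 4) / 4 ^ ?n))"
      unfolding sum_subtractf[symmetric]
      by (rule order_trans[OF sum_abs sum_mono]) (use k(2)[of _ x] in \<open>simp add: cell bump vb\<close>)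
    also have "\<dots> = a * (\<Sum>m\<in>levels d ?n. (1 / 4) ^ (\<Sum>j<d. m j)) * ((real d + 4) / 4 ^ ?n)"
      by (simp only: sum_distrib_left sum_distrib_right)
    also have "\<dots> \<le> a * 2 ^ d * ((real d + 4) / 4 ^ ?n)"
      using a by (intro mult_right_mono mult_left_mono sum_levels_le) auto
    also have "a * 2 ^ d = 1" by (simp add: a_def power_mult_distrib[symmetric])
    finally show ?thesis by simp
  qed
  with net show ?thesis by blast
qed

section \<open>Bookkeeping of sizes and rates\<close>

lemma power_of_2_below:
  assumes "1 \<le> (N :: nat)" obtains A where "2 ^ A \<le> N" "N < 2 ^ (A + 1)"
proof -
  define A where "A = nat \<lfloor>log 2 (real N)\<rfloor>"
  have l: "0 \<le> log 2 (real N)" using assms by simp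
  have "real A \<le> log 2 (real N)" "log 2 (real N) < real A + 1" using l by (auto simp: A_def)
  then have "2 powr real A \<le> real N" "real N < 2 powr (real A + 1)"
    using assms by (auto simp: le_log_iff log_less_iff)
  then have "real (2 ^ A) \<le> real N" "real N < real (2 ^ (A + 1))"
    by (simp_all add: powr_realpow powr_add)
  then show ?thesis by (intro that) (simp_all only: of_nat_le_iff of_nat_less_iff)
qed

text \<open>Halving \<open>\<beta> + 2\<close> in the number of rounds saves a factor
  \<open>2 ^ d\<close>, which pays for the factor \<open>1 + d\<close> in the depth of one level
  network.\<close>

lemma depth_bound:
  assumes "1 \<le> d" "2 ^ \<beta> \<le> L" "S = ((\<beta> + 2) div 2) ^ d"
  shows "1 + S * unit_depth d \<beta> \<le> (33 * L + 2) * (\<beta> + 2) ^ (d + 1) + 2 * d"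
proof -
  define t where "t = \<beta> + 2"
  have L: "1 \<le> L" using assms(2) one_le_power[of "2::nat" \<beta>] by linarith
  have "S * 2 ^ d = ((\<beta> + 2) div 2 * 2) ^ d" by (simp only: assms(3) power_mult_distrib)
  also have "\<dots> \<le> t ^ d" by (intro power_mono) (auto simp: t_def)
  finally have S: "S * 2 ^ d \<le> t ^ d" .
  have "unit_depth d \<beta> = 9 + 6 * \<beta> + 2 ^ \<beta> * (4 * t) + d * (3 + 2 * \<beta>)"
    by (simp add: unit_depth_def t_def algebra_simps)
  also have "\<dots> \<le> 6 * t + L * (4 * t) + d * (2 * t)"
    using assms(2) by (intro add_mono mult_mono) (auto simp: t_def)
  also have "\<dots> = t * (6 + 4 * L + 2 * d)" by (simp add: algebra_simps)
  also have "\<dots> \<le> t * ((33 * L + 2) * (1 + d))"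
    using L by (intro mult_left_mono) (auto simp: algebra_simps)
  also have "\<dots> \<le> t * ((33 * L + 2) * 2 ^ d)"
  proof (intro mult_left_mono)
    show "1 + d \<le> 2 ^ d" using less_exp[of d] by (simp add: Suc_le_eq)
  qed auto
  finally have "S * unit_depth d \<beta> \<le> S * (t * ((33 * L + 2) * 2 ^ d))" by (rule mult_left_mono) simp
  also have "\<dots> = (33 * L + 2) * t * (S * 2 ^ d)" by (simp only: mult_ac)
  also have "\<dots> \<le> (33 * L + 2) * t * t ^ d" using S by (rule mult_left_mono) simp
  also have "\<dots> = (33 * L + 2) * t ^ (d + 1)" by (simp only: power_Suc Suc_eq_plus1[symmetric] mult.assoc)
  finally have "S * unit_depth d \<beta> \<le> (33 * L + 2) * t ^ (d + 1)" .
  then show ?thesis using assms(1) unfolding t_def by linarith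
qed

text \<open>With \<open>r = 1 - 1 / (2 * Z)\<close> one has \<open>1 / (1 - r) = 2 * Z\<close>,
  which gives the power of the logarithms, while \<open>1 / r ^ \<nu>\<close> stays below
  \<open>exp 5 \<le> 3 ^ 5\<close> because \<open>\<nu> \<le> 5 * Z\<close>. The powers of 2 combine
  to 1/2, and \<open>1 / 2 * 4 / 3 * 243 = 162\<close>.\<close>

lemma tail_sum_rate:
  assumes "1 \<le> d" "d = 1 \<or> (1 \<le> X \<and> real \<nu> \<le> 5 * X)"
  shows "(1 / 2) ^ d * tail_sum d n \<nu> \<le> 162 * (1 / 4) ^ \<nu> * X ^ (d - 1)"
proof -
  \<comment> \<open>For \<open>d = 1\<close> the right-hand side contains only \<open>X ^ 0\<close>
    and \<open>X\<close> may be 0, so a \<open>Z\<close> of the size of \<open>\<nu>\<close>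
    replaces it.\<close>
  define Z where "Z = (if d = 1 then real \<nu> + 1 else X)"
  have Z: "1 \<le> Z" "real \<nu> \<le> 5 * Z" using assms(2) by (auto simp: Z_def)
  define y where "y = 1 / (2 * Z)"
  have y: "0 < y" "y \<le> 1 / 2" using Z by (auto simp: y_def field_simps)
  define r where "r = 1 - y"
  have r: "1 / 2 \<le> r" "r < 1" using y by (auto simp: r_def)
  define q where "q = 1 / (4 * r)"
  have qr: "q * r = 1 / 4" using r by (simp add: q_def)
  obtain d' where d': "d = Suc d'" using assms(1) by (cases d) auto
  have "- 2 * y \<le> ln r"
  proof -
    have "- y - 2 * y\<^sup>2 \<le> ln (1 - y)" using y by (intro ln_one_minus_pos_lower_bound) auto
    moreover have "2 * y\<^sup>2 \<le> y" using y by (simp add: power2_eq_square)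
    ultimately show ?thesis by (simp add: r_def)
  qed
  then have "real \<nu> * (- 2 * y) \<le> real \<nu> * ln r" by (intro mult_left_mono) auto
  moreover have "real \<nu> * (2 * y) \<le> 5" using Z by (simp add: y_def field_simps)
  ultimately have "- 5 \<le> real \<nu> * ln r" by linarith
  then have "exp (- 5) \<le> exp (real \<nu> * ln r)" by simp
  also have "\<dots> = r ^ \<nu>" using r by (simp add: exp_of_nat_mult)
  finally have rn: "exp (- 5) \<le> r ^ \<nu>" .
  have "q ^ \<nu> = (1 / 4) ^ \<nu> * (1 / r ^ \<nu>)" using r by (simp add: q_def power_divide power_mult_distrib)
  also have "1 / r ^ \<nu> \<le> 1 / exp (- 5)" using rn by (intro divide_left_mono) (use r in auto)
  also have "1 / exp (- 5 :: real) = exp 1 ^ 5" by (simp add: exp_minus exp_of_nat_mult[symmetric] inverse_eq_divide)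
  also have "\<dots> \<le> 3 ^ 5" using exp_le by (intro power_mono) auto
  finally have qn: "q ^ \<nu> \<le> (1 / 4) ^ \<nu> * 243" by simp
  have "tail_sum d n \<nu> \<le> 4 / 3 * q ^ \<nu> * (1 / (1 - r)) ^ d'"
    unfolding d' using r qr by (intro tail_sum_bound) auto
  also have "1 / (1 - r) = 2 * Z" using Z by (simp add: r_def y_def)
  finally have "(1 / 2) ^ d * tail_sum d n \<nu> \<le> (1 / 2) ^ d * (4 / 3 * q ^ \<nu> * (2 * Z) ^ d')"
    by (rule mult_left_mono) simp
  also have "\<dots> = 2 / 3 * Z ^ d' * q ^ \<nu>" by (simp add: d' power_mult_distrib power_one_over)
  also have "\<dots> \<le> 2 / 3 * Z ^ d' * ((1 / 4) ^ \<nu> * 243)" using Z qn by (intro mult_left_mono) auto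
  also have "\<dots> = 162 * (1 / 4) ^ \<nu> * Z ^ d'" by simp
  also have "Z ^ d' = X ^ (d - 1)" by (cases "d = 1") (auto simp: Z_def d')
  finally show ?thesis .
qed

section \<open>The norms and the continuous representative\<close>

lemma emeasure_lebesgue_cube: "emeasure (lebesgue_cube d) (space (lebesgue_cube d)) = 1"
proof -
  interpret product_sigma_finite "\<lambda>_ :: nat. lborel :: real measure" by (rule product_sigma_finite_lborel)
  have sub: "cube d \<subseteq> Rn d" by (auto simp: cube_def Rn_def)
  have "emeasure (lebesgue_cube d) (space (lebesgue_cube d)) = emeasure (lebesgue_Rn d) (cube d)"
    unfolding lebesgue_cube_def using sets_cube(1) sub
    by (simp add: space_restrict_space emeasure_restrict_space space_lebesgue_Rn Int_absorb2)
  also have "\<dots> = emeasure (borel_Rn d) (cube d)"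
  proof -
    have "cube d \<in> sets (borel_Rn d)" unfolding cube_def by (auto intro!: sets_PiM_I_finite)
    then show ?thesis unfolding lebesgue_Rn_def by simp
  qed
  also have "\<dots> = 1" unfolding cube_def by (subst emeasure_PiM) auto
  finally show ?thesis .
qed

text \<open>The cube has measure 1, so an almost everywhere bound \<open>E\<close> passes to every
  \<open>L_p\<close> norm without a constant.\<close>

lemma Lp_norm_le:
  assumes "1 \<le> p" "u \<in> borel_measurable (lebesgue_cube d)" "AE x in lebesgue_cube d. \<bar>u x\<bar> \<le> E" "0 \<le> E"
  shows "Lp_norm p (lebesgue_cube d) u \<le> ennreal E"
proof (cases "p = \<infinity>")
  case True
  have "(\<lambda>x. ennreal \<bar>u x\<bar>) \<in> borel_measurable (lebesgue_cube d)" using assms(2) by measurable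
  moreover have "AE x in lebesgue_cube d. ennreal \<bar>u x\<bar> \<le> ennreal E"
    using assms(3) by eventually_elim (simp add: ennreal_leI)
  ultimately show ?thesis using True by (auto simp: Lp_norm_def intro: esssup_I)
next
  case False
  define q where "q = enn2real p"
  have q: "1 \<le> q"
  proof -
    obtain r where r: "0 \<le> r" "p = ennreal r" using False by (cases p) auto
    have "ennreal 1 \<le> ennreal r" using assms(1) r(2) by simp
    then have "1 \<le> r" using r(1) by (subst (asm) ennreal_le_iff) auto
    then show ?thesis using r by (simp add: q_def)
  qed
  define I where "I = (\<integral>\<^sup>+ x. ennreal (\<bar>u x\<bar> powr q) \<partial>lebesgue_cube d)"
  have "I \<le> (\<integral>\<^sup>+ x. ennreal (E powr q) \<partial>lebesgue_cube d)" unfolding I_def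
    using assms(3) by (intro nn_integral_mono_AE, eventually_elim) (use q in \<open>auto intro!: ennreal_leI powr_mono2\<close>)
  also have "\<dots> = ennreal (E powr q)" by (simp add: emeasure_lebesgue_cube)
  finally have I: "I \<le> ennreal (E powr q)" .
  then have fin: "I \<noteq> \<infinity>" by (auto simp: top_unique)
  have "enn2real I \<le> E powr q" using enn2real_mono[OF I] by simp
  then have "enn2real I powr (1 / q) \<le> (E powr q) powr (1 / q)" using q by (intro powr_mono2) auto
  also have "\<dots> = E" using q assms(4) by (simp add: powr_powr)
  finally show ?thesis using False fin by (simp add: Lp_norm_def I_def[symmetric] q_def[symmetric] ennreal_leI)
qed

lemma korobov_representative:
  assumes "f \<in> korobov_space d" "korobov_norm d f \<le> 1"
  obtains g where "continuous_on (cube d) g" "AE x in lebesgue_cube d. f x = g x"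
    "\<And>x. x \<in> cube d - open_cube d \<Longrightarrow> g x = 0"
    "\<And>m i. i \<in> cells d m \<Longrightarrow> \<bar>hcoeff d g m i\<bar> \<le> (1 / 2) ^ d * (1 / 4) ^ (\<Sum>j<d. m j)"
proof -
  have f: "f \<in> L_infty (lebesgue_cube d)" using assms(1) by (simp add: korobov_space_def)
  have "zero_on_boundary d f" using assms(1) by (simp add: korobov_space_def)
  then obtain g where g: "continuous_on (cube d) g" "AE x in lebesgue_cube d. f x = g x"
    "\<forall>x\<in>cube d - open_cube d. g x = 0" unfolding zero_on_boundary_def by blast
  obtain c where c: "0 \<le> c" "AE x in lebesgue_cube d. \<bar>f x\<bar> \<le> c" using L_infty_bounded[OF f] .
  have fm: "f \<in> borel_measurable (lebesgue_cube d)" using f by (simp add: L_infty_def)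
  define w where "w = weak_deriv d (\<lambda>_. 2) f"
  have "\<forall>k. (\<forall>j<d. k j \<le> 2) \<longrightarrow> (\<exists>g. is_weak_deriv d k f g)"
    using assms(1) unfolding korobov_space_def by blast
  \<comment> \<open>Existence turns the \<open>SOME\<close> in \<open>weak_deriv\<close> into an
    actual weak derivative, the one whose norm is bounded.\<close>
  then have "\<exists>g. is_weak_deriv d (\<lambda>_. 2) f g" by simp
  then have w: "is_weak_deriv d (\<lambda>_. 2) f w" unfolding w_def weak_deriv_def by (rule someI_ex)
  have "esssup (lebesgue_cube d) (\<lambda>x. ennreal \<bar>w x\<bar>) \<le> ennreal 1"
    using assms(2) by (simp add: korobov_norm_def Lp_norm_def w_def)
  then have w1: "AE x in lebesgue_cube d. \<bar>w x\<bar> \<le> 1" by (rule esssup_bound) simp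
  show ?thesis
    by (rule that[of g]) (use g hcoeff_bound[OF fm c(2) g(1,2) w w1] in auto)
qed

lemma coordinate_measurable: "i < d \<Longrightarrow> (\<lambda>x. x i) \<in> borel_measurable (lebesgue_cube d)"
proof -
  assume "i < d"
  then have "(\<lambda>x. x i) \<in> measurable (borel_Rn d) lborel" by (intro measurable_component_singleton) auto
  then have "(\<lambda>x. x i) \<in> borel_measurable (borel_Rn d)" by simp
  then show ?thesis unfolding lebesgue_cube_def lebesgue_Rn_def
    by (intro measurable_restrict_space1 measurable_completion)
qed

theorem theorem2:
  shows "\<exists>C :: nat \<Rightarrow> real.
    (\<exists>P :: real poly. \<forall>d\<ge>1. 0 < C d \<and> C d \<le> poly P (real d)) \<and>
    (\<forall>(d::nat) (N::nat) (L::nat) (f :: (nat \<Rightarrow> real) \<Rightarrow> real).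
       1 \<le> d \<longrightarrow> 1 \<le> N \<longrightarrow> 1 \<le> L \<longrightarrow> (d = 1 \<or> 2 \<le> N \<and> 2 \<le> L) \<longrightarrow>
       f \<in> korobov_space d \<longrightarrow> korobov_norm d f \<le> 1 \<longrightarrow>
       (\<exists>k. relu_network d
              (3 ^ d * (64 * real d * (real N + 3) * (log 2 (8 * real N)) ^ (d + 1)))
              ((33 * real L + 2) * (log 2 (4 * real L)) ^ (d + 1) + 2 * real d) k \<and>
            (\<forall>p::ennreal. 1 \<le> p \<longrightarrow>
               Lp_norm p (lebesgue_cube d) (\<lambda>x. k x - f x)
                 \<le> ennreal (C d * real N powi (-4) * real L powi (-4) *
                            (log 2 (real N)) ^ (d - 1) * (log 2 (real L)) ^ (d - 1)))))"
proof (rule exI[of _ "\<lambda>d. poly [:11520, 256:] (real d)"], rule conjI)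
  show "\<exists>P :: real poly. \<forall>d\<ge>1. 0 < poly [:11520, 256:] (real d) \<and> poly [:11520, 256:] (real d) \<le> poly P (real d)"
    by (rule exI[of _ "[:11520, 256:]"]) (simp add: add_pos_nonneg)
next
  \<comment> \<open>This is \<open>256 * (d + 45)\<close>: \<open>256 = 2 ^ 8\<close> is lost by
    rounding \<open>N\<close> and \<open>L\<close> down to powers of two in the fourth powers,
    \<open>d + 4\<close> comes from the network, and 41, just above \<open>162 / 4\<close>, from the
    omitted levels.\<close>
  let ?P = "[:11520, 256:] :: real poly"
  show "\<forall>(d::nat) (N::nat) (L::nat) (f :: (nat \<Rightarrow> real) \<Rightarrow> real).
       1 \<le> d \<longrightarrow> 1 \<le> N \<longrightarrow> 1 \<le> L \<longrightarrow> (d = 1 \<or> 2 \<le> N \<and> 2 \<le> L) \<longrightarrow>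
       f \<in> korobov_space d \<longrightarrow> korobov_norm d f \<le> 1 \<longrightarrow>
       (\<exists>k. relu_network d
              (3 ^ d * (64 * real d * (real N + 3) * (log 2 (8 * real N)) ^ (d + 1)))
              ((33 * real L + 2) * (log 2 (4 * real L)) ^ (d + 1) + 2 * real d) k \<and>
            (\<forall>p::ennreal. 1 \<le> p \<longrightarrow>
               Lp_norm p (lebesgue_cube d) (\<lambda>x. k x - f x)
                 \<le> ennreal (poly ?P (real d) * real N powi (-4) * real L powi (-4) *
                            (log 2 (real N)) ^ (d - 1) * (log 2 (real L)) ^ (d - 1))))"
  proof (intro allI impI)
    fix d N L :: nat and f :: "(nat \<Rightarrow> real) \<Rightarrow> real"
    assume d: "1 \<le> d" and N: "1 \<le> N" and L: "1 \<le> L" and dNL: "d = 1 \<or> 2 \<le> N \<and> 2 \<le> L"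
      and f: "f \<in> korobov_space d" and fn: "korobov_norm d f \<le> 1"
    obtain A where A: "2 ^ A \<le> N" "N < 2 ^ (A + 1)" using power_of_2_below[OF N] .
    obtain \<beta> where B: "2 ^ \<beta> \<le> L" "L < 2 ^ (\<beta> + 1)" using power_of_2_below[OF L] .
    \<comment> \<open>The base \<open>2 ^ \<alpha>\<close> must be at least 2, also for
      \<open>N = 1\<close>.\<close>
    define \<alpha> where "\<alpha> = max A 1"
    define n where "n = 2 * \<alpha> + 2 * \<beta>"
    define s where "s = (\<beta> + 2) div 2"
    \<comment> \<open>\<open>P\<close> and \<open>S\<close> share out at most
      \<open>(n + 1) ^ d\<close> levels so that the width sees only \<open>log N\<close> and the
      depth only \<open>log L\<close>. The 3 here becomes the factor \<open>3 ^ d\<close> of the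
      width.\<close>
    define P where "P = (3 * (A + 3)) ^ d"
    define S where "S = s ^ d"
    have \<alpha>: "1 \<le> \<alpha>" "A \<le> \<alpha>" by (auto simp: \<alpha>_def)
    have PS: "(2 * \<alpha> + 2 * \<beta> + 1) ^ d \<le> S * P"
    proof -
      have s2: "\<beta> + 1 \<le> 2 * s" "1 \<le> s" by (auto simp: s_def)
      have "A * 1 \<le> A * s" using s2 by (intro mult_left_mono) auto
      moreover have "s * (3 * (A + 3)) = 3 * (A * s) + 9 * s" by (simp add: algebra_simps)
      moreover have "\<alpha> \<le> A + 1" by (simp add: \<alpha>_def)
      ultimately have "2 * \<alpha> + 2 * \<beta> + 1 \<le> s * (3 * (A + 3))" using s2 by linarith
      then show ?thesis unfolding S_def P_def power_mult_distrib[symmetric] by (rule power_mono) simp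
    qed
    have P1: "1 \<le> P" by (simp add: P_def)
    obtain g where g: "continuous_on (cube d) g" "AE x in lebesgue_cube d. f x = g x"
      "\<And>x. x \<in> cube d - open_cube d \<Longrightarrow> g x = 0"
      "\<And>m i. i \<in> cells d m \<Longrightarrow> \<bar>hcoeff d g m i\<bar> \<le> (1 / 2) ^ d * (1 / 4) ^ (\<Sum>j<d. m j)"
      using korobov_representative[OF f fn] by metis
    from sparse_grid_network[OF d \<alpha>(1) PS P1 g(4)] obtain k where
      k: "net ((\<lambda>i x. x i) ` {..<d}) (P * (d * (5 * 2 ^ \<alpha> + 16)) + 2 * (d + 1)) (1 + S * unit_depth d \<beta>) {k}"
      "\<And>x. x \<in> cube d \<Longrightarrow> \<bar>k x - (\<Sum>m\<in>levels d n. hcoeff d g m (cell_of d m x) * bump d m x)\<bar> \<le> (real d + 4) / 4 ^ n"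
      unfolding n_def by blast
    have logN: "real A + 3 \<le> log 2 (8 * real N)" "real A \<le> log 2 (real N)" "log 2 (real N) \<le> real A + 1"
    proof -
      have r: "(2 :: real) ^ A \<le> real N" "real N \<le> 2 ^ (A + 1)"
        using of_nat_mono[OF A(1), where 'a = real] of_nat_mono[OF less_imp_le[OF A(2)], where 'a = real] by simp_all
      show "real A \<le> log 2 (real N)" using r(1) N by (simp add: le_log_iff powr_realpow)
      have "log 2 (real N) \<le> log 2 (2 ^ (A + 1))" using r(2) N by (subst log_le_cancel_iff) auto
      then show "log 2 (real N) \<le> real A + 1" by (subst (asm) log_pow_cancel) auto
      have "log 2 (8 * real N) = log 2 (2 ^ 3) + log 2 (real N)" using N by (simp add: log_mult)
      moreover have "log 2 ((2 :: real) ^ 3) = 3" by (subst log_pow_cancel) auto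
      ultimately show "real A + 3 \<le> log 2 (8 * real N)" using \<open>real A \<le> log 2 (real N)\<close> by linarith
    qed
    have logL: "real \<beta> + 2 \<le> log 2 (4 * real L)" "real \<beta> \<le> log 2 (real L)"
    proof -
      have r: "(2 :: real) ^ \<beta> \<le> real L" using of_nat_mono[OF B(1), where 'a = real] by simp
      show "real \<beta> \<le> log 2 (real L)" using r L by (simp add: le_log_iff powr_realpow)
      have "log 2 (4 * real L) = log 2 (2 ^ 2) + log 2 (real L)" using L by (simp add: log_mult)
      moreover have "log 2 ((2 :: real) ^ 2) = 2" by (subst log_pow_cancel) auto
      ultimately show "real \<beta> + 2 \<le> log 2 (4 * real L)" using \<open>real \<beta> \<le> log 2 (real L)\<close> by linarith
    qed
    show "\<exists>k. relu_network d
        (3 ^ d * (64 * real d * (real N + 3) * (log 2 (8 * real N)) ^ (d + 1)))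
        ((33 * real L + 2) * (log 2 (4 * real L)) ^ (d + 1) + 2 * real d) k \<and>
        (\<forall>p::ennreal. 1 \<le> p \<longrightarrow> Lp_norm p (lebesgue_cube d) (\<lambda>x. k x - f x)
          \<le> ennreal (poly ?P (real d) * real N powi (-4) * real L powi (-4) *
              (log 2 (real N)) ^ (d - 1) * (log 2 (real L)) ^ (d - 1)))"
    proof (intro exI[of _ k] conjI allI impI)
      show "relu_network d
        (3 ^ d * (64 * real d * (real N + 3) * (log 2 (8 * real N)) ^ (d + 1)))
        ((33 * real L + 2) * (log 2 (4 * real L)) ^ (d + 1) + 2 * real d) k"
      proof (rule relu_network_of_net[OF k(1)])
        show "k \<in> aff {k}" by (intro aff_base) simp
        \<comment> \<open>The critical case is \<open>A = 0\<close>: then \<open>N = 1\<close> and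
          \<open>2 ^ \<alpha> = 2\<close>.\<close>
        have "2 ^ \<alpha> \<le> N + 1" using A N by (cases "A = 0") (auto simp: \<alpha>_def max_def)
        then have "P * (d * (5 * 2 ^ \<alpha> + 16)) \<le> P * (d * (5 * N + 21))" by (intro mult_left_mono) auto
        moreover have "2 * (d + 1) \<le> P * (d * 4)"
        proof -
          have "2 * (d + 1) \<le> 1 * (d * 4)" using d by simp
          also have "\<dots> \<le> P * (d * 4)" using P1 by (rule mult_right_mono) simp
          finally show ?thesis .
        qed
        ultimately have "P * (d * (5 * 2 ^ \<alpha> + 16)) + 2 * (d + 1) \<le> P * (d * (5 * N + 25))"
          by (simp add: algebra_simps)
        also have "\<dots> \<le> P * (64 * d * (N + 3))" by (intro mult_left_mono) (auto simp: algebra_simps)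
        finally have "real (P * (d * (5 * 2 ^ \<alpha> + 16)) + 2 * (d + 1)) \<le> real (P * (64 * d * (N + 3)))"
          by (rule of_nat_mono)
        also have "\<dots> = 3 ^ d * (64 * real d * (real N + 3) * (real A + 3) ^ d)"
        proof -
          have "real P = 3 ^ d * (real A + 3) ^ d" by (simp add: P_def flip: power_mult_distrib)
          then show ?thesis by simp
        qed
        also have "\<dots> \<le> 3 ^ d * (64 * real d * (real N + 3) * log 2 (8 * real N) ^ (d + 1))"
        proof (intro mult_left_mono)
          have "(real A + 3) ^ d \<le> (real A + 3) ^ (d + 1)" by (intro power_increasing) auto
          also have "\<dots> \<le> log 2 (8 * real N) ^ (d + 1)" using logN(1) by (intro power_mono) auto
          finally show "(real A + 3) ^ d \<le> log 2 (8 * real N) ^ (d + 1)" .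
        qed auto
        finally show "real (P * (d * (5 * 2 ^ \<alpha> + 16)) + 2 * (d + 1))
            \<le> 3 ^ d * (64 * real d * (real N + 3) * log 2 (8 * real N) ^ (d + 1))" .
        have "real (1 + S * unit_depth d \<beta>) \<le> real ((33 * L + 2) * (\<beta> + 2) ^ (d + 1) + 2 * d)"
          using depth_bound[OF d B(1), of S] by (intro of_nat_mono) (simp add: S_def s_def)
        also have "\<dots> = (33 * real L + 2) * (real \<beta> + 2) ^ (d + 1) + 2 * real d"
          by (simp only: of_nat_add of_nat_mult of_nat_power of_nat_numeral)
        also have "\<dots> \<le> (33 * real L + 2) * (log 2 (4 * real L)) ^ (d + 1) + 2 * real d"
          using logL(1) by (intro add_right_mono mult_left_mono power_mono) auto
        finally show "real (1 + S * unit_depth d \<beta>) \<le> (33 * real L + 2) * (log 2 (4 * real L)) ^ (d + 1) + 2 * real d" .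
      qed
      fix p :: ennreal assume p: "1 \<le> p"
      define X where "X = log 2 (real N) * log 2 (real L)"
      define E where "E = (real d + 45) / 4 ^ n * X ^ (d - 1)"
      \<comment> \<open>For \<open>d \<ge> 2\<close> both logarithms \<open>a\<close>,
        \<open>b\<close> are at least 1, so \<open>a + b \<le> a * b + 1\<close> and
        \<open>n + 1 \<le> 2 * a * b + 3 \<le> 5 * a * b\<close>.\<close>
      have X: "d = 1 \<or> (1 \<le> X \<and> real (n + 1) \<le> 5 * X)"
      proof (cases "d = 1")
        case False
        then have NL: "2 \<le> N" "2 \<le> L" using dNL by auto
        have "A \<noteq> 0" using A(2) NL(1) by (intro notI) simp
        then have "\<alpha> = A" by (simp add: \<alpha>_def)
        define a b where "a = log 2 (real N)" and "b = log 2 (real L)"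
        have ab: "1 \<le> a" "1 \<le> b" using NL by (auto simp: a_def b_def)
        have "real (n + 1) \<le> 2 * a + 2 * b + 1" using logN(2) logL(2) \<open>\<alpha> = A\<close> by (simp add: n_def a_def b_def)
        moreover have "0 \<le> (a - 1) * (b - 1)" using ab by simp
        then have "a + b \<le> a * b + 1" by (simp add: algebra_simps)
        moreover have "1 * 1 \<le> a * b" using ab by (intro mult_mono) auto
        ultimately show ?thesis by (simp add: X_def a_def[symmetric] b_def[symmetric])
      qed simp
      have X1: "1 \<le> X ^ (d - 1)" using X by (auto intro: one_le_power)
      have kg: "\<bar>k x - g x\<bar> \<le> E" if x: "x \<in> cube d" for x
      proof -
        \<comment> \<open>\<open>sparse_grid_error\<close> takes a bound on the tail sum itself, so
          the factor \<open>2 ^ d\<close> is inserted here and cancels against the coefficient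
          bound.\<close>
        have "\<bar>g x - (\<Sum>m\<in>levels d n. hcoeff d g m (cell_of d m x) * bump d m x)\<bar>
            \<le> (1 / 2) ^ d * (2 ^ d * (162 * (1 / 4) ^ (n + 1) * X ^ (d - 1)))"
        proof (rule sparse_grid_error[OF x g(3) continuous_on_cube_delta[OF g(1) x] g(4)])
          fix j
          have "2 ^ d * ((1 / 2) ^ d * tail_sum d j (n + 1)) \<le> 2 ^ d * (162 * (1 / 4) ^ (n + 1) * X ^ (d - 1))"
            by (intro mult_left_mono tail_sum_rate[OF d X]) auto
          moreover have "2 ^ d * ((1 / 2) ^ d * tail_sum d j (n + 1)) = tail_sum d j (n + 1)"
            by (simp add: power_one_over)
          ultimately show "tail_sum d j (n + 1) \<le> 2 ^ d * (162 * (1 / 4) ^ (n + 1) * X ^ (d - 1))" by (simp only:)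
        qed auto
        also have "\<dots> = 162 / 4 / 4 ^ n * X ^ (d - 1)" by (simp add: power_one_over)
        also have "\<dots> \<le> 41 / 4 ^ n * X ^ (d - 1)" using X1 by (intro mult_right_mono divide_right_mono) auto
        finally have "\<bar>g x - (\<Sum>m\<in>levels d n. hcoeff d g m (cell_of d m x) * bump d m x)\<bar> \<le> 41 / 4 ^ n * X ^ (d - 1)" .
        moreover have "(real d + 4) / 4 ^ n * 1 \<le> (real d + 4) / 4 ^ n * X ^ (d - 1)"
          using X1 by (intro mult_left_mono) auto
        moreover have "E = (real d + 4) / 4 ^ n * X ^ (d - 1) + 41 / 4 ^ n * X ^ (d - 1)"
          by (simp add: E_def algebra_simps add_divide_distrib)
        ultimately show ?thesis using k(2)[OF x] by linarith
      qed
      have "AE x in lebesgue_cube d. \<bar>k x - f x\<bar> \<le> E"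
        using g(2) AE_space
      proof eventually_elim
        case (elim x)
        then have "x \<in> cube d" by (simp add: lebesgue_cube_def space_restrict_space)
        then show ?case using kg elim by simp
      qed
      moreover have "(\<lambda>x. k x - f x) \<in> borel_measurable (lebesgue_cube d)"
      proof (rule borel_measurable_diff)
        show "k \<in> borel_measurable (lebesgue_cube d)"
          by (rule net_measurable[OF k(1)]) (auto intro: coordinate_measurable)
        show "f \<in> borel_measurable (lebesgue_cube d)" using f by (simp add: korobov_space_def L_infty_def)
      qed
      moreover have "0 \<le> E" using X1 by (simp add: E_def)
      ultimately have "Lp_norm p (lebesgue_cube d) (\<lambda>x. k x - f x) \<le> ennreal E" using Lp_norm_le[OF p] by blast
      also have "E \<le> poly ?P (real d) * real N powi (-4) * real L powi (-4) * log 2 (real N) ^ (d - 1) * log 2 (real L) ^ (d - 1)"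
      proof -
        have "real N ^ 4 * real L ^ 4 \<le> (2 ^ (A + 1)) ^ 4 * (2 ^ (\<beta> + 1)) ^ 4"
          using of_nat_mono[OF less_imp_le[OF A(2)], where 'a = real] of_nat_mono[OF less_imp_le[OF B(2)], where 'a = real]
          by (intro mult_mono power_mono) auto
        also have "\<dots> = 256 * 2 ^ (4 * A + 4 * \<beta>)" by (simp add: power_add power_mult[symmetric] mult.commute power_mult_distrib)
        also have "\<dots> \<le> 256 * (2 :: real) ^ (2 * n)" using \<alpha>(2) by (intro mult_left_mono power_increasing) (auto simp: n_def)
        also have "\<dots> = 256 * 4 ^ n" by (simp add: power_mult)
        finally have NL: "real N ^ 4 * real L ^ 4 \<le> 256 * 4 ^ n" .
        have pos: "0 < real N ^ 4 * real L ^ 4" using N L by simp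
        have "1 / 4 ^ n \<le> 256 / (real N ^ 4 * real L ^ 4)" using NL pos by (simp add: field_simps)
        then have "(real d + 45) * X ^ (d - 1) * (1 / 4 ^ n) \<le> (real d + 45) * X ^ (d - 1) * (256 / (real N ^ 4 * real L ^ 4))"
          using X1 by (intro mult_left_mono) auto
        moreover have "real N powi (-4) = 1 / real N ^ 4" "real L powi (-4) = 1 / real L ^ 4"
          by (simp_all add: power_int_def inverse_eq_divide power_one_over)
        ultimately show ?thesis by (simp add: E_def X_def power_mult_distrib field_simps)
      qed
      finally show "Lp_norm p (lebesgue_cube d) (\<lambda>x. k x - f x) \<le> ennreal (poly ?P (real d) * real N powi (-4) * real L powi (-4) *
              (log 2 (real N)) ^ (d - 1) * (log 2 (real L)) ^ (d - 1))"
        using ennreal_leI by (meson order_trans)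
    qed
  qed
qed

end
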